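(* Let $w\in S_\infty$ and let $\varphi$ be a flag. The weak Edelman–Greene insertion map $\rho^{(\bullet)}\mapsto(\hat P(\rho^{(\bullet)}),\hat Q(\rho^{(\bullet)}))$ is a bijection $$\mathrm{RFC}(w,\varphi)\longrightarrow\bigsqcup_\alpha\big(\mathrm{YR}_\alpha(w)\times\mathrm{SSKT}(\alpha,\varphi)\big),$$ where $\alpha$ ranges over all weak compositions such that $\mathrm{YR}_\alpha(w)$ is nonempty.
   Context: $S_\infty$: permutations of $\mathbb{Z}_{>0}$ fixing all but finitely many points; $s_i$ swaps $i,i+1$; $i_1\cdots i_m$ is a reduced word for $w$ if $w=s_{i_1}\cdots s_{i_m}$ with $m$ minimal. An increasing factorization $\rho^{(\bullet)}=(\rho^{(k)}|\cdots|\rho^{(1)})$ of $\rho$ writes $\rho=\rho^{(k)}\cdots\rho^{(1)}$ with consecutive, possibly empty, strictly increasing subwords. A flag is a weakly increasing $\varphi:\mathbb{Z}_{>0}\to\mathbb{Z}_{>0}$ with $\varphi(m)\ge m$. $\rho^{(\bullet)}$ is $\varphi$-flagged if $\varphi(\rho^{(i)}_1)\ge i$ whenever $\rho^{(i)}$ is nonempty ($\rho^{(i)}_1$ its first letter). $\mathrm{RFC}(w,\varphi)$ is the set of $\varphi$-flagged increasing factorizations of reduced words for $w$ (factorizations differing only by empty components at the left end identified). Coxeter–Knuth equivalence $\sim$: transitive closure of $\mathbf a xyz\mathbf b\sim\mathbf a xzy\mathbf b$ ($y<x<z$), $\mathbf a xyz\mathbf b\sim\mathbf a yxz\mathbf b$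 ($y<z<x$), $\mathbf a\, i(i+1)i\,\mathbf b\sim\mathbf a\,(i+1)i(i+1)\,\mathbf b$. Tableaux are fillings by positive integers of finite sets of boxes (row $r\in\mathbb{Z}$, column $c\in\mathbb{Z}_{>0}$), rows left-justified, rows indexed upward; the shape (when all rows have positive index) is the weak composition of row lengths; $T_{rc}$ denotes an entry. Weak descent tableau $\mathsf{WeakDesTab}(\rho)$: with run factorization (maximal strictly increasing runs) $(\sigma^{(k)}|\cdots|\sigma^{(1)})$, place $\sigma^{(k)}$ in row $\sigma^{(k)}_1$; for $i=k-1,\dots,1$ place $\sigma^{(i)}$ in row $\sigma^{(i)}_1$ if that is below the row of $\sigma^{(i+1)}$, else directly below the row of $\sigma^{(i+1)}$. Virtual: uses a non-positive row; else $\mathrm{des}(\rho)$ is its shape. $\mu\le\nu$ iff $\sum_{i\le k}\mu_i\le\sum_{i\le k}\nu_i$ for all $k$; for non-virtual reduced words $\rho\le\tau$ iff $\rho\sim\tau$ and $\mathrm{des}(\rho)\le\mathrm{des}(\tau)$; each $\sim$-class has a unique non-virtual $\le$-minimal element, called Yamanouchi. $\hat P(\rho^{(\bullet)})=\hat P(\rho):=\mathsf{WeakDesTab}(\hat\rho)$ for the Yamanouchi word $\hat\rho\sim\rho$. $\mathrm{YR}_\alpha(w)$ is the set of Yamanouchi reduced words $\sigma$ for $w$ with $\mathrm{des}(\sigma)=\alpha$; a Yamanouchi word is identified with its weak descent tableau (so $\hat P(\rho^{(\bullet)})$ is regarded as an element of $\mathrm{YR}_{\alpha}(w)$). It is known that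 if $\sigma x$ is reduced then the diagram of $\hat P(\sigma x)$ is that of $\hat P(\sigma)$ plus one box. $\hat Q(\rho^{(\bullet)})$ is the filling of the diagram of $\hat P(\rho)$ in which a box has entry $i$ iff it lies in the diagram of $\hat P(\rho^{(k)}\cdots\rho^{(i)})$ but not in that of $\hat P(\rho^{(k)}\cdots\rho^{(i+1)})$. A key tableau is a tableau $T$ such that (a) rows weakly decrease left to right; (b) columns have distinct entries; (c) if $T$ contains $(i,j),(k,j)$ with $i<k$ and $T_{ij}>T_{kj}$, then $T$ contains $(i,j+1)$ and $T_{i,j+1}>T_{kj}$. It is $\varphi$-flagged if $T_{ij}\le\varphi(i)$ for all its boxes. $\mathrm{SSKT}(\alpha,\varphi)$ is the set of $\varphi$-flagged key tableaux of shape $\alpha$ (all rows of positive index). *)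

theory Defs
  imports "HOL-Combinatorics.Transposition" "HOL-Combinatorics.Permutations"
begin

definition S_inf :: "(nat \<Rightarrow> nat) set" where
  "S_inf = {w. w permutes {1..} \<and> finite {i. w i \<noteq> i}}"

definition simple_refl :: "nat \<Rightarrow> nat \<Rightarrow> nat" where
  "simple_refl i = transpose i (Suc i)"

definition word_perm :: "nat list \<Rightarrow> nat \<Rightarrow> nat" where
  "word_perm \<rho> = foldr (\<lambda>i w. simple_refl i \<circ> w) \<rho> id"

definition word_for :: "(nat \<Rightarrow> nat) \<Rightarrow> nat list \<Rightarrow> bool" where
  "word_for w \<rho> \<longleftrightarrow> set \<rho> \<subseteq> {1..} \<and> word_perm \<rho> = w"

definition reduced_word_for :: "(nat \<Rightarrow> nat) \<Rightarrow> nat list \<Rightarrow> bool" where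
  "reduced_word_for w \<rho> \<longleftrightarrow>
     word_for w \<rho> \<and> (\<forall>\<tau>. word_for w \<tau> \<longrightarrow> length \<rho> \<le> length \<tau>)"

definition reduced :: "nat list \<Rightarrow> bool" where
  "reduced \<rho> \<longleftrightarrow> (\<exists>w. reduced_word_for w \<rho>)"

inductive ck_step :: "nat list \<Rightarrow> nat list \<Rightarrow> bool" where
  "y < x \<Longrightarrow> x < z \<Longrightarrow> ck_step (a @ [x, y, z] @ b) (a @ [x, z, y] @ b)"
| "y < z \<Longrightarrow> z < x \<Longrightarrow> ck_step (a @ [x, y, z] @ b) (a @ [y, x, z] @ b)"
| "ck_step (a @ [i, Suc i, i] @ b) (a @ [Suc i, i, Suc i] @ b)"

definition ck_equiv :: "nat list \<Rightarrow> nat list \<Rightarrow> bool" (infix "\<sim>\<^sub>C\<^sub>K" 50) where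
  "ck_equiv = equivclp ck_step"

text \<open>The value of a flag at 0 is irrelevant.\<close>

definition flag :: "(nat \<Rightarrow> nat) \<Rightarrow> bool" where
  "flag \<phi> \<longleftrightarrow> mono_on {1..} \<phi> \<and> (\<forall>m\<ge>1. m \<le> \<phi> m)"

text \<open>
  The factorization \<open>(\<rho>\<^sup>(\<^sup>k\<^sup>)|\<dots>|\<rho>\<^sup>(\<^sup>1\<^sup>))\<close> is the list \<open>[\<rho>\<^sup>(\<^sup>k\<^sup>), \<dots>, \<rho>\<^sup>(\<^sup>1\<^sup>)]\<close>, so the list is indexed
  from the right, starting at 1.
\<close>

definition component :: "nat list list \<Rightarrow> nat \<Rightarrow> nat list" where
  "component f i = f ! (length f - i)"

text \<open>The word \<open>\<rho>\<^sup>(\<^sup>k\<^sup>)\<dots>\<rho>\<^sup>(\<^sup>i\<^sup>)\<close>, which is empty for \<open>i = k + 1\<close>.\<close>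

definition upper_word :: "nat list list \<Rightarrow> nat \<Rightarrow> nat list" where
  "upper_word f i = concat (take (Suc (length f) - i) f)"

definition increasing_factorization :: "nat list \<Rightarrow> nat list list \<Rightarrow> bool" where
  "increasing_factorization \<rho> f \<longleftrightarrow> concat f = \<rho> \<and> (\<forall>s\<in>set f. sorted_wrt (<) s)"

definition flagged_factorization :: "(nat \<Rightarrow> nat) \<Rightarrow> nat list list \<Rightarrow> bool" where
  "flagged_factorization \<phi> f \<longleftrightarrow>
     (\<forall>i\<in>{1..length f}. component f i \<noteq> [] \<longrightarrow> i \<le> \<phi> (hd (component f i)))"

text \<open>
  Factorizations that differ by empty components at the left end are identified; each class is
  represented by its unique member whose leftmost component, if there is one, is nonempty.
\<close>

definition RFC :: "(nat \<Rightarrow> nat) \<Rightarrow> (nat \<Rightarrow> nat) \<Rightarrow> nat list list set" where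
  "RFC w \<phi> = {f. (\<exists>\<rho>. reduced_word_for w \<rho> \<and> increasing_factorization \<rho> f) \<and>
                 flagged_factorization \<phi> f \<and> (f \<noteq> [] \<longrightarrow> hd f \<noteq> [])}"

text \<open>
  A tableau maps boxes (row, column) to entries; its diagram is the domain of the map. Rows are
  indexed upward.
\<close>

type_synonym tableau = "int \<times> nat \<Rightarrow> nat option"

definition is_tableau :: "tableau \<Rightarrow> bool" where
  "is_tableau T \<longleftrightarrow> finite (dom T) \<and> (\<forall>(r, c)\<in>dom T. 1 \<le> c) \<and>
     (\<forall>r c c'. (r, c) \<in> dom T \<longrightarrow> 1 \<le> c' \<longrightarrow> c' \<le> c \<longrightarrow> (r, c') \<in> dom T) \<and>
     (\<forall>x\<in>ran T. 1 \<le> x)"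

definition positive_rows :: "tableau \<Rightarrow> bool" where
  "positive_rows T \<longleftrightarrow> (\<forall>(r, c)\<in>dom T. 0 < r)"

text \<open>Weak compositions are indexed by the positive integers and have the value 0 at index 0.\<close>

definition weak_composition :: "(nat \<Rightarrow> nat) \<Rightarrow> bool" where
  "weak_composition \<alpha> \<longleftrightarrow> \<alpha> 0 = 0 \<and> finite {i. \<alpha> i \<noteq> 0}"

definition shape :: "tableau \<Rightarrow> nat \<Rightarrow> nat" where
  "shape T i = card {c. (int i, c) \<in> dom T}"

definition dominance_le :: "(nat \<Rightarrow> nat) \<Rightarrow> (nat \<Rightarrow> nat) \<Rightarrow> bool" where
  "dominance_le \<mu> \<nu> \<longleftrightarrow> (\<forall>k. (\<Sum>i=1..k. \<mu> i) \<le> (\<Sum>i=1..k. \<nu> i))"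

fun runs :: "nat list \<Rightarrow> nat list list" where
  "runs [] = []"
| "runs (x # xs) = (case runs xs of
     [] \<Rightarrow> [[x]]
   | r # rs \<Rightarrow> if x < hd r then (x # r) # rs else [x] # r # rs)"

text \<open>The first argument is the row of the run preceding the given ones.\<close>

fun place_below :: "int \<Rightarrow> nat list list \<Rightarrow> (int \<times> nat list) list" where
  "place_below p [] = []"
| "place_below p (s # ss) =
     (let r = (if int (hd s) < p then int (hd s) else p - 1) in (r, s) # place_below r ss)"

fun place_runs :: "nat list list \<Rightarrow> (int \<times> nat list) list" where
  "place_runs [] = []"
| "place_runs (s # ss) = (int (hd s), s) # place_below (int (hd s)) ss"

definition WeakDesTab :: "nat list \<Rightarrow> tableau" where
  "WeakDesTab \<rho> = (\<lambda>(r, c). case map_of (place_runs (runs \<rho>)) r of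
     None \<Rightarrow> None
   | Some s \<Rightarrow> if 1 \<le> c \<and> c \<le> length s then Some (s ! (c - 1)) else None)"

definition virtual :: "nat list \<Rightarrow> bool" where
  "virtual \<rho> \<longleftrightarrow> \<not> positive_rows (WeakDesTab \<rho>)"

text \<open>Meaningful only for non-virtual words.\<close>

definition des :: "nat list \<Rightarrow> nat \<Rightarrow> nat" where
  "des \<rho> = shape (WeakDesTab \<rho>)"

definition word_le :: "nat list \<Rightarrow> nat list \<Rightarrow> bool" where
  "word_le \<rho> \<tau> \<longleftrightarrow> \<rho> \<sim>\<^sub>C\<^sub>K \<tau> \<and> dominance_le (des \<rho>) (des \<tau>)"

definition Yamanouchi :: "nat list \<Rightarrow> bool" where
  "Yamanouchi \<rho> \<longleftrightarrow> reduced \<rho> \<and> \<not> virtual \<rho> \<and>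
     (\<forall>\<tau>. reduced \<tau> \<longrightarrow> \<not> virtual \<tau> \<longrightarrow> word_le \<tau> \<rho> \<longrightarrow> \<tau> = \<rho>)"

definition YR :: "(nat \<Rightarrow> nat) \<Rightarrow> (nat \<Rightarrow> nat) \<Rightarrow> nat list set" where
  "YR \<alpha> w = {\<sigma>. reduced_word_for w \<sigma> \<and> Yamanouchi \<sigma> \<and> des \<sigma> = \<alpha>}"

definition hat_word :: "nat list \<Rightarrow> nat list" where
  "hat_word \<rho> = (THE \<sigma>. Yamanouchi \<sigma> \<and> \<sigma> \<sim>\<^sub>C\<^sub>K \<rho>)"

definition P_hat_word :: "nat list \<Rightarrow> tableau" where
  "P_hat_word \<rho> = WeakDesTab (hat_word \<rho>)"

definition P_hat :: "nat list list \<Rightarrow> tableau" where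
  "P_hat f = P_hat_word (concat f)"

definition Q_hat :: "nat list list \<Rightarrow> tableau" where
  "Q_hat f = (\<lambda>b. if b \<in> dom (P_hat f)
     then Some (THE i. i \<in> {1..length f} \<and>
                  b \<in> dom (P_hat_word (upper_word f i)) \<and>
                  b \<notin> dom (P_hat_word (upper_word f (i + 1))))
     else None)"

definition key_tableau :: "tableau \<Rightarrow> bool" where
  "key_tableau T \<longleftrightarrow> is_tableau T \<and>
     (\<forall>r c c' x y. c < c' \<longrightarrow> T (r, c) = Some x \<longrightarrow> T (r, c') = Some y \<longrightarrow> y \<le> x) \<and>
     (\<forall>r r' c x y. r \<noteq> r' \<longrightarrow> T (r, c) = Some x \<longrightarrow> T (r', c) = Some y \<longrightarrow> x \<noteq> y) \<and>
     (\<forall>i k j x y. i < k \<longrightarrow> T (i, j) = Some x \<longrightarrow> T (k, j) = Some y \<longrightarrow> x > y \<longrightarrow>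
        (\<exists>z. T (i, j + 1) = Some z \<and> z > y))"

definition flagged_tableau :: "(nat \<Rightarrow> nat) \<Rightarrow> tableau \<Rightarrow> bool" where
  "flagged_tableau \<phi> T \<longleftrightarrow> (\<forall>i j x. T (i, j) = Some x \<longrightarrow> x \<le> \<phi> (nat i))"

definition SSKT :: "(nat \<Rightarrow> nat) \<Rightarrow> (nat \<Rightarrow> nat) \<Rightarrow> tableau set" where
  "SSKT \<alpha> \<phi> = {T. key_tableau T \<and> positive_rows T \<and> shape T = \<alpha> \<and> flagged_tableau \<phi> T}"

text \<open>
  \<open>YR\<close> under the identification of a Yamanouchi word with its weak descent tableau. A disjoint union
  over \<open>\<alpha>\<close> is a set of triples \<open>(\<alpha>, P, Q)\<close>, and the insertion map puts \<open>(P_hat f, Q_hat f)\<close> into the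
  summand indexed by the shape of \<open>P_hat f\<close>.
\<close>

definition YR_tab :: "(nat \<Rightarrow> nat) \<Rightarrow> (nat \<Rightarrow> nat) \<Rightarrow> tableau set" where
  "YR_tab \<alpha> w = WeakDesTab ` YR \<alpha> w"

end

theory Submission
  imports Defs
begin

text \<open>
  Words are studied through Edelman--Greene row insertion. For a reduced word \<open>\<rho>\<close> with insertion
  tableau of \<open>l\<close> rows, there is a unique class of words \<open>\<rho>\<^sup>-\<close> such that \<open>\<rho> \<sim> \<rho>\<^sup>- d\<close> with \<open>d\<close> decreasing of
  length \<open>l\<close> and every row of the insertion tableau of \<open>\<rho>\<^sup>-\<close> one box shorter. Adding up the indicator
  functions of the first columns of the insertion tableaux of \<open>\<rho>, \<rho>\<^sup>-, \<rho>\<^sup>-\<^sup>-, \<dots>\<close> gives a weak composition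
  \<open>alpha \<rho>\<close>. The crucial fact is that \<open>alpha (\<sigma>x)\<close> arises from \<open>alpha \<sigma>\<close> by adding a box in the column
  of the new box of the insertion tableau, in the lowest row of the resulting length. Hence the
  sequence of diagrams \<open>alpha\<close> and the usual recording tableau determine each other, and condition (c)
  for key tableaux expresses exactly the rule for the row of a new box. The flag conditions agree
  because the nonempty rows of \<open>alpha \<rho>\<close> are letters of \<open>\<rho>\<close> and include the smallest one.

  Applied to the identity flag, this correspondence shows that every flagged increasing factorization
  of a word equivalent to \<open>\<rho>\<close> has weight at least \<open>alpha \<rho>\<close> in dominance order, with equality only for
  the one whose recording tableau has the constant entry \<open>r\<close> in each row \<open>r\<close>. Its word is therefore
  the Yamanouchi word, and \<open>alpha \<rho>\<close> is the diagram of the weak insertion tableau.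
\<close>

subsection \<open>Reduced words and Coxeter--Knuth equivalence\<close>

text \<open>The obstacle is that Yamanouchi words are given by a minimality condition, so there is
  no direct rule for how \<open>hat_word\<close> changes when a letter is appended. The proof
  therefore never follows these words. It follows \<open>alpha\<close>, which depends only on the
  Coxeter--Knuth class, and compares it with \<open>des\<close> only after its growth rule is
  available. The growth rule has two sources. If the new box of the insertion tableau lies outside
  the first column, peeling the first column commutes with appending the letter and moves the box
  one column to the left; so everything reduces to a box that opens a new row. In that case the
  appended letter is the last letter of the peeled decreasing word. The letters of a decreasing word
  create first-column values in decreasing order, so the new value lies below every present row of
  length one. This is why the lowest row appears in the rule.\<close>

lemma word_perm_Nil [simp]: "word_perm [] = id"
  by (simp add: word_perm_def)

lemma word_perm_Cons [simp]: "word_perm (x # a) = simple_refl x \<circ> word_perm a"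
  by (simp add: word_perm_def)

lemma word_perm_append [simp]: "word_perm (a @ b) = word_perm a \<circ> word_perm b"
  by (induction a) (simp_all add: comp_assoc)

lemma simple_refl_self: "simple_refl i \<circ> simple_refl i = id"
  by (simp add: simple_refl_def)

lemma simple_refl_commute:
  assumes "Suc i < j"
  shows "simple_refl i \<circ> simple_refl j = simple_refl j \<circ> simple_refl i"
  using assms by (auto simp: simple_refl_def transpose_def fun_eq_iff)

lemma simple_refl_braid:
  "simple_refl i \<circ> (simple_refl (Suc i) \<circ> simple_refl i) =
   simple_refl (Suc i) \<circ> (simple_refl i \<circ> simple_refl (Suc i))"
  by (auto simp: simple_refl_def transpose_def fun_eq_iff)

lemma ck_step_word_perm: "ck_step a b \<Longrightarrow> word_perm a = word_perm b"
proof (induction rule: ck_step.induct)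
  case (1 y x z a b)
  then have "simple_refl y \<circ> simple_refl z = simple_refl z \<circ> simple_refl y"
    by (intro simple_refl_commute) simp
  then show ?case by (simp flip: comp_assoc)
next
  case (2 y z x a b)
  then have "simple_refl y \<circ> simple_refl x = simple_refl x \<circ> simple_refl y"
    by (intro simple_refl_commute) simp
  then show ?case by (simp flip: comp_assoc)
next
  case (3 a i b)
  have "word_perm ([i, Suc i, i]) = word_perm [Suc i, i, Suc i]"
    using simple_refl_braid[of i] by simp
  then show ?case by (simp only: word_perm_append)
qed

lemma ck_step_length: "ck_step a b \<Longrightarrow> length a = length b"
  by (induction rule: ck_step.induct) auto

lemma ck_step_set: "ck_step a b \<Longrightarrow> set a = set b"
  by (induction rule: ck_step.induct) auto

lemma ck_step_context: "ck_step a b \<Longrightarrow> ck_step (u @ a @ v) (u @ b @ v)"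
proof (induction rule: ck_step.induct)
  case (1 y x z a b)
  then show ?case using ck_step.intros(1)[of y x z "u @ a" "b @ v"] by simp
next
  case (2 y z x a b)
  then show ?case using ck_step.intros(2)[of y z x "u @ a" "b @ v"] by simp
next
  case (3 a i b)
  then show ?case using ck_step.intros(3)[of "u @ a" i "b @ v"] by simp
qed

lemma ck_refl [simp]: "a \<sim>\<^sub>C\<^sub>K a"
  by (simp add: ck_equiv_def)

lemma ck_sym: "a \<sim>\<^sub>C\<^sub>K b \<Longrightarrow> b \<sim>\<^sub>C\<^sub>K a"
  unfolding ck_equiv_def by (rule equivclp_sym)

lemma ck_trans [trans]: "a \<sim>\<^sub>C\<^sub>K b \<Longrightarrow> b \<sim>\<^sub>C\<^sub>K c \<Longrightarrow> a \<sim>\<^sub>C\<^sub>K c"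
  unfolding ck_equiv_def by (rule equivclp_trans)

lemma ck_equiv_step: "ck_step a b \<Longrightarrow> a \<sim>\<^sub>C\<^sub>K b"
  unfolding ck_equiv_def by blast

lemma ck_equiv_invariant:
  assumes "a \<sim>\<^sub>C\<^sub>K b" and "\<And>a b. ck_step a b \<Longrightarrow> f a = f b"
  shows "f a = f b"
  using assms(1) unfolding ck_equiv_def
  by (induction rule: equivclp_induct) (use assms(2) in metis)+

lemma ck_equiv_word_perm: "a \<sim>\<^sub>C\<^sub>K b \<Longrightarrow> word_perm a = word_perm b"
  by (erule ck_equiv_invariant) (rule ck_step_word_perm)

lemma ck_equiv_length: "a \<sim>\<^sub>C\<^sub>K b \<Longrightarrow> length a = length b"
  by (erule ck_equiv_invariant) (rule ck_step_length)

lemma ck_equiv_set: "a \<sim>\<^sub>C\<^sub>K b \<Longrightarrow> set a = set b"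
  by (erule ck_equiv_invariant) (rule ck_step_set)

lemma ck_equiv_context: "a \<sim>\<^sub>C\<^sub>K b \<Longrightarrow> u @ a @ v \<sim>\<^sub>C\<^sub>K u @ b @ v"
  unfolding ck_equiv_def
proof (induction rule: equivclp_induct)
  case base
  then show ?case by simp
next
  case (step y z)
  then have "equivclp ck_step (u @ y @ v) (u @ z @ v)"
    using ck_step_context by (metis converse_r_into_equivclp r_into_equivclp)
  then show ?case using step.IH equivclp_trans by metis
qed

lemma ck_equiv_append: "a \<sim>\<^sub>C\<^sub>K a' \<Longrightarrow> b \<sim>\<^sub>C\<^sub>K b' \<Longrightarrow> a @ b \<sim>\<^sub>C\<^sub>K a' @ b'"
  using ck_equiv_context[of a a' "[]" b] ck_equiv_context[of b b' a' "[]"] ck_trans by simp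

lemma reduced_iff: "reduced \<rho> \<longleftrightarrow> reduced_word_for (word_perm \<rho>) \<rho>"
  by (auto simp: reduced_def reduced_word_for_def word_for_def)

lemma reduced_ck: "a \<sim>\<^sub>C\<^sub>K b \<Longrightarrow> reduced a \<Longrightarrow> reduced b"
  using ck_equiv_word_perm[of a b] ck_equiv_length[of a b] ck_equiv_set[of a b]
  by (simp add: reduced_iff reduced_word_for_def word_for_def)

lemma reduced_word_for_ck: "a \<sim>\<^sub>C\<^sub>K b \<Longrightarrow> reduced_word_for w a \<Longrightarrow> reduced_word_for w b"
  using ck_equiv_word_perm[of a b] ck_equiv_length[of a b] ck_equiv_set[of a b]
  by (simp add: reduced_word_for_def word_for_def)

text \<open>A shorter word for the factor could be substituted for \<open>b\<close> and would
  shorten the whole word without changing its permutation.\<close>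

lemma reduced_factor:
  assumes "reduced (a @ b @ c)"
  shows "reduced b"
proof -
  have "length b \<le> length \<tau>" if "set \<tau> \<subseteq> {1..}" "word_perm \<tau> = word_perm b" for \<tau>
  proof -
    have "word_for (word_perm (a @ b @ c)) (a @ \<tau> @ c)"
      using assms that by (simp add: reduced_iff reduced_word_for_def word_for_def)
    then show ?thesis
      using assms by (auto simp: reduced_iff reduced_word_for_def)
  qed
  then show ?thesis using assms by (auto simp: reduced_iff reduced_word_for_def word_for_def)
qed

lemma reduced_prefix: "reduced (a @ b) \<Longrightarrow> reduced a"
  using reduced_factor[of "[]" a b] by simp

lemma reduced_suffix: "reduced (a @ b) \<Longrightarrow> reduced b"
  using reduced_factor[of a b "[]"] by simp

lemma reduced_Nil [simp]: "reduced []"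
  by (simp add: reduced_iff reduced_word_for_def word_for_def)

lemma reduced_pos: "reduced a \<Longrightarrow> x \<in> set a \<Longrightarrow> 1 \<le> x"
  by (auto simp: reduced_iff reduced_word_for_def word_for_def)

lemma not_reduced_square: "\<not> reduced (a @ [x, x] @ b)"
proof
  assume "reduced (a @ [x, x] @ b)"
  then have "reduced [x, x]" by (rule reduced_factor)
  then have "length [x, x] \<le> length ([] :: nat list)"
    unfolding reduced_iff reduced_word_for_def
    by (metis word_for_def word_perm_Cons word_perm_Nil comp_id simple_refl_self empty_subsetI
        list.set(1))
  then show False by simp
qed

lemma not_reduced_commuting_square:
  assumes "Suc x < y"
  shows "\<not> reduced (a @ [x, y, x] @ b)"
proof
  assume "reduced (a @ [x, y, x] @ b)"
  then have r: "reduced [x, y, x]" by (rule reduced_factor)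
  have "word_perm [x, y, x] = simple_refl x \<circ> simple_refl x \<circ> simple_refl y"
    by (simp add: comp_assoc simple_refl_commute[OF assms])
  also have "\<dots> = word_perm [y]" by (simp add: simple_refl_self)
  finally have "word_for (word_perm [x, y, x]) [y]"
    using reduced_pos[OF r] by (simp add: word_for_def)
  then have "length [x, y, x] \<le> length [y]"
    using r unfolding reduced_iff reduced_word_for_def by blast
  then show False by simp
qed

subsection \<open>Edelman--Greene row insertion\<close>

definition bump :: "nat set \<Rightarrow> nat \<Rightarrow> nat option" where
  "bump S x = (if \<exists>y\<in>S. x < y then Some (LEAST y. y \<in> S \<and> x < y) else None)"

text \<open>Inserting \<open>x \<in> S\<close> into a row \<open>S\<close> leaves the row unchanged; for reduced words the bumped value is
  then \<open>Suc x\<close>, and this case corresponds to a braid move.\<close>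

definition newrow :: "nat set \<Rightarrow> nat \<Rightarrow> nat set" where
  "newrow S x = (if x \<in> S then S else
     case bump S x of None \<Rightarrow> insert x S | Some y \<Rightarrow> insert x (S - {y}))"

abbreviation row_word :: "nat set \<Rightarrow> nat list" where
  "row_word S \<equiv> sorted_list_of_set S"

lemma bump_None_iff: "bump S x = None \<longleftrightarrow> (\<forall>z\<in>S. z \<le> x)"
  by (auto simp: bump_def not_le)

lemma bump_Some_iff:
  "bump S x = Some y \<longleftrightarrow> y \<in> S \<and> x < y \<and> (\<forall>z\<in>S. x < z \<longrightarrow> y \<le> z)"
proof
  assume a: "bump S x = Some y"
  then have ex: "\<exists>y. y \<in> S \<and> x < y" by (auto simp: bump_def split: if_splits)
  have y: "y = (LEAST y. y \<in> S \<and> x < y)" using a by (auto simp: bump_def split: if_splits)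
  show "y \<in> S \<and> x < y \<and> (\<forall>z\<in>S. x < z \<longrightarrow> y \<le> z)"
    unfolding y using LeastI_ex[OF ex] by (auto intro: Least_le)
next
  assume "y \<in> S \<and> x < y \<and> (\<forall>z\<in>S. x < z \<longrightarrow> y \<le> z)"
  moreover from this have "(LEAST y. y \<in> S \<and> x < y) = y" by (intro Least_equality) auto
  ultimately show "bump S x = Some y" by (auto simp: bump_def)
qed

lemma newrow_None: "bump S x = None \<Longrightarrow> newrow S x = insert x S"
  by (auto simp: newrow_def)

lemma newrow_Some: "bump S x = Some y \<Longrightarrow> newrow S x = (if x \<in> S then S else insert x (S - {y}))"
  by (auto simp: newrow_def)

lemma in_newrow [simp]: "x \<in> newrow S x"
  by (auto simp: newrow_def split: option.splits)

lemma finite_newrow [simp]: "finite S \<Longrightarrow> finite (newrow S x)"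
  by (auto simp: newrow_def split: option.splits)

lemma row_word_Un:
  assumes "finite A" "finite B" "\<And>a b. a \<in> A \<Longrightarrow> b \<in> B \<Longrightarrow> a < b"
  shows "row_word (A \<union> B) = row_word A @ row_word B"
proof (rule sorted_distinct_set_unique)
  show "sorted (row_word A @ row_word B)" "distinct (row_word A @ row_word B)"
    using assms by (fastforce simp: sorted_append less_imp_le)+
qed (use assms in auto)

text \<open>\<open>x\<close> moves left through \<open>B\<close> by the first relation: when it
  passes \<open>b\<close>, the letter \<open>p\<close> just before \<open>b\<close> satisfies
  \<open>x < p < b\<close> and acts as the witness.\<close>

lemma ck_move_small_left:
  assumes "sorted_wrt (<) (y # B)" "x < y"
  shows "y # B @ [x] \<sim>\<^sub>C\<^sub>K y # x # B"
  using assms(1)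
proof (induction B rule: rev_induct)
  case (snoc b B)
  obtain u p where p: "y # B = u @ [p]" by (metis append_butlast_last_id list.distinct(1))
  have "x < p" "p < b" using snoc.prems p assms(2)
    by (auto simp: sorted_wrt_append append_eq_Cons_conv Cons_eq_append_conv)
  then have "u @ [p, b, x] @ [] \<sim>\<^sub>C\<^sub>K u @ [p, x, b] @ []"
    by (intro ck_sym[OF ck_equiv_step] ck_step.intros)
  then have a: "(y # B) @ [b, x] \<sim>\<^sub>C\<^sub>K (y # B) @ [x, b]" unfolding p by simp
  have b: "(y # B @ [x]) @ [b] \<sim>\<^sub>C\<^sub>K (y # x # B) @ [b]"
    using snoc by (intro ck_equiv_append ck_refl snoc.IH) (auto simp: sorted_wrt_append)
  show ?case using ck_trans[OF a[simplified] b[simplified]] by simp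
qed simp

text \<open>Dually, \<open>y\<close> moves left through \<open>A\<close> by the second relation; the
  witness is the letter on the right, which lies between the passed letter and
  \<open>y\<close>.\<close>

lemma ck_move_large_left:
  assumes "sorted_wrt (<) (A @ [x])" "x < y"
  shows "A @ [y, x] \<sim>\<^sub>C\<^sub>K y # A @ [x]"
  using assms
proof (induction A arbitrary: x rule: rev_induct)
  case (snoc a A)
  then have a: "A @ [y, a, x] @ [] \<sim>\<^sub>C\<^sub>K A @ [a, y, x] @ []"
    by (intro ck_equiv_step ck_step.intros) (auto simp: sorted_wrt_append)
  have b: "(A @ [y, a]) @ [x] \<sim>\<^sub>C\<^sub>K (y # A @ [a]) @ [x]"
    using snoc by (intro ck_equiv_append ck_refl snoc.IH) (auto simp: sorted_wrt_append)
  show ?case using ck_trans[OF ck_sym[OF a[simplified]] b[simplified]] by simp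
qed simp

text \<open>If \<open>x\<close> were in \<open>S\<close> it would be the maximum, and the row
  followed by \<open>x\<close> would end in a square.\<close>

lemma row_insert_append:
  assumes "finite S" "reduced (row_word S @ [x])" "bump S x = None"
  shows "x \<notin> S" "row_word (newrow S x) = row_word S @ [x]"
proof -
  show x: "x \<notin> S"
  proof
    assume "x \<in> S"
    then have "row_word S = row_word ((S - {x}) \<union> {x})" by (simp add: insert_absorb)
    also have "\<dots> = row_word (S - {x}) @ row_word {x}"
      by (rule row_word_Un) (use assms(1,3) in \<open>auto simp: bump_None_iff le_neq_implies_less\<close>)
    finally have "row_word S @ [x] = row_word (S - {x}) @ [x, x] @ []" by simp
    then show False using assms(2) not_reduced_square by metis
  qed
  have "row_word (S \<union> {x}) = row_word S @ row_word {x}"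
    by (rule row_word_Un) (use assms(1,3) x in \<open>auto simp: bump_None_iff order.order_iff_strict\<close>)
  then show "row_word (newrow S x) = row_word S @ [x]" using assms by (simp add: newrow_None)
qed

text \<open>\<open>x\<close> first moves left until it follows \<open>y\<close>; then
  \<open>y\<close> moves to the front, after a braid move in case \<open>x\<close> is already
  present. The equivalence assumes \<open>x \<in> S \<longrightarrow> y = Suc x\<close> instead of
  reducedness because inverse insertion knows only the right-hand word to be reduced and uses the
  equivalence to obtain reducedness of the left-hand one.\<close>

lemma row_bump:
  assumes "finite S" "bump S x = Some y"
  shows "reduced (row_word S @ [x]) \<Longrightarrow> x \<in> S \<Longrightarrow> y = Suc x"
    and "(x \<in> S \<longrightarrow> y = Suc x) \<Longrightarrow> row_word S @ [x] \<sim>\<^sub>C\<^sub>K y # row_word (newrow S x)"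
proof -
  define A where "A = row_word (S \<inter> {..<x})"
  define B where "B = row_word (S \<inter> {y<..})"
  note y = assms(2)[unfolded bump_Some_iff]
  then have xy: "x < y" and yS: "y \<in> S" by auto
  have cover: "z < x \<or> z = x \<or> z = y \<or> y < z" if "z \<in> S" for z
    using y that by (metis nat_neq_iff order_le_less)
  have split: "row_word S = A @ (if x \<in> S then [x] else []) @ y # B"
  proof -
    have "row_word ({y} \<union> (S \<inter> {y<..})) = row_word {y} @ row_word (S \<inter> {y<..})"
      by (rule row_word_Un) (use assms(1) in auto)
    moreover have "row_word ((S \<inter> {x}) \<union> ({y} \<union> (S \<inter> {y<..}))) =
        row_word (S \<inter> {x}) @ row_word ({y} \<union> (S \<inter> {y<..}))"
      by (rule row_word_Un) (use assms(1) xy in auto)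
    moreover have "row_word ((S \<inter> {..<x}) \<union> ((S \<inter> {x}) \<union> ({y} \<union> (S \<inter> {y<..})))) =
        row_word (S \<inter> {..<x}) @ row_word ((S \<inter> {x}) \<union> ({y} \<union> (S \<inter> {y<..})))"
      by (rule row_word_Un) (use assms(1) xy in auto)
    moreover have "(S \<inter> {..<x}) \<union> ((S \<inter> {x}) \<union> ({y} \<union> (S \<inter> {y<..}))) = S"
      using cover yS by auto
    ultimately have "row_word S = row_word (S \<inter> {..<x}) @ row_word (S \<inter> {x}) @ row_word {y} @ row_word (S \<inter> {y<..})"
      by (simp only:)
    then show ?thesis by (simp add: A_def B_def)
  qed
  have sB: "sorted_wrt (<) (y # B)" using assms(1) by (simp add: B_def)
  have sA: "sorted_wrt (<) (A @ [x])" using assms(1) by (simp add: A_def sorted_wrt_append)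
  have "(A @ (if x \<in> S then [x] else [])) @ (y # B @ [x]) \<sim>\<^sub>C\<^sub>K (A @ (if x \<in> S then [x] else [])) @ (y # x # B)"
    by (intro ck_equiv_append ck_refl ck_move_small_left sB xy)
  then have 1: "row_word S @ [x] \<sim>\<^sub>C\<^sub>K A @ (if x \<in> S then [x] else []) @ y # x # B"
    unfolding split by (simp only: append_assoc append_Cons append_Nil)
  show "y = Suc x" if "reduced (row_word S @ [x])" "x \<in> S"
  proof (rule ccontr)
    assume "y \<noteq> Suc x"
    then have "\<not> reduced (A @ [x, y, x] @ B)" using xy by (intro not_reduced_commuting_square) auto
    moreover have "reduced (A @ [x, y, x] @ B)" using reduced_ck[OF 1] that by simp
    ultimately show False by simp
  qed
  show "row_word S @ [x] \<sim>\<^sub>C\<^sub>K y # row_word (newrow S x)" if y_Suc: "x \<in> S \<longrightarrow> y = Suc x"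
  proof (cases "x \<in> S")
    case True
    then have [simp]: "y = Suc x" using y_Suc by simp
    note 1
    also have "A @ (if x \<in> S then [x] else []) @ y # x # B = A @ [x, Suc x, x] @ B"
      using True by simp
    also have "\<dots> \<sim>\<^sub>C\<^sub>K A @ [Suc x, x, Suc x] @ B"
      by (intro ck_equiv_step ck_step.intros)
    also have "\<dots> = (A @ [y, x]) @ (y # B)" by simp
    also have "\<dots> \<sim>\<^sub>C\<^sub>K (y # A @ [x]) @ (y # B)"
      by (intro ck_equiv_append ck_move_large_left sA xy ck_refl)
    also have "\<dots> = y # row_word (newrow S x)"
      using True split by (simp add: newrow_def)
    finally show ?thesis .
  next
    case False
    have e1: "row_word ({x} \<union> (S \<inter> {y<..})) = row_word {x} @ row_word (S \<inter> {y<..})"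
      by (rule row_word_Un) (use assms(1) xy in auto)
    have e2: "row_word ((S \<inter> {..<x}) \<union> ({x} \<union> (S \<inter> {y<..}))) =
      row_word (S \<inter> {..<x}) @ row_word ({x} \<union> (S \<inter> {y<..}))"
      by (rule row_word_Un) (use assms(1) xy in auto)
    have e3: "newrow S x = (S \<inter> {..<x}) \<union> ({x} \<union> (S \<inter> {y<..}))"
      unfolding newrow_Some[OF assms(2)] using cover False xy by auto
    have new: "row_word (newrow S x) = A @ [x] @ B"
      unfolding e3 e2 e1 A_def B_def by simp
    note 1
    also have "A @ (if x \<in> S then [x] else []) @ y # x # B = (A @ [y, x]) @ B"
      using False by simp
    also have "\<dots> \<sim>\<^sub>C\<^sub>K (y # A @ [x]) @ B"
      by (intro ck_equiv_append ck_move_large_left sA xy ck_refl)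
    finally show ?thesis by (simp add: new)
  qed
qed

lemma row_insert_bump:
  assumes "finite S" "reduced (row_word S @ [x])" "bump S x = Some y"
  shows "x \<in> S \<Longrightarrow> y = Suc x" "row_word S @ [x] \<sim>\<^sub>C\<^sub>K y # row_word (newrow S x)"
  using row_bump[OF assms(1,3)] assms(2) by blast+

fun row_run :: "nat set \<Rightarrow> nat list \<Rightarrow> nat set \<times> nat list" where
  "row_run S [] = (S, [])"
| "row_run S (x # w) = (let (S', out) = row_run (newrow S x) w
     in (S', (case bump S x of None \<Rightarrow> out | Some y \<Rightarrow> y # out)))"

lemma row_run_ck:
  "finite S \<Longrightarrow> reduced (row_word S @ w) \<Longrightarrow>
   row_word S @ w \<sim>\<^sub>C\<^sub>K snd (row_run S w) @ row_word (fst (row_run S w))"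
proof (induction w arbitrary: S)
  case (Cons x w)
  have r: "reduced (row_word S @ [x])" using Cons.prems reduced_prefix[of "row_word S @ [x]" w] by simp
  show ?case
  proof (cases "bump S x")
    case None
    have e: "row_word (newrow S x) = row_word S @ [x]" using row_insert_append Cons.prems r None by blast
    show ?thesis using Cons.IH[of "newrow S x"] Cons.prems by (simp add: e None case_prod_beta)
  next
    case (Some y)
    have "(row_word S @ [x]) @ w \<sim>\<^sub>C\<^sub>K (y # row_word (newrow S x)) @ w"
      using Cons.prems r Some by (intro ck_equiv_append ck_refl row_insert_bump)
    then have 1: "row_word S @ x # w \<sim>\<^sub>C\<^sub>K [y] @ row_word (newrow S x) @ w" by simp
    then have "reduced (row_word (newrow S x) @ w)" using Cons.prems reduced_ck reduced_suffix by metis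
    then have "row_word (newrow S x) @ w \<sim>\<^sub>C\<^sub>K
        snd (row_run (newrow S x) w) @ row_word (fst (row_run (newrow S x) w))"
      using Cons.prems by (intro Cons.IH) simp_all
    then have "[y] @ row_word (newrow S x) @ w \<sim>\<^sub>C\<^sub>K
      [y] @ snd (row_run (newrow S x) w) @ row_word (fst (row_run (newrow S x) w))"
      by (rule ck_equiv_append[OF ck_refl])
    from ck_trans[OF 1 this] show ?thesis by (simp add: Some case_prod_beta)
  qed
qed simp

definition bump_word :: "nat set \<Rightarrow> nat \<Rightarrow> nat list" where
  "bump_word S x = (case bump S x of None \<Rightarrow> [] | Some y \<Rightarrow> [y])"

lemma row_run_Cons:
  "row_run S (x # w) = (fst (row_run (newrow S x) w), bump_word S x @ snd (row_run (newrow S x) w))"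
  by (simp add: bump_word_def case_prod_beta split: option.split)

declare row_run.simps(2) [simp del]

section \<open>Compatibility of row insertion with the Coxeter--Knuth relations\<close>

inductive ck3 :: "nat list \<Rightarrow> nat list \<Rightarrow> bool" where
  ck3_1: "y < x \<Longrightarrow> x < z \<Longrightarrow> ck3 [x, y, z] [x, z, y]"
| ck3_2: "y < z \<Longrightarrow> z < x \<Longrightarrow> ck3 [x, y, z] [y, x, z]"
| ck3_3: "ck3 [i, Suc i, i] [Suc i, i, Suc i]"

lemma ck3_ck_step: "ck3 u v \<Longrightarrow> ck_step (a @ u @ b) (a @ v @ b)"
  by (induction rule: ck3.induct) (blast intro: ck_step.intros)+

lemma ck_step_ck3E:
  assumes "ck_step \<rho> \<tau>"
  obtains a u v b where "\<rho> = a @ u @ b" "\<tau> = a @ v @ b" "ck3 u v"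
  using assms by cases (blast intro: ck3.intros)+

lemma ck3_length: "ck3 u v \<Longrightarrow> length u = 3 \<and> length v = 3"
  by (induction rule: ck3.induct) auto

lemma bump_SomeI: "y \<in> S \<Longrightarrow> x < y \<Longrightarrow> (\<And>z. z \<in> S \<Longrightarrow> x < z \<Longrightarrow> y \<le> z) \<Longrightarrow> bump S x = Some y"
  by (simp add: bump_Some_iff)

lemma bump_NoneI: "(\<And>z. z \<in> S \<Longrightarrow> z \<le> x) \<Longrightarrow> bump S x = None"
  by (simp add: bump_None_iff)

text \<open>The only consequence of reducedness that row insertion needs.\<close>

definition row_ok :: "nat set \<Rightarrow> nat \<Rightarrow> bool" where
  "row_ok S x \<longleftrightarrow> (x \<in> S \<longrightarrow> Suc x \<in> S)"

fun row_run_ok :: "nat set \<Rightarrow> nat list \<Rightarrow> bool" where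
  "row_run_ok S [] \<longleftrightarrow> True"
| "row_run_ok S (x # w) \<longleftrightarrow> row_ok S x \<and> row_run_ok (newrow S x) w"

lemma reduced_row_ok:
  assumes "finite S" "reduced (row_word S @ [x])"
  shows "row_ok S x"
  using row_insert_append(1)[OF assms] row_insert_bump(1)[OF assms]
  by (cases "bump S x") (auto simp: row_ok_def bump_Some_iff)

lemma reduced_row_step:
  assumes "finite S" "reduced (row_word S @ x # w)"
  shows "reduced (row_word S @ [x])" "reduced (row_word (newrow S x) @ w)"
    "reduced (bump_word S x @ row_word (newrow S x) @ w)"
proof -
  show r: "reduced (row_word S @ [x])" using assms reduced_prefix[of "row_word S @ [x]" w] by simp
  show *: "reduced (bump_word S x @ row_word (newrow S x) @ w)"
  proof (cases "bump S x")
    case None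
    then show ?thesis using row_insert_append(2)[OF assms(1) r None] assms by (simp add: bump_word_def)
  next
    case (Some y)
    have "(row_word S @ [x]) @ w \<sim>\<^sub>C\<^sub>K (y # row_word (newrow S x)) @ w"
      using assms r Some by (intro ck_equiv_append ck_refl row_insert_bump)
    from reduced_ck[OF this] show ?thesis using assms Some by (simp add: bump_word_def)
  qed
  show "reduced (row_word (newrow S x) @ w)" by (rule reduced_suffix[OF *])
qed

lemma reduced_row_run_ok:
  "finite S \<Longrightarrow> reduced (row_word S @ w) \<Longrightarrow> row_run_ok S w"
proof (induction w arbitrary: S)
  case (Cons x w)
  then show ?case
    using reduced_row_step[OF Cons.prems] reduced_row_ok[OF Cons.prems(1)] by simp
qed simp

text \<open>The entry \<open>x\<close> separates the two insertions: inserting \<open>y\<close>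
  alters only values up to \<open>x\<close>, inserting \<open>z\<close> only values above
  \<open>x\<close>.\<close>

lemma row_commute:
  assumes "x \<in> S" "y < x" "x < z"
  shows "bump (newrow S y) z = bump S z" "bump (newrow S z) y = bump S y"
    "newrow (newrow S y) z = newrow (newrow S z) y"
proof -
  obtain y' where y': "bump S y = Some y'" "y' \<le> x"
    using assms by (metis bump_None_iff bump_Some_iff not_le option.exhaust)
  note y'' = y'(1)[unfolded bump_Some_iff]
  have ny: "newrow S y = (if y \<in> S then S else insert y (S - {y'}))" by (rule newrow_Some[OF y'(1)])
  show 1: "bump (newrow S y) z = bump S z"
  proof (cases "bump S z")
    case None
    then have "\<And>w. w \<in> S \<Longrightarrow> w \<le> z" by (simp add: bump_None_iff)
    then show ?thesis unfolding None ny using assms by (intro bump_NoneI) (auto split: if_splits)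
  next
    case (Some z')
    note z' = Some[unfolded bump_Some_iff]
    show ?thesis unfolding Some ny using assms z' y'(2) by (intro bump_SomeI) (auto split: if_splits)
  qed
  show 2: "bump (newrow S z) y = bump S y"
  proof (cases "bump S z")
    case None
    show ?thesis unfolding y'(1) newrow_None[OF None] using assms y'' y'(2)
      by (intro bump_SomeI) auto
  next
    case (Some z')
    note z' = Some[unfolded bump_Some_iff]
    show ?thesis unfolding y'(1) newrow_Some[OF Some] using assms y'' y'(2) z'
      by (intro bump_SomeI) (auto split: if_splits)
  qed
  show "newrow (newrow S y) z = newrow (newrow S z) y"
  proof (cases "bump S z")
    case None
    have "newrow (newrow S y) z = insert z (newrow S y)" using 1 None by (intro newrow_None) simp
    moreover have "newrow (newrow S z) y = (if y \<in> newrow S z then newrow S z else insert y (newrow S z - {y'}))"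
      using 2 y'(1) by (intro newrow_Some) simp
    ultimately show ?thesis unfolding newrow_None[OF None] ny using assms y'(2) by auto
  next
    case (Some z')
    note z' = Some[unfolded bump_Some_iff]
    have "newrow (newrow S y) z = (if z \<in> newrow S y then newrow S y else insert z (newrow S y - {z'}))"
      using 1 Some by (intro newrow_Some) simp
    moreover have "newrow (newrow S z) y = (if y \<in> newrow S z then newrow S z else insert y (newrow S z - {y'}))"
      using 2 y'(1) by (intro newrow_Some) simp
    moreover have "z' \<noteq> y" "y' \<noteq> z" "z \<noteq> y" using assms z' y'(2) by auto
    ultimately show ?thesis unfolding newrow_Some[OF Some] ny by auto
  qed
qed

text \<open>Both directions are allowed because the type of the relation may change from one row to
  the next, for instance from the second relation to a reversed braid relation.\<close>

abbreviation row_related :: "nat set \<times> nat list \<Rightarrow> nat set \<times> nat list \<Rightarrow> bool" where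
  "row_related p q \<equiv> fst p = fst q \<and> (snd p = snd q \<or> ck3 (snd p) (snd q) \<or> ck3 (snd q) (snd p))"

text \<open>Once \<open>x\<close> is in the row, inserting \<open>y\<close> and inserting
  \<open>z\<close> commute. If all three letters bump, the bumped letters satisfy
  \<open>y' \<le> x < x' < z'\<close>, again an instance of the first relation.\<close>

lemma row_ck3_1:
  assumes "y < x" "x < z" "row_ok S x"
  shows "row_related (row_run S [x, y, z]) (row_run S [x, z, y])"
proof -
  define S1 where "S1 = newrow S x"
  have x: "x \<in> S1" by (simp add: S1_def)
  note c = row_commute[OF x assms(1,2)]
  have eq: "fst (row_run S [x, y, z]) = fst (row_run S [x, z, y])"
    using c(3) by (simp add: row_run_Cons S1_def)
  obtain y' where y': "bump S1 y = Some y'" "y' \<le> x"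
    using assms x by (metis bump_None_iff bump_Some_iff not_le option.exhaust)
  have o: "snd (row_run S [x, y, z]) = bump_word S x @ [y'] @ bump_word S1 z"
    "snd (row_run S [x, z, y]) = bump_word S x @ bump_word S1 z @ [y']"
    using c y'(1) by (simp_all add: row_run_Cons bump_word_def flip: S1_def)
  show ?thesis
  proof (cases "bump S1 z")
    case None
    then show ?thesis using eq o by (simp add: bump_word_def)
  next
    case (Some z')
    note z' = Some[unfolded bump_Some_iff]
    have "z' \<in> S" using z' assms by (auto simp: S1_def newrow_def split: if_splits option.splits)
    then obtain x' where x': "bump S x = Some x'"
      using z' assms by (metis bump_None_iff not_le option.exhaust less_trans)
    note x'' = x'[unfolded bump_Some_iff]
    have "x' < z'"
    proof (cases "x \<in> S")
      case True
      then have "x' \<le> Suc x" using assms(3) x'' by (simp add: row_ok_def)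
      then show ?thesis using z' assms by simp
    next
      case False
      then have "z' \<noteq> x'" using z' x' assms by (auto simp: S1_def newrow_def)
      moreover have "x' \<le> z'" using x'' \<open>z' \<in> S\<close> z' assms by simp
      ultimately show ?thesis by simp
    qed
    then have "ck3 [x', y', z'] [x', z', y']" using x'' y'(2) by (intro ck3_1) auto
    then show ?thesis using eq o Some x' by (simp add: bump_word_def)
  qed
qed

lemma row_gap:
  assumes "y < z" "z < x" "\<And>s. s \<in> R \<Longrightarrow> s \<le> y \<or> x < s"
  shows "bump R z = bump R x" "bump (newrow R x) z = Some x" "newrow (newrow R x) z = newrow R z"
proof -
  have nx: "x \<notin> R" "z \<notin> R" using assms by force+
  show 1: "bump R z = bump R x"
  proof (cases "bump R x")
    case None
    then have "\<And>s. s \<in> R \<Longrightarrow> s \<le> x" by (simp add: bump_None_iff)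
    then show ?thesis unfolding None using assms by (intro bump_NoneI) force
  next
    case (Some q)
    note q = Some[unfolded bump_Some_iff]
    have "q \<le> s" if "s \<in> R" "z < s" for s using q that assms by (metis leD less_trans)
    then show ?thesis unfolding Some using q assms by (intro bump_SomeI) auto
  qed
  have sub: "newrow R x \<subseteq> insert x R" by (auto simp: newrow_def split: option.splits)
  show 2: "bump (newrow R x) z = Some x"
    using assms sub by (intro bump_SomeI) (auto, force)
  show "newrow (newrow R x) z = newrow R z"
  proof (cases "bump R x")
    case None
    have "newrow (newrow R x) z = insert z (newrow R x - {x})"
      unfolding newrow_Some[OF 2] using nx sub assms by auto
    also have "\<dots> = insert z R" unfolding newrow_None[OF None] using nx by auto
    finally show ?thesis using newrow_None[of R z] 1 None by simp
  next
    case (Some q)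
    have "newrow (newrow R x) z = insert z (newrow R x - {x})"
      unfolding newrow_Some[OF 2] using nx sub assms by auto
    also have "\<dots> = insert z (R - {q})" unfolding newrow_Some[OF Some] using nx by auto
    finally show ?thesis using newrow_Some[of R z q] 1 Some nx by simp
  qed
qed

text \<open>If the row has an entry \<open>s\<close> with \<open>y < s \<le> x\<close>, then
  \<open>y\<close> bumps some \<open>y' \<le> x\<close>. For \<open>y' = x\<close> the outputs form
  a braid, because \<open>row_ok\<close> provides \<open>Suc x\<close>; for \<open>y' < x\<close>
  they form an instance of the second relation. Without such an \<open>s\<close>, the inserted
  \<open>x\<close> is itself bumped out again and the type changes to the first relation.\<close>

lemma row_ck3_2:
  assumes "y < z" "z < x" "row_ok S x" "row_ok S y"
  shows "row_related (row_run S [x, y, z]) (row_run S [y, x, z])"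
proof (cases "\<exists>s\<in>S. y < s \<and> s \<le> x")
  case False
  then have gap: "s \<le> y \<or> x < s" if "s \<in> S" for s using that by force
  have "Suc y \<notin> S" using gap[of "Suc y"] assms by auto
  then have y: "y \<notin> S" using assms by (auto simp: row_ok_def)
  have x: "x \<notin> S" using gap[of x] assms by auto
  define R where "R = newrow S y"
  have gapR: "s \<le> y \<or> x < s" if "s \<in> R" for s
    using that gap by (auto simp: R_def newrow_def split: if_splits option.splits)
  have bxy: "bump S x = bump S y"
  proof (cases "bump S x")
    case None
    then have "\<And>s. s \<in> S \<Longrightarrow> s \<le> y" using gap by (metis bump_None_iff leD)
    then show ?thesis unfolding None by (metis bump_NoneI)
  next
    case (Some q)
    note q = Some[unfolded bump_Some_iff]
    have "q \<le> s" if "s \<in> S" "y < s" for s using q that gap by (metis leD)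
    then show ?thesis unfolding Some using q assms by (metis bump_SomeI less_trans)
  qed
  have sub: "newrow S x \<subseteq> insert x S" by (auto simp: newrow_def split: option.splits)
  have b1: "bump (newrow S x) y = Some x"
    using assms sub gap by (intro bump_SomeI) (auto, force)
  have n1: "newrow (newrow S x) y = R"
  proof -
    have "newrow (newrow S x) y = insert y (newrow S x - {x})"
      unfolding newrow_Some[OF b1] using y sub assms by auto
    also have "\<dots> = R" using bxy x y by (auto simp: R_def newrow_def split: option.splits)
    finally show ?thesis .
  qed
  note g = row_gap[OF assms(1,2) gapR]
  have u: "row_run S [x, y, z] = (newrow R z, bump_word S x @ [x] @ bump_word R x)"
    using b1 n1 g(1) by (simp add: row_run_Cons bump_word_def)
  have v: "row_run S [y, x, z] = (newrow R z, bump_word S x @ bump_word R x @ [x])"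
    using bxy g by (simp add: row_run_Cons bump_word_def flip: R_def)
  show ?thesis
  proof (cases "bump R x")
    case None
    then show ?thesis using u v by (simp add: bump_word_def)
  next
    case (Some q)
    note q = Some[unfolded bump_Some_iff]
    have "q \<noteq> y" using q assms by auto
    then have "q \<in> S" using q by (auto simp: R_def newrow_def split: if_splits option.splits)
    then obtain p where p: "bump S x = Some p" using q by (metis bump_None_iff leD option.exhaust)
    note p' = p[unfolded bump_Some_iff]
    have "q \<noteq> p" using q p bxy y assms p' by (auto simp: R_def newrow_def)
    moreover have "p \<le> q" using p' q \<open>q \<in> S\<close> by auto
    ultimately have "ck3 [p, x, q] [p, q, x]" using p' by (intro ck3_1) auto
    then show ?thesis using u v Some p by (simp add: bump_word_def)
  qed
next
  case True
  then obtain y' where y': "bump S y = Some y'" "y' \<le> x"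
    by (metis bump_None_iff bump_Some_iff leD le_trans option.exhaust)
  note y'' = y'(1)[unfolded bump_Some_iff]
  have ny: "newrow S y = (if y \<in> S then S else insert y (S - {y'}))" by (rule newrow_Some[OF y'(1)])
  have x'e: "Suc x \<in> S" if "x \<in> S" using that assms by (simp add: row_ok_def)
  have y'S: "y' = Suc y" if "y \<in> S" using that assms y'' by (force simp: row_ok_def)
  have b2: "bump (newrow S x) y = Some y'"
    using y'' y'(2) assms
    by (intro bump_SomeI) (auto simp: newrow_def bump_Some_iff split: if_splits option.splits)
  have b1: "bump (newrow S y) x = bump S x"
  proof (cases "bump S x")
    case None
    then have "\<And>s. s \<in> S \<Longrightarrow> s \<le> x" by (simp add: bump_None_iff)
    then show ?thesis unfolding None using assms
      by (intro bump_NoneI) (auto simp: ny split: if_splits)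
  next
    case (Some q)
    note q = Some[unfolded bump_Some_iff]
    show ?thesis unfolding Some using q y'(2) assms
      by (intro bump_SomeI) (auto simp: ny split: if_splits)
  qed
  show ?thesis
  proof (cases "y' = x")
    case yx: True
    then have y: "y \<notin> S" using y'S assms by auto
    have xS: "x \<in> S" using yx y'' by simp
    have bx: "bump S x = Some (Suc x)" using x'e[OF xS] by (intro bump_SomeI) auto
    have n1: "newrow S x = S" using xS by (simp add: newrow_def)
    have n2: "newrow S y = insert y (S - {x})" using y yx by (simp add: ny)
    have gap: "s \<le> y \<or> x \<le> s" if "s \<in> S" for s using y'' that yx by force
    have b3: "bump (insert y (S - {x})) z = Some (Suc x)"
      using x'e[OF xS] assms gap by (intro bump_SomeI) force+
    have zn: "z \<notin> S" using gap[of z] assms by auto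
    have n3: "newrow (insert y (S - {x})) z = insert z (insert y (S - {x}) - {Suc x})"
      unfolding newrow_Some[OF b3] using zn assms by auto
    have n4: "newrow (insert y (S - {x})) x = insert x (insert y (S - {x}) - {Suc x})"
      using newrow_Some[OF b1[unfolded bx n2]] assms by auto
    have b5: "bump (insert x (insert y (S - {x}) - {Suc x})) z = Some x"
      using assms gap by (intro bump_SomeI) force+
    have n5: "newrow (insert x (insert y (S - {x}) - {Suc x})) z = insert z (insert y (S - {x}) - {Suc x})"
      unfolding newrow_Some[OF b5] using zn assms by auto
    have "row_run S [x, y, z] = (insert z (insert y (S - {x}) - {Suc x}), [Suc x, x, Suc x])"
      using y'(1) yx by (simp add: row_run_Cons bump_word_def bx n1 n2 b3 n3)
    moreover have "row_run S [y, x, z] = (insert z (insert y (S - {x}) - {Suc x}), [x, Suc x, x])"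
      using y'(1) yx b1 by (simp add: row_run_Cons bump_word_def bx n2 n4 b5 n5)
    ultimately show ?thesis using ck3_3[of x] by simp
  next
    case ne: False
    have l: "newrow (newrow S x) y = (if y \<in> newrow S x then newrow S x else insert y (newrow S x - {y'}))"
      by (rule newrow_Some[OF b2])
    have comm: "newrow (newrow S x) y = newrow (newrow S y) x"
    proof (cases "bump S x")
      case None
      have r: "newrow (newrow S y) x = insert x (newrow S y)" using b1 None by (intro newrow_None) simp
      show ?thesis unfolding l r unfolding newrow_None[OF None] ny using ne assms by auto
    next
      case (Some q)
      note q = Some[unfolded bump_Some_iff]
      have r: "newrow (newrow S y) x = (if x \<in> newrow S y then newrow S y else insert x (newrow S y - {q}))"
        using b1 Some by (intro newrow_Some) simp
      have "q \<noteq> y" "q \<noteq> y'" using q y'(2) assms by auto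
      then show ?thesis unfolding l r unfolding newrow_Some[OF Some] ny using ne assms by auto
    qed
    define R where "R = newrow (newrow S x) y"
    have xR: "x \<in> R" unfolding R_def comm by simp
    obtain z' where z': "bump R z = Some z'" "z' \<le> x"
      using assms xR by (metis bump_None_iff bump_Some_iff not_le option.exhaust)
    note z'' = z'(1)[unfolded bump_Some_iff]
    have "y' < z'"
    proof (cases "y \<in> S")
      case True
      then show ?thesis using y'S z'' assms by simp
    next
      case False
      have "y \<notin> newrow S x" using False assms by (auto simp: newrow_def split: option.splits)
      then have "R = insert y (newrow S x - {y'})" unfolding R_def newrow_Some[OF b2] by simp
      then have "z' \<noteq> y'" "z' \<in> newrow S x" using z'' y'' assms by auto
      moreover from this have "z' = x \<or> z' \<in> S" by (auto simp: newrow_def split: if_splits option.splits)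
      ultimately show ?thesis using y'' z'' y'(2) ne assms by force
    qed
    have u: "row_run S [x, y, z] = (newrow R z, bump_word S x @ [y', z'])"
      using b2 z' by (simp add: row_run_Cons bump_word_def flip: R_def)
    have v: "row_run S [y, x, z] = (newrow R z, y' # bump_word S x @ [z'])"
      using b1 y'(1) z' comm by (simp add: row_run_Cons bump_word_def flip: R_def)
    show ?thesis
    proof (cases "bump S x")
      case None
      then show ?thesis using u v by (simp add: bump_word_def)
    next
      case (Some q)
      then have "x < q" by (simp add: bump_Some_iff)
      then have "ck3 [q, y', z'] [y', q, z']" using \<open>y' < z'\<close> z'(2) by (intro ck3_2) auto
      then show ?thesis using u v Some by (simp add: bump_word_def)
    qed
  qed
qed

text \<open>With \<open>Suc i\<close> in the row, \<open>row_ok\<close> also provides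
  \<open>Suc (Suc i)\<close>, and the outputs form a braid one unit higher. Without it,
  \<open>i\<close> is missing as well and the outputs agree or form an instance of the first
  relation.\<close>

lemma row_ck3_3:
  assumes "row_ok S i" "row_ok S (Suc i)"
  shows "row_related (row_run S [i, Suc i, i]) (row_run S [Suc i, i, Suc i])"
proof (cases "Suc i \<in> S")
  case True
  then have S2: "Suc (Suc i) \<in> S" using assms by (simp add: row_ok_def)
  have b: "bump S i = Some (Suc i)" "bump S (Suc i) = Some (Suc (Suc i))"
    using True S2 by (auto intro!: bump_SomeI)
  have n: "newrow S (Suc i) = S" using True by (simp add: newrow_def)
  show ?thesis
  proof (cases "i \<in> S")
    case iS: True
    have "newrow S i = S" using iS by (simp add: newrow_def)
    then show ?thesis using b n ck3_3[of "Suc i"] by (simp add: row_run_Cons bump_word_def)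
  next
    case False
    define R where "R = insert i (S - {Suc i})"
    have n1: "newrow S i = R" unfolding newrow_Some[OF b(1)] R_def using False by simp
    have b2: "bump R (Suc i) = Some (Suc (Suc i))" using S2 by (intro bump_SomeI) (auto simp: R_def)
    have n2: "newrow R (Suc i) = insert (Suc i) (R - {Suc (Suc i)})"
      unfolding newrow_Some[OF b2] by (simp add: R_def)
    have b3: "bump (insert (Suc i) (R - {Suc (Suc i)})) i = Some (Suc i)"
      by (intro bump_SomeI) auto
    have n3: "newrow (insert (Suc i) (R - {Suc (Suc i)})) i = insert (Suc i) (R - {Suc (Suc i)})"
      by (simp add: newrow_def R_def)
    show ?thesis using b n n1 b2 n2 b3 n3 ck3_3[of "Suc i"] by (simp add: row_run_Cons bump_word_def)
  qed
next
  case False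
  then have i: "i \<notin> S" using assms by (auto simp: row_ok_def)
  have eqb: "bump S (Suc i) = bump S i"
  proof (cases "bump S i")
    case None
    then have "\<And>s. s \<in> S \<Longrightarrow> s \<le> i" by (simp add: bump_None_iff)
    then show ?thesis unfolding None by (intro bump_NoneI) force
  next
    case (Some q)
    note q = Some[unfolded bump_Some_iff]
    then have "q \<noteq> Suc i" using False by auto
    then show ?thesis unfolding Some using q by (intro bump_SomeI) auto
  qed
  define R where "R = newrow S i"
  have sub: "newrow S (Suc i) \<subseteq> insert (Suc i) S" by (auto simp: newrow_def split: option.splits)
  have b1: "bump (newrow S (Suc i)) i = Some (Suc i)" by (intro bump_SomeI) auto
  have n1: "newrow (newrow S (Suc i)) i = R"
  proof -
    have "newrow (newrow S (Suc i)) i = insert i (newrow S (Suc i) - {Suc i})"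
      unfolding newrow_Some[OF b1] using i sub by auto
    also have "\<dots> = R" using eqb i False by (auto simp: R_def newrow_def split: option.splits)
    finally show ?thesis .
  qed
  have iR: "i \<in> R" "Suc i \<notin> R" using False by (auto simp: R_def newrow_def split: option.splits if_splits)
  have b2: "bump (newrow R (Suc i)) i = Some (Suc i)" by (intro bump_SomeI) auto
  have "i \<in> newrow R (Suc i)" using iR by (auto simp: newrow_def bump_Some_iff split: option.splits)
  then have n2: "newrow (newrow R (Suc i)) i = newrow R (Suc i)" by (simp add: newrow_def)
  have u: "row_run S [i, Suc i, i] = (newrow R (Suc i), bump_word S i @ bump_word R (Suc i) @ [Suc i])"
    using b2 n2 by (simp add: row_run_Cons bump_word_def flip: R_def)
  have v: "row_run S [Suc i, i, Suc i] = (newrow R (Suc i), bump_word S i @ [Suc i] @ bump_word R (Suc i))"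
    using b1 n1 eqb by (simp add: row_run_Cons bump_word_def)
  show ?thesis
  proof (cases "bump R (Suc i)")
    case None
    then show ?thesis using u v by (simp add: bump_word_def)
  next
    case (Some q)
    note q = Some[unfolded bump_Some_iff]
    then have "q \<in> S" by (auto simp: R_def newrow_def split: if_splits option.splits)
    then obtain p where p: "bump S i = Some p" using q by (metis bump_None_iff leD option.exhaust Suc_lessD)
    have p': "bump S (Suc i) = Some p" using p eqb by simp
    note p'' = p'[unfolded bump_Some_iff]
    have "q \<noteq> p" using q p i p'' by (auto simp: R_def newrow_def)
    moreover have "p \<le> q" using p'' q \<open>q \<in> S\<close> by auto
    ultimately have "ck3 [p, Suc i, q] [p, q, Suc i]" using p'' by (intro ck3_1) auto
    then show ?thesis using u v Some p by (simp add: bump_word_def)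
  qed
qed

lemma row_ck3:
  assumes "finite S" "ck3 u v" "reduced (row_word S @ u)"
  shows "row_related (row_run S u) (row_run S v)"
proof -
  have "reduced (row_word S @ v)"
    using reduced_ck[OF ck_equiv_step[OF ck3_ck_step[OF assms(2), of "row_word S" "[]"]]] assms(3) by simp
  then have ok: "row_run_ok S u" "row_run_ok S v" using assms reduced_row_run_ok by auto
  show ?thesis using assms(2)
  proof cases
    case (ck3_1 y x z)
    then show ?thesis using row_ck3_1[of y x z S] ok(1) unfolding ck3_1(1,2) row_run_ok.simps by blast
  next
    case (ck3_2 y z x)
    then show ?thesis using row_ck3_2[of y z x S] ok unfolding ck3_2(1,2) row_run_ok.simps by blast
  next
    case (ck3_3 i)
    then show ?thesis using row_ck3_3[of S i] ok unfolding ck3_3(1,2) row_run_ok.simps by blast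
  qed
qed

subsection \<open>Edelman--Greene tableaux\<close>

fun ins :: "nat \<Rightarrow> nat set list \<Rightarrow> nat set list" where
  "ins x [] = [{x}]"
| "ins x (S # Ts) = newrow S x # (case bump S x of None \<Rightarrow> Ts | Some y \<Rightarrow> ins y Ts)"

definition ins_word :: "nat set list \<Rightarrow> nat list \<Rightarrow> nat set list" where
  "ins_word T w = foldl (\<lambda>T x. ins x T) T w"

definition EG :: "nat list \<Rightarrow> nat set list" where
  "EG w = ins_word [] w"

definition read :: "nat set list \<Rightarrow> nat list" where
  "read T = concat (map row_word (rev T))"

lemma read_simps [simp]: "read [] = []" "read (S # Ts) = read Ts @ row_word S"
  by (simp_all add: read_def)

lemma ins_word_simps [simp]:
  "ins_word T [] = T" "ins_word T (x # w) = ins_word (ins x T) w" "ins_word T (w @ [x]) = ins x (ins_word T w)"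
  by (simp_all add: ins_word_def)

lemma ins_word_append: "ins_word T (u @ v) = ins_word (ins_word T u) v"
  by (simp add: ins_word_def)

lemma EG_Nil [simp]: "EG [] = []" and EG_snoc: "EG (w @ [x]) = ins x (EG w)"
  by (simp_all add: EG_def)

text \<open>A word may be inserted row by row instead of letter by letter, so a relation between
  words has to be traced through one row at a time only.\<close>

lemma ins_word_row: "ins_word (S # Ts) w = fst (row_run S w) # ins_word Ts (snd (row_run S w))"
  by (induction w arbitrary: S Ts)
    (simp_all add: row_run_Cons bump_word_def ins_word_append split: option.split)

lemma ins_word_Nil: "w \<noteq> [] \<Longrightarrow> ins_word [] w = ins_word [{}] w"
  by (cases w) (simp_all add: bump_def newrow_def)

lemma length_row_run: "length (snd (row_run S w)) \<le> length w"
  by (induction w arbitrary: S) (auto simp: row_run_Cons bump_word_def le_SucI split: option.split)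

lemma ins_finite: "\<forall>S\<in>set T. finite S \<Longrightarrow> \<forall>S\<in>set (ins x T). finite S"
  by (induction x T rule: ins.induct) (auto split: option.splits)

lemma EG_finite: "\<forall>S\<in>set (EG w). finite S"
  by (induction w rule: rev_induct) (simp_all add: EG_snoc ins_finite)

lemma reduced_read_tail:
  assumes "finite S" "reduced (read (S # Ts) @ w)"
  shows "reduced (row_word S @ w)" "reduced (read Ts @ snd (row_run S w))"
proof -
  show r: "reduced (row_word S @ w)" using assms(2) reduced_suffix[of "read Ts"] by simp
  have "read Ts @ (row_word S @ w) \<sim>\<^sub>C\<^sub>K read Ts @ (snd (row_run S w) @ row_word (fst (row_run S w)))"
    by (intro ck_equiv_append ck_refl row_run_ck assms r)
  then have "reduced ((read Ts @ snd (row_run S w)) @ row_word (fst (row_run S w)))"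
    using reduced_ck assms(2) by (metis append_assoc read_simps(2))
  then show "reduced (read Ts @ snd (row_run S w))" by (rule reduced_prefix)
qed

lemma reduced_read_bump:
  assumes "finite S" "reduced (read (S # Ts) @ [x])" "bump S x = Some y"
  shows "reduced (read Ts @ [y])"
  using reduced_read_tail(2)[OF assms(1,2)] assms(3) by (simp add: row_run_Cons bump_word_def)

lemma read_ins:
  "\<forall>S\<in>set T. finite S \<Longrightarrow> reduced (read T @ [x]) \<Longrightarrow> read T @ [x] \<sim>\<^sub>C\<^sub>K read (ins x T)"
proof (induction T arbitrary: x)
  case (Cons S Ts)
  have fS: "finite S" using Cons.prems by simp
  note r = reduced_read_tail(1)[OF fS Cons.prems(2)]
  show ?case
  proof (cases "bump S x")
    case None
    then show ?thesis using row_insert_append(2)[OF fS r None] by simp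
  next
    case (Some y)
    have "read (S # Ts) @ [x] = read Ts @ (row_word S @ [x])" by simp
    also have "\<dots> \<sim>\<^sub>C\<^sub>K read Ts @ (y # row_word (newrow S x))"
      by (intro ck_equiv_append ck_refl row_insert_bump fS r Some)
    also have "\<dots> = (read Ts @ [y]) @ row_word (newrow S x)" by simp
    also have "\<dots> \<sim>\<^sub>C\<^sub>K read (ins y Ts) @ row_word (newrow S x)"
      using Cons.prems reduced_read_bump[OF fS Cons.prems(2) Some]
      by (intro ck_equiv_append ck_refl Cons.IH) auto
    finally show ?thesis by (simp add: Some)
  qed
qed simp

lemma read_EG: "reduced w \<Longrightarrow> w \<sim>\<^sub>C\<^sub>K read (EG w)"
proof (induction w rule: rev_induct)
  case (snoc x w)
  have "w \<sim>\<^sub>C\<^sub>K read (EG w)" using snoc reduced_prefix by blast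
  then have 1: "w @ [x] \<sim>\<^sub>C\<^sub>K read (EG w) @ [x]" by (intro ck_equiv_append ck_refl)
  also have "\<dots> \<sim>\<^sub>C\<^sub>K read (ins x (EG w))"
    by (intro read_ins EG_finite reduced_ck[OF 1] snoc.prems)
  finally show ?case by (simp add: EG_snoc)
qed simp

lemma reduced_read_EG: "reduced (w @ u) \<Longrightarrow> reduced (read (EG w) @ u)"
  using reduced_ck[OF ck_equiv_append[OF read_EG ck_refl]] reduced_prefix by blast

lemma ins_word_ck3:
  "\<forall>S\<in>set T. finite S \<Longrightarrow> ck3 u v \<Longrightarrow> reduced (read T @ u) \<Longrightarrow> ins_word T u = ins_word T v"
proof (induction T arbitrary: u v)
  case Nil
  note len = ck3_length[OF Nil.prems(2)]
  have ne: "u \<noteq> []" "v \<noteq> []" using len by auto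
  have rel: "row_related (row_run {} u) (row_run {} v)"
    using Nil.prems by (intro row_ck3) simp_all
  \<comment> \<open>The first letter enters the empty row without bumping, so at most two letters
    leave it and no relation between words of length three can hold.\<close>
  have short: "length (snd (row_run {} w)) < 3" if "length w = 3" for w
  proof -
    from that obtain x w' where w: "w = x # w'" "length w' = 2" by (cases w) auto
    then show ?thesis using length_row_run[of "newrow {} x" w']
      by (simp add: row_run_Cons bump_word_def bump_def)
  qed
  have "snd (row_run {} u) = snd (row_run {} v)"
    using rel short[of u] short[of v] len ck3_length by fastforce
  then show ?case unfolding ins_word_Nil[OF ne(1)] ins_word_Nil[OF ne(2)] ins_word_row using rel by simp
next
  case (Cons S Ts)
  have fS: "finite S" using Cons.prems by simp
  note ru = reduced_read_tail[OF fS Cons.prems(3)]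
  have "reduced (read (S # Ts) @ v)"
    using reduced_ck[OF ck_equiv_step[OF ck3_ck_step[OF Cons.prems(2), of "read (S # Ts)" "[]"]]]
      Cons.prems(3) by simp
  note rv = reduced_read_tail[OF fS this]
  have rel: "row_related (row_run S u) (row_run S v)"
    by (rule row_ck3[OF fS Cons.prems(2) ru(1)])
  then consider "snd (row_run S u) = snd (row_run S v)" | "ck3 (snd (row_run S u)) (snd (row_run S v))"
    | "ck3 (snd (row_run S v)) (snd (row_run S u))" by blast
  then have "ins_word Ts (snd (row_run S u)) = ins_word Ts (snd (row_run S v))"
  proof cases
    case 2
    then show ?thesis using Cons.prems ru by (intro Cons.IH) auto
  next
    case 3
    then show ?thesis using Cons.prems rv by (intro Cons.IH[symmetric]) auto
  qed simp
  then show ?case unfolding ins_word_row using rel by simp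
qed

lemma EG_ck_step:
  assumes "ck_step \<rho> \<tau>" "reduced \<rho>"
  shows "EG \<rho> = EG \<tau>"
proof -
  obtain a u v b where e: "\<rho> = a @ u @ b" "\<tau> = a @ v @ b" "ck3 u v"
    using ck_step_ck3E[OF assms(1)] .
  have "reduced (a @ u)" using assms(2) e reduced_prefix[of "a @ u" b] by simp
  then have "ins_word (EG a) u = ins_word (EG a) v"
    by (intro ins_word_ck3 EG_finite e reduced_read_EG)
  then show ?thesis by (simp add: e EG_def ins_word_append)
qed

lemma EG_ck:
  assumes "\<rho> \<sim>\<^sub>C\<^sub>K \<tau>" "reduced \<rho>"
  shows "EG \<rho> = EG \<tau>"
proof -
  have "reduced \<tau> \<and> EG \<rho> = EG \<tau>"
    using assms(1)[unfolded ck_equiv_def]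
  proof (induction rule: equivclp_induct)
    case base
    then show ?case using assms by simp
  next
    case (step y z)
    then have "reduced z" using reduced_ck ck_equiv_step ck_sym by metis
    then show ?case using step EG_ck_step by metis
  qed
  then show ?thesis by simp
qed

lemma EG_eq_iff: "reduced \<rho> \<Longrightarrow> reduced \<tau> \<Longrightarrow> EG \<rho> = EG \<tau> \<longleftrightarrow> \<rho> \<sim>\<^sub>C\<^sub>K \<tau>"
  using EG_ck read_EG ck_sym ck_trans by metis

section \<open>Column strictness\<close>

text \<open>Column strictness of two adjacent rows in counting form: the \<open>k\<close>-th smallest element of \<open>S2\<close> exceeds
  that of \<open>S\<close>.\<close>

definition below :: "nat set \<Rightarrow> nat set \<Rightarrow> bool" where
  "below S S2 \<longleftrightarrow> (\<forall>t. card (S2 \<inter> {..t}) \<le> card (S \<inter> {..<t}))"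

fun tab :: "nat set list \<Rightarrow> bool" where
  "tab [] \<longleftrightarrow> True"
| "tab [S] \<longleftrightarrow> finite S \<and> S \<noteq> {}"
| "tab (S # S2 # Ts) \<longleftrightarrow> finite S \<and> S \<noteq> {} \<and> below S S2 \<and> tab (S2 # Ts)"

lemma tab_Cons:
  "tab (S # Ts) \<longleftrightarrow> finite S \<and> S \<noteq> {} \<and> (Ts \<noteq> [] \<longrightarrow> below S (hd Ts)) \<and> tab Ts"
  by (cases Ts) auto

lemma tab_finite: "tab T \<Longrightarrow> S \<in> set T \<Longrightarrow> finite S \<and> S \<noteq> {}"
  by (induction T) (auto simp: tab_Cons)

lemma card_insert_Int:
  "finite S \<Longrightarrow> x \<notin> S \<Longrightarrow> card (insert x S \<inter> A) = card (S \<inter> A) + (if x \<in> A then 1 else 0)"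
  by (simp add: Int_insert_left)

text \<open>Additions on both sides avoid truncated subtraction.\<close>

lemma card_swap_Int:
  assumes "finite S" "x \<notin> S" "y \<in> S"
  shows "card (insert x (S - {y}) \<inter> A) + (if y \<in> A then 1 else 0) = card (S \<inter> A) + (if x \<in> A then 1 else 0)"
proof -
  have "card (S \<inter> A) = card ((S - {y}) \<inter> A) + (if y \<in> A then 1 else 0)"
    using card_insert_Int[of "S - {y}" y A] assms by (simp add: insert_absorb)
  then show ?thesis using card_insert_Int[of "S - {y}" x A] assms by simp
qed

lemma card_newrow_atMost_mono:
  assumes "finite S"
  shows "card (S \<inter> {..t}) \<le> card (newrow S x \<inter> {..t})" "card (S \<inter> {..<t}) \<le> card (newrow S x \<inter> {..<t})"
proof -
  have *: "card (S \<inter> A) \<le> card (newrow S x \<inter> A)" if A: "\<And>a b. a < b \<Longrightarrow> b \<in> A \<Longrightarrow> a \<in> A" for A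
  proof (cases "bump S x")
    case None
    then show ?thesis using assms by (auto simp: newrow_None intro!: card_mono)
  next
    case (Some y)
    then have "x < y" "y \<in> S" by (auto simp: bump_Some_iff)
    then show ?thesis using assms A card_swap_Int[of S x y A] by (auto simp: newrow_Some[OF Some] split: if_splits)
  qed
  show "card (S \<inter> {..t}) \<le> card (newrow S x \<inter> {..t})" "card (S \<inter> {..<t}) \<le> card (newrow S x \<inter> {..<t})"
    by (rule *; simp)+
qed

text \<open>The count for \<open>S2\<close> grows only if \<open>y \<le> t\<close> and
  \<open>t\<close> is smaller than the next entry of \<open>S2\<close> after \<open>y\<close>. There
  the lower row has slack: for \<open>y < t\<close> it comes from the entry \<open>y\<close> of
  \<open>S\<close>, and for \<open>t = y\<close> from \<open>x\<close>, which is either new or equal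
  to \<open>y - 1\<close>.\<close>

lemma below_newrow:
  assumes fin: "finite S" "finite S2" and b: "below S S2" and ok: "row_ok S x" "row_ok S2 y"
    and bump: "bump S x = Some y"
  shows "below (newrow S x) (newrow S2 y)"
  unfolding below_def
proof
  fix t
  have bt: "card (S2 \<inter> {..t}) \<le> card (S \<inter> {..<t})" for t using b by (simp add: below_def)
  note y = bump[unfolded bump_Some_iff]
  note mono = card_newrow_atMost_mono(2)[OF fin(1), of _ x]
  show "card (newrow S2 y \<inter> {..t}) \<le> card (newrow S x \<inter> {..<t})"
  proof (cases "y \<in> S2 \<or> t < y \<or> (\<exists>u. bump S2 y = Some u \<and> u \<le> t)")
    case True
    have "card (newrow S2 y \<inter> {..t}) = card (S2 \<inter> {..t})"
    proof (cases "y \<in> S2")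
      case False
      show ?thesis
      proof (cases "bump S2 y")
        case None
        then show ?thesis using True False fin by (simp add: newrow_None card_insert_Int)
      next
        case (Some u)
        then have "u \<in> S2" "y < u" by (auto simp: bump_Some_iff)
        then show ?thesis using card_swap_Int[of S2 y u "{..t}"] True False fin Some
          by (auto simp: newrow_Some split: if_splits)
      qed
    qed (simp add: newrow_def)
    then show ?thesis using bt[of t] mono[of t] by simp
  next
    case False
    then have yt: "y \<le> t" "y \<notin> S2" by auto
    have gap: "s < y \<or> t < s" if "s \<in> S2" for s
    proof (cases "bump S2 y")
      case None
      then show ?thesis using that yt by (auto simp: bump_None_iff order.order_iff_strict)
    next
      case (Some u)
      then have "t < u" using False by auto
      then show ?thesis using that yt Some unfolding bump_Some_iff
        by (metis linorder_neqE_nat order_less_le_trans)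
    qed
    have N: "card (newrow S2 y \<inter> {..t}) \<le> card (S2 \<inter> {..t}) + 1"
    proof (cases "bump S2 y")
      case None
      then show ?thesis using fin yt by (simp add: newrow_None card_insert_Int)
    next
      case (Some u)
      then have "u \<in> S2" "y < u" by (auto simp: bump_Some_iff)
      then show ?thesis using card_swap_Int[of S2 y u "{..t}"] yt fin Some
        by (auto simp: newrow_Some split: if_splits)
    qed
    show ?thesis
    proof (cases "t = y")
      case False
      have "S2 \<inter> {..t} = S2 \<inter> {..y}" using gap yt by fastforce
      then have "card (S2 \<inter> {..t}) \<le> card (S \<inter> {..<y})" using bt[of y] by simp
      moreover have "card (insert y (S \<inter> {..<y})) \<le> card (S \<inter> {..<t})"
        using False yt y fin by (intro card_mono) auto
      ultimately show ?thesis using N mono[of t] fin by simp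
    next
      case ty: True
      show ?thesis
      proof (cases "x \<in> S")
        case True
        then have "y = Suc x" using y ok(1) unfolding row_ok_def by (metis Suc_leI le_antisym lessI)
        then have "S2 \<inter> {..t} = S2 \<inter> {..x}" using gap ty by fastforce
        then have "card (S2 \<inter> {..t}) \<le> card (S \<inter> {..<x})" using bt[of x] by simp
        moreover have "card (insert x (S \<inter> {..<x})) \<le> card (S \<inter> {..<t})"
          using True \<open>y = Suc x\<close> ty fin by (intro card_mono) auto
        ultimately show ?thesis using N mono[of t] fin by simp
      next
        case False
        have "card (newrow S x \<inter> {..<t}) = card (S \<inter> {..<t}) + 1"
          using card_swap_Int[of S x y "{..<t}"] False fin y ty by (simp add: newrow_Some[OF bump])
        then show ?thesis using N bt[of t] by simp
      qed
    qed
  qed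
qed

lemma tab_ins: "tab T \<Longrightarrow> reduced (read T @ [x]) \<Longrightarrow> tab (ins x T)"
proof (induction T arbitrary: x)
  case (Cons S Ts)
  then have fS: "finite S" "S \<noteq> {}" by (auto simp: tab_Cons)
  note ok = reduced_row_ok[OF fS(1) reduced_read_tail(1)[OF fS(1) Cons.prems(2)]]
  show ?case
  proof (cases "bump S x")
    case None
    have "below (insert x S) (hd Ts)" if "below S (hd Ts)"
    proof -
      have "card (S \<inter> {..<t}) \<le> card (insert x S \<inter> {..<t})" for t
        using fS by (intro card_mono) auto
      then show ?thesis using that unfolding below_def by (meson le_trans)
    qed
    then show ?thesis using Cons.prems None by (auto simp: tab_Cons newrow_None)
  next
    case (Some y)
    note ry = reduced_read_bump[OF fS(1) Cons.prems(2) Some]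
    have t: "tab (ins y Ts)" using Cons.prems ry by (intro Cons.IH) (auto simp: tab_Cons)
    have "below (newrow S x) (hd (ins y Ts))"
    proof (cases Ts)
      case Nil
      have "card ({y} \<inter> {..t}) \<le> card (newrow S x \<inter> {..<t})" for t
      proof (cases "y \<le> t")
        case True
        then have "x \<in> newrow S x \<inter> {..<t}" using Some by (simp add: bump_Some_iff)
        then have "newrow S x \<inter> {..<t} \<noteq> {}" by blast
        moreover have "finite (newrow S x \<inter> {..<t})" by simp
        ultimately have "card (newrow S x \<inter> {..<t}) > 0" using card_gt_0_iff by blast
        then show ?thesis using True by simp
      qed simp
      then show ?thesis by (simp add: Nil below_def)
    next
      case Ts: (Cons S2 Us)
      have f2: "finite S2" and bl: "below S S2" using Cons.prems(1) by (auto simp: Ts tab_Cons)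
      have "row_ok S2 y" using reduced_read_tail(1)[OF f2 ry[unfolded Ts]] f2 by (intro reduced_row_ok)
      then show ?thesis using below_newrow[OF fS(1) f2 bl ok _ Some] by (simp add: Ts)
    qed
    moreover have "newrow S x \<noteq> {}" using in_newrow by blast
    ultimately show ?thesis using t fS Some by (simp add: tab_Cons)
  qed
qed simp

lemma tab_EG: "reduced w \<Longrightarrow> tab (EG w)"
proof (induction w rule: rev_induct)
  case (snoc x w)
  then show ?case using reduced_read_EG[of w "[x]"] reduced_prefix[of w "[x]"] by (simp add: EG_snoc tab_ins)
qed simp

section \<open>Growth of the shape and inverse insertion\<close>

definition shp :: "nat set list \<Rightarrow> nat \<Rightarrow> nat" where
  "shp T i = (if i < length T then card (T ! i) else 0)"

lemma shp_Nil [simp]: "shp [] = (\<lambda>_. 0)"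
  by (simp add: shp_def fun_eq_iff)

lemma shp_Cons_0 [simp]: "shp (S # Ts) 0 = card S"
  and shp_Cons_Suc [simp]: "shp (S # Ts) (Suc i) = shp Ts i"
  by (simp_all add: shp_def)

lemma shp_ConsE: "shp (S # Ts) = case_nat (card S) (shp Ts)"
  by (auto simp: fun_eq_iff split: nat.split)

lemma card_newrow:
  assumes "finite S" "reduced (row_word S @ [x])"
  shows "card (newrow S x) = (case bump S x of None \<Rightarrow> Suc (card S) | Some y \<Rightarrow> card S)"
proof (cases "bump S x")
  case None
  then show ?thesis using row_insert_append(1)[OF assms None] assms by (simp add: newrow_None)
next
  case (Some y)
  then have "y \<in> S" by (simp add: bump_Some_iff)
  then have "card S > 0" using assms(1) card_gt_0_iff by blast
  then show ?thesis using Some \<open>y \<in> S\<close> assms by (simp add: newrow_Some)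
qed

fun box_row :: "nat \<Rightarrow> nat set list \<Rightarrow> nat" where
  "box_row x [] = 0"
| "box_row x (S # Ts) = (case bump S x of None \<Rightarrow> 0 | Some y \<Rightarrow> Suc (box_row y Ts))"

lemma shp_ins:
  "\<forall>S\<in>set T. finite S \<Longrightarrow> reduced (read T @ [x]) \<Longrightarrow>
   shp (ins x T) = (shp T)(box_row x T := Suc (shp T (box_row x T)))"
proof (induction T arbitrary: x)
  case Nil
  then show ?case by (auto simp: shp_def fun_eq_iff)
next
  case (Cons S Ts)
  have fS: "finite S" using Cons.prems by simp
  note r = card_newrow[OF fS reduced_read_tail(1)[OF fS Cons.prems(2)]]
  show ?case
  proof (cases "bump S x")
    case None
    then show ?thesis using r by (auto simp: fun_eq_iff shp_ConsE split: nat.split)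
  next
    case (Some y)
    then have "shp (ins y Ts) = (shp Ts)(box_row y Ts := Suc (shp Ts (box_row y Ts)))"
      using Cons.prems reduced_read_bump[OF fS Cons.prems(2) Some] by (intro Cons.IH) auto
    then show ?thesis using r Some by (auto simp: fun_eq_iff shp_ConsE split: nat.split)
  qed
qed

text \<open>Inverts one bump: \<open>x\<close> is the largest entry of the new row below
  \<open>y\<close>, and \<open>y\<close> has survived there exactly when the row did not
  change.\<close>

lemma row_bump_unique:
  assumes "bump S x = Some y" "bump S' x' = Some y" "newrow S x = newrow S' x'"
  shows "S = S' \<and> x = x'"
proof -
  have char: "x \<in> newrow S x \<and> x < y \<and> (\<forall>e\<in>newrow S x. e < y \<longrightarrow> e \<le> x)"
    "S = (if y \<in> newrow S x then newrow S x else insert y (newrow S x - {x}))"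
    if "bump S x = Some y" for S x
  proof -
    note y = that[unfolded bump_Some_iff]
    show "x \<in> newrow S x \<and> x < y \<and> (\<forall>e\<in>newrow S x. e < y \<longrightarrow> e \<le> x)"
      using y unfolding newrow_Some[OF that] by (auto simp: not_less[symmetric] split: if_splits)
    show "S = (if y \<in> newrow S x then newrow S x else insert y (newrow S x - {x}))"
      using y unfolding newrow_Some[OF that] by auto
  qed
  have "x = x'" using char(1)[OF assms(1)] char(1)[OF assms(2)] assms(3) by (simp add: le_antisym)
  moreover have "S = S'" using char(2)[OF assms(1)] char(2)[OF assms(2)] assms(3) \<open>x = x'\<close> by metis
  ultimately show ?thesis by simp
qed

text \<open>As the row lengths before insertion agree, a row bumps a letter in both tableaux or in
  neither; in the first case \<open>row_bump_unique\<close> inverts the step.\<close>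

lemma ins_inj:
  "\<forall>S\<in>set T. finite S \<Longrightarrow> \<forall>S\<in>set T'. finite S \<Longrightarrow> reduced (read T @ [x]) \<Longrightarrow> reduced (read T' @ [x']) \<Longrightarrow>
   ins x T = ins x' T' \<Longrightarrow> map card T = map card T' \<Longrightarrow> T = T' \<and> x = x'"
proof (induction T arbitrary: T' x x')
  case Nil
  then show ?case by simp
next
  case (Cons S Ts)
  then obtain S' Ts' where T': "T' = S' # Ts'" by (cases T') auto
  have fS: "finite S" "finite S'" using Cons.prems T' by auto
  have r: "reduced (row_word S @ [x])" "reduced (row_word S' @ [x'])"
    using reduced_read_tail(1)[OF fS(1) Cons.prems(3)] reduced_read_tail(1)[OF fS(2) Cons.prems(4)[unfolded T']] .
  have new: "newrow S x = newrow S' x'" and c: "card S = card S'" using Cons.prems T' by auto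
  show ?case
  proof (cases "bump S x")
    case None
    then have None': "bump S' x' = None"
      using card_newrow[OF fS(1) r(1)] card_newrow[OF fS(2) r(2)] new c by (auto split: option.splits)
    have e: "insert x S = insert x' S'" using new by (simp add: newrow_None None None')
    have n: "x \<notin> S" "x' \<notin> S'" using row_insert_append(1) fS r None None' by auto
    have "x = x'" using e n None None' by (metis bump_None_iff insertI1 insert_iff le_antisym)
    then show ?thesis using e n Cons.prems T' None None' by (auto simp: insert_ident)
  next
    case (Some y)
    then obtain y' where Some': "bump S' x' = Some y'"
      using card_newrow[OF fS(1) r(1)] card_newrow[OF fS(2) r(2)] new c by (auto split: option.splits)
    have "Ts = Ts' \<and> y = y'"
      using Cons.prems reduced_read_bump[OF fS(1) Cons.prems(3) Some]
        reduced_read_bump[OF fS(2) Cons.prems(4)[unfolded T'] Some'] Some Some' T'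
      by (intro Cons.IH) auto
    then show ?thesis using row_bump_unique[OF Some] Some' new T' by auto
  qed
qed

lemma not_reduced_far_square:
  assumes "\<And>a. a \<in> set A \<Longrightarrow> Suc a < y"
  shows "\<not> reduced (y # A @ [y])"
proof
  assume r: "reduced (y # A @ [y])"
  have "simple_refl y \<circ> word_perm A = word_perm A \<circ> simple_refl y" using assms
  proof (induction A)
    case (Cons a A)
    have "simple_refl y \<circ> word_perm (a # A) = (simple_refl y \<circ> simple_refl a) \<circ> word_perm A"
      by (simp add: comp_assoc)
    also have "simple_refl y \<circ> simple_refl a = simple_refl a \<circ> simple_refl y"
      using simple_refl_commute[of a y] Cons.prems by simp
    also have "simple_refl a \<circ> simple_refl y \<circ> word_perm A = simple_refl a \<circ> (simple_refl y \<circ> word_perm A)"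
      by (simp add: comp_assoc)
    also have "simple_refl y \<circ> word_perm A = word_perm A \<circ> simple_refl y"
      by (rule Cons.IH) (simp add: Cons.prems)
    also have "simple_refl a \<circ> (word_perm A \<circ> simple_refl y) = word_perm (a # A) \<circ> simple_refl y"
      by (simp add: comp_assoc)
    finally show ?case .
  qed simp
  then have "word_perm (y # A @ [y]) = word_perm A \<circ> (simple_refl y \<circ> simple_refl y)"
    by (simp flip: comp_assoc)
  then have "word_perm (y # A @ [y]) = word_perm A" by (simp add: simple_refl_self)
  then have "word_for (word_perm (y # A @ [y])) A"
    using reduced_pos[OF r] by (auto simp: word_for_def)
  then have "length (y # A @ [y]) \<le> length A"
    using r unfolding reduced_iff reduced_word_for_def by blast
  then show False by simp
qed

text \<open>Otherwise the leading \<open>y\<close> commutes with all smaller entries of the row and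
  meets the \<open>y\<close> inside the row.\<close>

lemma reduced_Cons_row_pred:
  assumes "finite S" "reduced (y # row_word S)" "y \<in> S"
  shows "0 < y" "y - 1 \<in> S"
proof -
  show y: "0 < y" using reduced_pos[OF assms(2), of y] by simp
  show "y - 1 \<in> S"
  proof (rule ccontr)
    assume n: "y - 1 \<notin> S"
    define A where "A = row_word (S \<inter> {..<y})"
    have far: "Suc a < y" if "a \<in> set A" for a
    proof -
      have "a \<in> S" "a < y" using that assms(1) by (auto simp: A_def)
      moreover from this have "a \<noteq> y - 1" using n by auto
      ultimately show ?thesis by simp
    qed
    have 1: "row_word ((S \<inter> {..<y}) \<union> ({y} \<union> (S \<inter> {y<..}))) = A @ row_word ({y} \<union> (S \<inter> {y<..}))"
      unfolding A_def by (rule row_word_Un) (use assms(1) in auto)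
    have 2: "row_word ({y} \<union> (S \<inter> {y<..})) = row_word {y} @ row_word (S \<inter> {y<..})"
      by (rule row_word_Un) (use assms(1) in auto)
    have "(S \<inter> {..<y}) \<union> ({y} \<union> (S \<inter> {y<..})) = S" using assms(3) by auto
    then have "row_word S = A @ [y] @ row_word (S \<inter> {y<..})" using 1[unfolded 2] by simp
    then have "reduced ((y # A @ [y]) @ row_word (S \<inter> {y<..}))" using assms(2) by simp
    then show False using reduced_prefix not_reduced_far_square far by blast
  qed
qed

text \<open>If \<open>y\<close> is already in the row, the bump to be inverted is the braid case,
  which leaves the row fixed with \<open>x = y - 1\<close>; otherwise \<open>x\<close> is the
  largest entry below \<open>y\<close>.\<close>

lemma row_uninsert:
  assumes "finite S" "reduced (y # row_word S)" "\<exists>s\<in>S. s < y"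
  obtains R x where "finite R" "bump R x = Some y" "newrow R x = S" "x \<in> R \<longrightarrow> y = Suc x"
proof (cases "y \<in> S")
  case True
  note y = reduced_Cons_row_pred[OF assms(1,2) True]
  have "bump S (y - 1) = Some y" using True y by (intro bump_SomeI) auto
  moreover have "newrow S (y - 1) = S" using y by (simp add: newrow_def)
  ultimately show ?thesis using that[of S "y - 1"] assms(1) y by simp
next
  case False
  define x where "x = Max (S \<inter> {..<y})"
  have "S \<inter> {..<y} \<noteq> {}" using assms(3) by auto
  then have x: "x \<in> S" "x < y" using Max_in[of "S \<inter> {..<y}"] assms(1) by (auto simp: x_def)
  have mx: "s \<le> x" if "s \<in> S" "s < y" for s using that assms(1) by (simp add: x_def)
  define R where "R = insert y (S - {x})"
  have b: "bump R x = Some y" using x mx by (intro bump_SomeI) (auto simp: R_def not_less[symmetric])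
  have "newrow R x = S" unfolding newrow_Some[OF b] using x False by (auto simp: R_def)
  moreover have "x \<notin> R" using x by (simp add: R_def)
  ultimately show ?thesis using that[of R x] b assms(1) by (simp add: R_def)
qed

text \<open>Undoing the bump lowers the count for the lower row only for
  \<open>x < t \<le> y\<close>. The new row has no entry after \<open>x\<close> up to
  \<open>y\<close>, so column strictness at \<open>y\<close>, or at \<open>Suc y\<close> if
  \<open>t = y\<close> is in \<open>S2\<close>, supplies the missing unit.\<close>

lemma below_uninsert:
  assumes fin: "finite R" "finite S2" and b: "below (newrow R x) (newrow S2 y)" and ok: "row_ok S2 y"
    and bump: "bump R x = Some y"
  shows "below R S2"
  unfolding below_def
proof
  fix t
  have bt: "card (newrow S2 y \<inter> {..t}) \<le> card (newrow R x \<inter> {..<t})" for t using b by (simp add: below_def)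
  note m = card_newrow_atMost_mono(1)[OF fin(2), of _ y]
  note y = bump[unfolded bump_Some_iff]
  show "card (S2 \<inter> {..t}) \<le> card (R \<inter> {..<t})"
  proof (cases "x \<in> R")
    case True
    then have "newrow R x = R" by (simp add: newrow_def)
    then show ?thesis using bt[of t] m[of t] by simp
  next
    case False
    define S where "S = newrow R x"
    have S: "S = insert x (R - {y})" using False by (simp add: S_def newrow_Some[OF bump])
    have fS: "finite S" using fin by (simp add: S)
    have cS: "card (S \<inter> {..<t}) + (if y < t then 1 else 0) = card (R \<inter> {..<t}) + (if x < t then 1 else 0)"
      using card_swap_Int[of R x y "{..<t}"] False fin y unfolding S by simp
    show ?thesis
    proof (cases "x < t \<and> t \<le> y")
      case False
      then have "card (S \<inter> {..<t}) = card (R \<inter> {..<t})" using cS y by (auto split: if_splits)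
      then show ?thesis using bt[of t] m[of t] by (simp add: S_def)
    next
      case True
      then have cR: "card (S \<inter> {..<t}) = card (R \<inter> {..<t}) + 1" using cS by simp
      have "y \<notin> S" using y S by auto
      have "s \<le> x \<or> y < s" if "s \<in> S" for s
        using that y S by (auto simp: not_less[symmetric])
      then have eqS: "S \<inter> {..<t} = S \<inter> {..<y}" "S \<inter> {..<Suc y} = S \<inter> {..<y}"
        using True \<open>y \<notin> S\<close> by (fastforce simp: less_Suc_eq)+
      have "card (S2 \<inter> {..t}) + 1 \<le> card (S \<inter> {..<y})"
      proof (cases "t = y")
        case False
        have "card (insert y (newrow S2 y \<inter> {..t})) \<le> card (newrow S2 y \<inter> {..y})"
          using True False fin by (intro card_mono) auto
        moreover have "y \<notin> newrow S2 y \<inter> {..t}" using True False by auto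
        ultimately have "card (newrow S2 y \<inter> {..t}) + 1 \<le> card (newrow S2 y \<inter> {..y})"
          using fin by simp
        then show ?thesis using bt[of y] m[of t] by (simp add: S_def)
      next
        case ty: True
        show ?thesis
        proof (cases "y \<in> S2")
          case True
          then have "Suc y \<in> S2" using ok by (simp add: row_ok_def)
          then have "card (insert (Suc y) (S2 \<inter> {..y})) \<le> card (S2 \<inter> {..Suc y})"
            using fin by (intro card_mono) auto
          then have "card (S2 \<inter> {..y}) + 1 \<le> card (S2 \<inter> {..Suc y})" using fin by simp
          also have "\<dots> \<le> card (S \<inter> {..<Suc y})" using bt[of "Suc y"] True by (simp add: S_def newrow_def)
          finally show ?thesis using ty eqS by simp
        next
          case False
          have "card (newrow S2 y \<inter> {..y}) = card (S2 \<inter> {..y}) + 1"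
          proof (cases "bump S2 y")
            case None
            then show ?thesis using fin False by (simp add: newrow_None card_insert_Int)
          next
            case (Some u)
            then have "u \<in> S2" "y < u" by (auto simp: bump_Some_iff)
            then show ?thesis using card_swap_Int[of S2 y u "{..y}"] False fin Some
              by (simp add: newrow_Some)
          qed
          then show ?thesis using bt[of y] ty by (simp add: S_def)
        qed
      qed
      then show ?thesis using cR eqS by simp
    qed
  qed
qed

lemma hd_ins: "hd (ins y Ts) = (if Ts = [] then {y} else newrow (hd Ts) y)"
  by (cases Ts) auto

lemma below_exists_less:
  assumes "below S S2" "finite S2" "y \<in> S2"
  shows "\<exists>s\<in>S. s < y"
proof -
  have "card (S2 \<inter> {..y}) > 0" using assms card_gt_0_iff by blast
  then have "card (S \<inter> {..<y}) > 0" using assms(1) by (metis below_def order_less_le_trans)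
  then have "S \<inter> {..<y} \<noteq> {}" by force
  then show ?thesis by auto
qed

lemma row_word_remove_Max:
  assumes "finite S" "S \<noteq> {}"
  shows "row_word S = row_word (S - {Max S}) @ [Max S]"
proof -
  have "row_word ((S - {Max S}) \<union> {Max S}) = row_word (S - {Max S}) @ row_word {Max S}"
    by (rule row_word_Un) (use assms in \<open>auto intro!: le_neq_implies_less Max_ge\<close>)
  moreover have "(S - {Max S}) \<union> {Max S} = S" using assms by (simp add: insert_absorb)
  ultimately show ?thesis by simp
qed

text \<open>Reverse insertion from the removable corner in row \<open>k\<close>. For
  \<open>k > 0\<close> the higher rows release a letter \<open>y\<close> that lies in their first
  row; column strictness then gives an entry of \<open>S\<close> smaller than \<open>y\<close>,
  which is what \<open>row_uninsert\<close> requires.\<close>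

lemma ins_surj:
  "tab T \<Longrightarrow> reduced (read T) \<Longrightarrow> shp T (Suc k) < shp T k \<Longrightarrow>
   \<exists>T' x. tab T' \<and> reduced (read T' @ [x]) \<and> ins x T' = T \<and> box_row x T' = k"
proof (induction T arbitrary: k)
  case Nil
  then show ?case by simp
next
  case (Cons S Ts)
  have fS: "finite S" "S \<noteq> {}" and tTs: "tab Ts" using Cons.prems by (auto simp: tab_Cons)
  show ?case
  proof (cases k)
    case 0
    define m where "m = Max S"
    have m: "m \<in> S" "\<And>s. s \<in> S \<Longrightarrow> s \<le> m" using fS by (auto simp: m_def)
    have word: "row_word S = row_word (S - {m}) @ [m]" using row_word_remove_Max fS m_def by simp
    show ?thesis
    proof (cases "S = {m}")
      case True
      have "Ts = []"
      proof (rule ccontr)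
        assume "Ts \<noteq> []"
        then obtain S2 Us where "Ts = S2 # Us" by (cases Ts) auto
        then have "card S2 < 1" "finite S2" "S2 \<noteq> {}" using Cons.prems 0 True tTs by (auto simp: tab_Cons)
        then show False by simp
      qed
      then have "read (S # Ts) = [m]" using True by simp
      then have "tab [] \<and> reduced (read [] @ [m]) \<and> ins m [] = S # Ts \<and> box_row m [] = k"
        using Cons.prems(2) True 0 \<open>Ts = []\<close> by simp
      then show ?thesis by blast
    next
      case False
      have b: "bump (S - {m}) m = None" using m by (intro bump_NoneI) auto
      have bl: "below (S - {m}) (hd Ts)" if ne: "Ts \<noteq> []"
        unfolding below_def
      proof
        fix t
        obtain S2 Us where Ts: "Ts = S2 # Us" using ne by (cases Ts) auto
        have f2: "finite S2" using tTs Ts by (auto simp: tab_Cons)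
        have "card (S2 \<inter> {..t}) \<le> card ((S - {m}) \<inter> {..<t})"
        proof (cases "m < t")
          case True
          have "card (S2 \<inter> {..t}) \<le> card S2" using f2 by (intro card_mono) auto
          also have "\<dots> \<le> card (S - {m})" using Cons.prems(3) 0 Ts m fS by simp
          also have "(S - {m}) = (S - {m}) \<inter> {..<t}" using m True by force
          finally show ?thesis .
        next
          case False
          then have "(S - {m}) \<inter> {..<t} = S \<inter> {..<t}" by auto
          then show ?thesis using Cons.prems(1) Ts by (simp add: below_def)
        qed
        then show "card (hd Ts \<inter> {..t}) \<le> card ((S - {m}) \<inter> {..<t})" by (simp add: Ts)
      qed
      have "tab ((S - {m}) # Ts)" using bl fS False m tTs by (auto simp: tab_Cons)
      moreover have "reduced (read ((S - {m}) # Ts) @ [m])" using Cons.prems(2) word by simp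
      moreover have "ins m ((S - {m}) # Ts) = S # Ts" using b m by (simp add: newrow_None insert_absorb)
      moreover have "box_row m ((S - {m}) # Ts) = k" using b 0 by simp
      ultimately show ?thesis by blast
    qed
  next
    case (Suc j)
    have "reduced (read Ts)" using Cons.prems(2) reduced_prefix by simp
    then obtain Ts' y where IH: "tab Ts'" "reduced (read Ts' @ [y])" "ins y Ts' = Ts" "box_row y Ts' = j"
      using Cons.IH[OF tTs, of j] Cons.prems(3) Suc by auto
    have fin': "\<forall>S\<in>set Ts'. finite S" using IH(1) tab_finite by blast
    have ne: "Ts \<noteq> []" using IH(3) by (cases Ts') auto
    have bl: "below S (hd Ts)" using Cons.prems(1) ne by (simp add: tab_Cons)
    have yhd: "y \<in> hd Ts" using IH(3) hd_ins[of y Ts'] by (auto split: if_splits)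
    have fhd: "finite (hd Ts)" using tTs ne tab_finite by force
    have ck: "(read Ts' @ [y]) @ row_word S \<sim>\<^sub>C\<^sub>K read Ts @ row_word S"
      using read_ins[OF fin' IH(2)] unfolding IH(3) by (rule ck_equiv_append[OF _ ck_refl])
    have red: "reduced ((read Ts' @ [y]) @ row_word S)"
      using reduced_ck[OF ck_sym[OF ck]] Cons.prems(2) by simp
    then have "reduced (y # row_word S)" using reduced_suffix[of "read Ts'"] by simp
    then obtain R x where R: "finite R" "bump R x = Some y" "newrow R x = S" "x \<in> R \<longrightarrow> y = Suc x"
      using row_uninsert[OF fS(1)] below_exists_less[OF bl fhd yhd] by blast
    have "R \<noteq> {}" using R(2) by (auto simp: bump_Some_iff)
    moreover have "below R (hd Ts')" if ne': "Ts' \<noteq> []"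
    proof -
      obtain S2 Us where Ts': "Ts' = S2 # Us" using ne' by (cases Ts') auto
      have f2: "finite S2" using fin' Ts' by simp
      have "row_ok S2 y" using reduced_read_tail(1)[OF f2 IH(2)[unfolded Ts']] f2 by (intro reduced_row_ok)
      moreover have "below (newrow R x) (newrow S2 y)" using bl IH(3) Ts' R(3) by auto
      ultimately show ?thesis using below_uninsert[OF R(1) f2 _ _ R(2)] Ts' by simp
    qed
    ultimately have "tab (R # Ts')" using IH(1) R(1) by (simp add: tab_Cons)
    moreover have "reduced (read (R # Ts') @ [x])"
    proof -
      have "read Ts' @ (row_word R @ [x]) \<sim>\<^sub>C\<^sub>K read Ts' @ (y # row_word S)"
        using row_bump(2)[OF R(1,2,4)] unfolding R(3) by (rule ck_equiv_append[OF ck_refl])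
      from reduced_ck[OF ck_sym[OF this]] show ?thesis using red by simp
    qed
    moreover have "ins x (R # Ts') = S # Ts" using R IH(3) by simp
    moreover have "box_row x (R # Ts') = k" using R(2) IH(4) Suc by simp
    ultimately show ?thesis by blast
  qed
qed

section \<open>Comparison of successive bumping routes\<close>

lemma box_row_mono:
  "\<forall>S\<in>set T. finite S \<Longrightarrow> reduced (read T @ [x, y]) \<Longrightarrow> x < y \<Longrightarrow> box_row y (ins x T) \<le> box_row x T"
proof (induction T arbitrary: x y)
  case Nil
  then show ?case by (simp add: bump_def)
next
  case (Cons S Ts)
  have fS: "finite S" using Cons.prems by simp
  note r = reduced_read_tail[OF fS Cons.prems(2)]
  have ok: "row_ok S x" using reduced_row_run_ok[OF fS r(1)] by simp
  show ?case
  proof (cases "bump (newrow S x) y")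
    case None
    then show ?thesis by simp
  next
    case (Some y')
    note y' = Some[unfolded bump_Some_iff]
    have "y' \<in> S" using y' Cons.prems(3) by (auto simp: newrow_def split: if_splits option.splits)
    then obtain x' where x': "bump S x = Some x'"
      using y' Cons.prems(3) by (metis bump_None_iff leD less_trans option.exhaust)
    note x'' = x'[unfolded bump_Some_iff]
    have "x' < y'"
    proof (cases "x \<in> S")
      case True
      then have "x' \<le> Suc x" using ok x'' by (simp add: row_ok_def)
      then show ?thesis using y' Cons.prems(3) by simp
    next
      case False
      then have "y' \<noteq> x'" using y' Cons.prems(3) by (auto simp: newrow_Some[OF x'])
      moreover have "x' \<le> y'" using x'' \<open>y' \<in> S\<close> y' Cons.prems(3) by simp
      ultimately show ?thesis by simp
    qed
    moreover have "reduced (read Ts @ [x', y'])"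
      using r(2) x' Some by (simp add: row_run_Cons bump_word_def)
    ultimately have "box_row y' (ins x' Ts) \<le> box_row x' Ts"
      using Cons.prems by (intro Cons.IH) auto
    then show ?thesis using x' Some by simp
  qed
qed

lemma bump_newrow_smaller:
  assumes "y < x"
  obtains y' where "bump (newrow S x) y = Some y'" "y' \<le> x"
  using assms by (metis bump_None_iff bump_Some_iff in_newrow not_le option.exhaust)

text \<open>The smaller second letter always bumps something at most \<open>x\<close>, hence smaller
  than the letter bumped by \<open>x\<close>; so the second route passes beyond the row in which the
  first one ended.\<close>

lemma box_row_antimono:
  "\<forall>S\<in>set T. finite S \<Longrightarrow> reduced (read T @ [x, y]) \<Longrightarrow> y < x \<Longrightarrow> box_row x T < box_row y (ins x T)"
proof (induction T arbitrary: x y)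
  case Nil
  then have "bump {x} y = Some x" by (intro bump_SomeI) auto
  then show ?case by simp
next
  case (Cons S Ts)
  have fS: "finite S" using Cons.prems by simp
  note r = reduced_read_tail[OF fS Cons.prems(2)]
  obtain y' where y': "bump (newrow S x) y = Some y'" "y' \<le> x"
    using bump_newrow_smaller[OF Cons.prems(3)] .
  show ?case
  proof (cases "bump S x")
    case None
    then show ?thesis using y' by simp
  next
    case (Some x')
    then have "y' < x'" using y' by (simp add: bump_Some_iff)
    moreover have "reduced (read Ts @ [x', y'])"
      using r(2) y' Some by (simp add: row_run_Cons bump_word_def)
    ultimately have "box_row x' Ts < box_row y' (ins x' Ts)"
      using Cons.prems by (intro Cons.IH) auto
    then show ?thesis using y' Some by simp
  qed
qed

section \<open>The values in the first column\<close>

text \<open>The value, if any, that an insertion adds to the first column.\<close>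

fun entry :: "nat \<Rightarrow> nat set list \<Rightarrow> nat option" where
  "entry x [] = Some x"
| "entry x (S # Ts) = (if x < Min S then Some x
     else case bump S x of None \<Rightarrow> None | Some y \<Rightarrow> entry y Ts)"

definition col1 :: "nat set list \<Rightarrow> nat set" where
  "col1 T = Min ` set T"

lemma col1_simps [simp]: "col1 [] = {}" "col1 (S # Ts) = insert (Min S) (col1 Ts)"
  by (simp_all add: col1_def)

lemma tab_Min_less: "tab (S # Ts) \<Longrightarrow> r \<in> col1 Ts \<Longrightarrow> Min S < r"
proof (induction Ts arbitrary: S)
  case (Cons S2 Ts)
  have f: "finite S" "S \<noteq> {}" "finite S2" "S2 \<noteq> {}" "below S S2" using Cons.prems by (auto simp: tab_Cons)
  have "Min S2 \<in> S2" using f by simp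
  then obtain s where "s \<in> S" "s < Min S2" using below_exists_less f by blast
  then have "Min S < Min S2" using f by (meson Min_le le_less_trans)
  moreover have "Min S2 < r" if "r \<in> col1 Ts" using Cons.IH[of S2] Cons.prems(1) that by (simp add: tab_Cons)
  ultimately show ?case using Cons.prems(2) by (auto intro: less_trans)
qed simp

lemma card_col1: "tab T \<Longrightarrow> card (col1 T) = length T"
proof (induction T)
  case (Cons S Ts)
  have "Min S \<notin> col1 Ts" using tab_Min_less[OF Cons.prems] by blast
  then show ?case using Cons by (simp add: tab_Cons col1_def)
qed simp

lemma Min_newrow:
  assumes "finite S" "S \<noteq> {}"
  shows "Min (newrow S x) = min x (Min S)"
proof (rule Min_eqI)
  have m: "Min S \<in> S" using assms by simp
  show "finite (newrow S x)" using assms by simp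
  show "min x (Min S) \<in> newrow S x"
  proof (cases "x \<le> Min S")
    case False
    then have "Min S \<in> newrow S x" using m
      by (auto simp: newrow_def bump_Some_iff split: option.splits)
    then show ?thesis using False by (simp add: min_def)
  qed (simp add: min_def)
  fix s assume "s \<in> newrow S x"
  then have "s = x \<or> s \<in> S" by (auto simp: newrow_def split: if_splits option.splits)
  then show "min x (Min S) \<le> s" using assms by (auto simp: min.coboundedI2)
qed

lemma bump_small:
  assumes "finite S" "S \<noteq> {}" "x < Min S"
  shows "bump S x = Some (Min S)"
  using assms by (intro bump_SomeI) auto

text \<open>Every row minimum is pushed into the next row, so as a set the column gains only
  \<open>x\<close>.\<close>

lemma col1_ins_small:
  "tab T \<Longrightarrow> (\<And>r. r \<in> col1 T \<Longrightarrow> x < r) \<Longrightarrow> col1 (ins x T) = insert x (col1 T)"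
proof (induction T arbitrary: x)
  case (Cons S Ts)
  have f: "finite S" "S \<noteq> {}" using Cons.prems by (auto simp: tab_Cons)
  have x: "x < Min S" using Cons.prems by simp
  have "col1 (ins (Min S) Ts) = insert (Min S) (col1 Ts)"
    using Cons.prems tab_Min_less[OF Cons.prems(1)] by (intro Cons.IH) (auto simp: tab_Cons)
  then show ?case using bump_small[OF f x] Min_newrow[OF f, of x] x by simp
qed simp

lemma col1_ins: "tab T \<Longrightarrow> col1 (ins x T) = col1 T \<union> set_option (entry x T)"
proof (induction T arbitrary: x)
  case (Cons S Ts)
  have f: "finite S" "S \<noteq> {}" using Cons.prems by (auto simp: tab_Cons)
  show ?case
  proof (cases "x < Min S")
    case True
    then have "\<And>r. r \<in> col1 (S # Ts) \<Longrightarrow> x < r"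
      using tab_Min_less[OF Cons.prems] by (auto intro: less_trans)
    from col1_ins_small[OF Cons.prems this] show ?thesis using True by simp
  next
    case False
    then have "Min (newrow S x) = Min S" using Min_newrow[OF f, of x] by simp
    then show ?thesis using Cons False by (auto simp: tab_Cons split: option.splits)
  qed
qed simp

lemma entry_Some_iff: "tab T \<Longrightarrow> entry x T \<noteq> None \<longleftrightarrow> box_row x T = length T"
proof (induction T arbitrary: x)
  case (Cons S Ts)
  have f: "finite S" "S \<noteq> {}" and t: "tab Ts" using Cons.prems by (auto simp: tab_Cons)
  have small: "entry y Us = Some y" if "\<And>r. r \<in> col1 Us \<Longrightarrow> y < r" for y Us
    using that by (cases Us) auto
  show ?case
  proof (cases "x < Min S")
    case True
    have "entry (Min S) Ts = Some (Min S)" using small tab_Min_less[OF Cons.prems] by blast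
    then have "box_row (Min S) Ts = length Ts" using Cons.IH[OF t, of "Min S"] by simp
    then show ?thesis using True bump_small[OF f True] by simp
  next
    case False
    then show ?thesis using Cons.IH[OF t] by (auto split: option.splits)
  qed
qed simp

lemma length_ins: "box_row x T \<le> length T \<and> length (ins x T) = (if box_row x T = length T then Suc (length T) else length T)"
  by (induction x T rule: ins.induct) (auto split: option.splits)

lemma entry_ge: "entry x T = Some r \<Longrightarrow> x \<le> r"
proof (induction x T rule: entry.induct)
  case (2 x S Ts)
  then show ?case by (fastforce simp: bump_Some_iff split: if_splits option.splits)
qed simp

text \<open>While both routes continue, their letters stay in order. When the second letter falls
  below the current minimum it is itself the new value, and it is smaller than \<open>x\<close>,
  which is at most \<open>r\<close> by \<open>entry_ge\<close>.\<close>

lemma entry_decreasing: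
  "tab T \<Longrightarrow> y < x \<Longrightarrow> entry x T = Some r \<Longrightarrow> \<exists>r'. entry y (ins x T) = Some r' \<and> r' < r"
proof (induction T arbitrary: x y)
  case (Cons S Ts)
  have f: "finite S" "S \<noteq> {}" and t: "tab Ts" using Cons.prems by (auto simp: tab_Cons)
  note m = Min_newrow[OF f, of x]
  show ?case
  proof (cases "y < min x (Min S)")
    case True
    have "x \<le> r" using entry_ge[OF Cons.prems(3)] .
    then show ?thesis using True m Cons.prems(2) by simp
  next
    case False
    then have x: "\<not> x < Min S" using Cons.prems(2) by (auto simp: min_def split: if_splits)
    then obtain x' where x': "bump S x = Some x'" "entry x' Ts = Some r"
      using Cons.prems(3) by (auto split: option.splits)
    obtain y' where y': "bump (newrow S x) y = Some y'" "y' \<le> x"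
      using bump_newrow_smaller[OF Cons.prems(2)] .
    have "y' < x'" using x' y' by (simp add: bump_Some_iff)
    then have "\<exists>r'. entry y' (ins x' Ts) = Some r' \<and> r' < r" using Cons.IH[OF t] x' by blast
    then show ?thesis using False m x' y' Cons.prems(2) by auto
  qed
qed simp

section \<open>Invariants of Coxeter--Knuth classes\<close>

definition sh :: "nat list \<Rightarrow> nat \<Rightarrow> nat" where
  "sh \<rho> = shp (EG \<rho>)"

definition rows :: "nat list \<Rightarrow> nat" where
  "rows \<rho> = length (EG \<rho>)"

definition C1 :: "nat list \<Rightarrow> nat set" where
  "C1 \<rho> = col1 (EG \<rho>)"

definition new_row :: "nat list \<Rightarrow> nat \<Rightarrow> nat" where
  "new_row \<rho> x = box_row x (EG \<rho>)"

lemma sh_ck: "reduced \<rho> \<Longrightarrow> \<rho> \<sim>\<^sub>C\<^sub>K \<tau> \<Longrightarrow> sh \<rho> = sh \<tau>"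
  and rows_ck: "reduced \<rho> \<Longrightarrow> \<rho> \<sim>\<^sub>C\<^sub>K \<tau> \<Longrightarrow> rows \<rho> = rows \<tau>"
  and C1_ck: "reduced \<rho> \<Longrightarrow> \<rho> \<sim>\<^sub>C\<^sub>K \<tau> \<Longrightarrow> C1 \<rho> = C1 \<tau>"
  and new_row_ck: "reduced \<rho> \<Longrightarrow> \<rho> \<sim>\<^sub>C\<^sub>K \<tau> \<Longrightarrow> new_row \<rho> x = new_row \<tau> x"
  by (simp_all add: sh_def rows_def C1_def new_row_def EG_ck)

lemma sh_Nil [simp]: "sh [] = (\<lambda>_. 0)" and rows_Nil [simp]: "rows [] = 0" and C1_Nil [simp]: "C1 [] = {}"
  by (simp_all add: sh_def rows_def C1_def)

lemma sh_snoc: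
  assumes "reduced (\<rho> @ [x])"
  shows "sh (\<rho> @ [x]) = (sh \<rho>)(new_row \<rho> x := Suc (sh \<rho> (new_row \<rho> x)))"
  unfolding sh_def new_row_def EG_snoc
  by (intro shp_ins EG_finite reduced_read_EG assms)

lemma sh_pos_iff:
  assumes "reduced \<rho>"
  shows "0 < sh \<rho> i \<longleftrightarrow> i < rows \<rho>"
proof -
  have "card (EG \<rho> ! i) > 0" if "i < length (EG \<rho>)"
    using tab_finite[OF tab_EG[OF assms], of "EG \<rho> ! i"] that by (simp add: card_gt_0_iff)
  then show ?thesis by (auto simp: sh_def shp_def rows_def)
qed

lemma below_card:
  assumes "below S S2" "finite S" "finite S2"
  shows "card S2 \<le> card S"
proof -
  define t where "t = Max (insert 0 S2)"
  have "S2 \<inter> {..t} = S2" using assms(3) by (auto simp: t_def)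
  then have "card S2 \<le> card (S \<inter> {..<t})" using assms(1) unfolding below_def by metis
  also have "\<dots> \<le> card S" using assms(2) by (intro card_mono) auto
  finally show ?thesis .
qed

lemma tab_shp_antimono: "tab T \<Longrightarrow> shp T (Suc i) \<le> shp T i"
proof (induction T arbitrary: i)
  case (Cons S Ts)
  show ?case
  proof (cases i)
    case 0
    show ?thesis
    proof (cases Ts)
      case (Cons S2 Us)
      then show ?thesis using Cons.prems 0 by (auto simp: tab_Cons intro!: below_card)
    qed (simp add: 0)
  next
    case (Suc j)
    then show ?thesis using Cons by (simp add: tab_Cons)
  qed
qed simp

lemma sh_antimono: "reduced \<rho> \<Longrightarrow> i \<le> j \<Longrightarrow> sh \<rho> j \<le> sh \<rho> i"
  unfolding sh_def by (rule lift_Suc_antimono_le[of "shp (EG \<rho>)"]) (simp_all add: tab_shp_antimono tab_EG)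

text \<open>Injectivity of insertion, expressed in words: a deletion is determined up to equivalence
  by the shape it leaves. Later arguments identify words by comparing shapes only.\<close>

lemma delete_unique:
  assumes "reduced (\<sigma> @ [x])" "\<sigma> @ [x] \<sim>\<^sub>C\<^sub>K \<tau> @ [y]" "sh \<sigma> = sh \<tau>"
  shows "\<sigma> \<sim>\<^sub>C\<^sub>K \<tau>" "x = y"
proof -
  have r2: "reduced (\<tau> @ [y])" using reduced_ck assms by blast
  have r: "reduced \<sigma>" "reduced \<tau>" using assms(1) r2 reduced_prefix by auto
  have len: "length (EG \<sigma>) = length (EG \<tau>)"
    using sh_pos_iff[OF r(1)] sh_pos_iff[OF r(2)] assms(3) unfolding rows_def
    by (metis linorder_neqE_nat less_irrefl)
  then have "map card (EG \<sigma>) = map card (EG \<tau>)"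
    using assms(3) by (auto simp: sh_def shp_def fun_eq_iff intro!: nth_equalityI) metis
  then have "EG \<sigma> = EG \<tau> \<and> x = y"
    using EG_ck[OF assms(2,1)] assms(1) r2
    by (intro ins_inj EG_finite reduced_read_EG) (simp_all add: EG_snoc)
  then show "\<sigma> \<sim>\<^sub>C\<^sub>K \<tau>" "x = y" using EG_eq_iff r by auto
qed

text \<open>Boxes are removed from the last row, whose end is always a removable corner because
  \<open>shp\<close> vanishes beyond it.\<close>

lemma EG_surj: "tab T \<Longrightarrow> reduced (read T) \<Longrightarrow> \<exists>w. reduced w \<and> EG w = T"
proof (induction "length (read T)" arbitrary: T rule: less_induct)
  case less
  show ?case
  proof (cases "T = []")
    case True
    then show ?thesis using reduced_Nil EG_Nil by blast
  next
    case False
    define k where "k = length T - 1"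
    have "T ! k \<in> set T" using False by (simp add: k_def)
    then have "shp T (Suc k) < shp T k"
      using False tab_finite[OF less.prems(1), of "T ! k"] by (simp add: shp_def k_def card_gt_0_iff)
    then obtain T' x where T': "tab T'" "reduced (read T' @ [x])" "ins x T' = T"
      using ins_surj less.prems by blast
    have ck: "read T' @ [x] \<sim>\<^sub>C\<^sub>K read T"
      using read_ins[of T' x] T' tab_finite by blast
    then have "length (read T') < length (read T)" using ck_equiv_length[OF ck] by simp
    then obtain w where w: "reduced w" "EG w = T'"
      using less.hyps T'(1) reduced_prefix[OF T'(2)] by blast
    have "w @ [x] \<sim>\<^sub>C\<^sub>K read T' @ [x]" using read_EG[OF w(1)] w(2) by (intro ck_equiv_append) auto
    then have "reduced (w @ [x])" using reduced_ck ck_sym T'(2) by blast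
    moreover have "EG (w @ [x]) = T" using w T' by (simp add: EG_snoc)
    ultimately show ?thesis by blast
  qed
qed

lemma delete_exists:
  assumes "reduced \<rho>" "sh \<rho> (Suc k) < sh \<rho> k"
  obtains \<sigma> x where "\<rho> \<sim>\<^sub>C\<^sub>K \<sigma> @ [x]" "reduced (\<sigma> @ [x])" "new_row \<sigma> x = k"
proof -
  have "reduced (read (EG \<rho>))" using reduced_read_EG[of \<rho> "[]"] assms(1) by simp
  then obtain T' x where T': "tab T'" "reduced (read T' @ [x])" "ins x T' = EG \<rho>" "box_row x T' = k"
    using ins_surj tab_EG assms unfolding sh_def by blast
  then obtain \<sigma> where \<sigma>: "reduced \<sigma>" "EG \<sigma> = T'" using EG_surj reduced_prefix by blast
  have "\<sigma> @ [x] \<sim>\<^sub>C\<^sub>K read T' @ [x]" using read_EG[OF \<sigma>(1)] \<sigma>(2) by (intro ck_equiv_append) auto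
  then have r: "reduced (\<sigma> @ [x])" using reduced_ck ck_sym T'(2) by blast
  have "EG (\<sigma> @ [x]) = EG \<rho>" using \<sigma> T' by (simp add: EG_snoc)
  then have "\<rho> \<sim>\<^sub>C\<^sub>K \<sigma> @ [x]" using EG_eq_iff[OF assms(1) r] by simp
  then show ?thesis using that[OF _ r] T'(4) \<sigma>(2) by (simp add: new_row_def)
qed

lemma new_row_mono: "reduced (\<rho> @ [x, y]) \<Longrightarrow> x < y \<Longrightarrow> new_row (\<rho> @ [x]) y \<le> new_row \<rho> x"
  unfolding new_row_def EG_snoc by (intro box_row_mono EG_finite reduced_read_EG)

lemma new_row_antimono: "reduced (\<rho> @ [x, y]) \<Longrightarrow> y < x \<Longrightarrow> new_row \<rho> x < new_row (\<rho> @ [x]) y"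
  unfolding new_row_def EG_snoc by (intro box_row_antimono EG_finite reduced_read_EG)

text \<open>Descents of a word are visible in its sequence of shapes.\<close>

lemma new_row_less_iff:
  assumes "reduced (\<rho> @ [x, y])"
  shows "new_row \<rho> x < new_row (\<rho> @ [x]) y \<longleftrightarrow> y < x"
proof -
  have "x \<noteq> y" using assms not_reduced_square[of \<rho> x "[]"] by auto
  then show ?thesis using new_row_mono[OF assms] new_row_antimono[OF assms] by force
qed

lemma card_C1: "reduced \<rho> \<Longrightarrow> card (C1 \<rho>) = rows \<rho>"
  by (simp add: C1_def rows_def card_col1 tab_EG)

lemma finite_C1 [simp]: "finite (C1 \<rho>)"
  by (simp add: C1_def col1_def)

lemma rows_snoc: "new_row \<rho> x \<le> rows \<rho>"
  "rows (\<rho> @ [x]) = (if new_row \<rho> x = rows \<rho> then Suc (rows \<rho>) else rows \<rho>)"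
  using length_ins[of x "EG \<rho>"] by (simp_all add: rows_def new_row_def EG_snoc)

lemma C1_snoc:
  assumes "reduced \<rho>"
  shows "C1 (\<rho> @ [x]) = C1 \<rho> \<union> set_option (entry x (EG \<rho>))"
  unfolding C1_def EG_snoc using assms by (intro col1_ins tab_EG)

lemma entry_None_iff:
  assumes "reduced \<rho>"
  shows "entry x (EG \<rho>) = None \<longleftrightarrow> new_row \<rho> x \<noteq> rows \<rho>"
  using entry_Some_iff[OF tab_EG[OF assms], of x] by (auto simp: new_row_def rows_def)

lemma C1_mono: "reduced (\<rho> @ \<tau>) \<Longrightarrow> C1 \<rho> \<subseteq> C1 (\<rho> @ \<tau>)"
proof (induction \<tau> rule: rev_induct)
  case (snoc x \<tau>)
  then have r: "reduced (\<rho> @ \<tau>)" using reduced_prefix[of "\<rho> @ \<tau>" "[x]"] by simp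
  show ?case using C1_snoc[OF r, of x] snoc.IH[OF r] by auto
qed simp

lemma set_read: "\<forall>S\<in>set T. finite S \<Longrightarrow> set (read T) = \<Union> (set T)"
  by (induction T) auto

lemma set_EG: "reduced \<rho> \<Longrightarrow> set \<rho> = \<Union> (set (EG \<rho>))"
  using ck_equiv_set[OF read_EG] set_read[OF EG_finite] by metis

lemma C1_subset:
  assumes "reduced \<rho>"
  shows "C1 \<rho> \<subseteq> set \<rho>"
proof
  fix r assume "r \<in> C1 \<rho>"
  then obtain S where S: "S \<in> set (EG \<rho>)" "r = Min S" by (auto simp: C1_def col1_def)
  then have "r \<in> S" using tab_finite[OF tab_EG[OF assms] S(1)] by simp
  then show "r \<in> set \<rho>" using S(1) by (auto simp: set_EG[OF assms])
qed

lemma Min_in_C1: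
  assumes "reduced \<rho>" "\<rho> \<noteq> []"
  shows "Min (set \<rho>) \<in> C1 \<rho>"
proof -
  have "Min (set \<rho>) \<in> set \<rho>" using assms by simp
  then obtain S where S: "S \<in> set (EG \<rho>)" "Min (set \<rho>) \<in> S" by (subst (asm) (2) set_EG[OF assms(1)]) auto
  have "S \<subseteq> set \<rho>" using S(1) by (auto simp: set_EG[OF assms(1)])
  then have "Min S = Min (set \<rho>)" using S EG_finite by (intro Min_eqI) auto
  then show ?thesis using S(1) by (metis C1_def col1_def image_eqI)
qed

subsection \<open>The weak composition of a Coxeter--Knuth class\<close>

lemma rows_mono: "rows \<rho> \<le> rows (\<rho> @ \<tau>)"
proof (induction \<tau> rule: rev_induct)
  case (snoc x \<tau>)
  then show ?case using rows_snoc(2)[of "\<rho> @ \<tau>" x] by (simp split: if_splits)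
qed simp

lemma rows_append_le: "rows (\<rho> @ \<tau>) \<le> rows \<rho> + length \<tau>"
proof (induction \<tau> rule: rev_induct)
  case (snoc x \<tau>)
  then show ?case using rows_snoc(2)[of "\<rho> @ \<tau>" x] by (simp split: if_splits)
qed simp

lemma new_row_less_rows: "new_row \<rho> x < rows (\<rho> @ [x])"
  using rows_snoc[of \<rho> x] by (auto split: if_splits)

lemma strict_seq_ge:
  fixes b :: "nat \<Rightarrow> nat"
  assumes "\<And>j. Suc j < n \<Longrightarrow> b j < b (Suc j)"
  shows "j < n \<Longrightarrow> j \<le> b j"
proof (induction j)
  case (Suc j)
  then show ?case using assms[of j] by simp
qed simp

lemma strict_seq_id:
  fixes b :: "nat \<Rightarrow> nat"
  assumes "\<And>j. Suc j < n \<Longrightarrow> b j < b (Suc j)" "\<And>j. j < n \<Longrightarrow> b j < n" "j < n"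
  shows "b j = j"
proof -
  have "b j \<le> j"
  proof -
    have "b (n - Suc i) \<le> n - Suc i" if "i < n" for i
      using that
    proof (induction i)
      case 0
      then show ?case using assms(2)[of "n - 1"] by simp
    next
      case (Suc i)
      then have "b (n - Suc (Suc i)) < b (n - Suc i)"
        using assms(1)[of "n - Suc (Suc i)"] by (simp add: Suc_diff_Suc)
      then show ?case using Suc by simp
    qed
    from this[of "n - Suc j"] show ?thesis using assms(3) by (simp add: Suc_diff_Suc)
  qed
  then show ?thesis using strict_seq_ge[of n b j, OF assms(1)] assms(3) by simp
qed

lemma take_Suc_append: "j < length d \<Longrightarrow> \<tau> @ take (Suc j) d = (\<tau> @ take j d) @ [d ! j]"
  by (simp add: take_Suc_conv_app_nth)

lemma reduced_take: "reduced (\<tau> @ d) \<Longrightarrow> reduced (\<tau> @ take j d)"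
  using reduced_prefix[of "\<tau> @ take j d" "drop j d"] by simp

lemma rows_take: "rows (\<tau> @ take j d) \<le> rows (\<tau> @ d)"
  using rows_mono[of "\<tau> @ take j d" "drop j d"] by simp

lemma dec_new_row_less:
  assumes "reduced (\<tau> @ d)" "sorted_wrt (>) d" "Suc j < length d"
  shows "new_row (\<tau> @ take j d) (d ! j) < new_row (\<tau> @ take (Suc j) d) (d ! Suc j)"
proof -
  have "reduced (\<tau> @ take (Suc (Suc j)) d)" by (rule reduced_take[OF assms(1)])
  then have "reduced ((\<tau> @ take j d) @ [d ! j, d ! Suc j])"
    using assms(3) by (simp add: take_Suc_conv_app_nth)
  moreover have "d ! Suc j < d ! j" using assms(2,3) by (simp add: sorted_wrt_iff_nth_less)
  ultimately show ?thesis using new_row_antimono[of "\<tau> @ take j d"] assms(3)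
    by (simp only: take_Suc_append)
qed

lemma new_row_less_rows_append:
  assumes "j < length d"
  shows "new_row (\<tau> @ take j d) (d ! j) < rows (\<tau> @ d)"
  using new_row_less_rows[of "\<tau> @ take j d" "d ! j"] rows_take[of \<tau> "Suc j" d] assms
  by (simp only: take_Suc_append)

lemma dec_length_le_rows:
  assumes "reduced (\<tau> @ d)" "sorted_wrt (>) d"
  shows "length d \<le> rows (\<tau> @ d)"
proof (cases d)
  case (Cons a d')
  define b where "b j = new_row (\<tau> @ take j d) (d ! j)" for j
  have "length d - 1 \<le> b (length d - 1)"
    using dec_new_row_less[OF assms] Cons by (intro strict_seq_ge[of "length d"]) (auto simp: b_def)
  moreover have "b (length d - 1) < rows (\<tau> @ d)"
    using Cons by (simp only: b_def) (rule new_row_less_rows_append, simp)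
  ultimately show ?thesis by simp
qed simp

text \<open>The rows of the new boxes increase strictly along \<open>d\<close>, and there are no
  more rows than letters, so no row can be skipped.\<close>

lemma dec_new_row:
  assumes "reduced (\<tau> @ d)" "sorted_wrt (>) d" "rows (\<tau> @ d) \<le> length d" "j < length d"
  shows "new_row (\<tau> @ take j d) (d ! j) = j"
proof -
  define b where "b j = new_row (\<tau> @ take j d) (d ! j)" for j
  have "b j = j"
  proof (rule strict_seq_id[of "length d"])
    show "b j < b (Suc j)" if "Suc j < length d" for j
      using dec_new_row_less[OF assms(1,2) that] by (simp add: b_def)
    show "b j < length d" if "j < length d" for j
      using new_row_less_rows_append[OF that, of \<tau>] assms(3) by (simp add: b_def)
  qed (rule assms(4))
  then show ?thesis by (simp add: b_def)
qed

lemma dec_sh: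
  assumes "reduced (\<tau> @ d)" "sorted_wrt (>) d" "rows (\<tau> @ d) \<le> length d"
  shows "j \<le> length d \<Longrightarrow> sh (\<tau> @ take j d) = (\<lambda>i. sh \<tau> i + (if i < j then 1 else 0))"
proof (induction j)
  case (Suc j)
  then have j: "j < length d" by simp
  have "reduced ((\<tau> @ take j d) @ [d ! j])"
    using reduced_take[OF assms(1), of "Suc j"] by (simp only: take_Suc_append[OF j])
  from sh_snoc[OF this] show ?case
    using Suc dec_new_row[OF assms j] by (simp only: take_Suc_append[OF j]) (auto simp: fun_eq_iff)
qed simp

lemma peel_unique:
  "reduced (\<tau> @ d) \<Longrightarrow> \<tau> @ d \<sim>\<^sub>C\<^sub>K \<tau>' @ d' \<Longrightarrow> length d = length d' \<Longrightarrow>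
   (\<And>j. j < length d \<Longrightarrow> sh (\<tau> @ take j d) = sh (\<tau>' @ take j d')) \<Longrightarrow> \<tau> \<sim>\<^sub>C\<^sub>K \<tau>' \<and> d = d'"
proof (induction d arbitrary: d' rule: rev_induct)
  case (snoc x d)
  then obtain e y where d': "d' = e @ [y]" by (metis append_butlast_last_id length_0_conv snoc_eq_iff_butlast)
  have l: "length d = length e" using snoc.prems d' by simp
  have "sh (\<tau> @ d) = sh (\<tau>' @ e)" using snoc.prems(4)[of "length d"] d' l by simp
  then have *: "\<tau> @ d \<sim>\<^sub>C\<^sub>K \<tau>' @ e" "x = y"
    using delete_unique[of "\<tau> @ d" x "\<tau>' @ e" y] snoc.prems d' by auto
  have "\<tau> \<sim>\<^sub>C\<^sub>K \<tau>' \<and> d = e"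
  proof (rule snoc.IH)
    show "reduced (\<tau> @ d)" using snoc.prems(1) reduced_prefix[of "\<tau> @ d" "[x]"] by simp
    show "sh (\<tau> @ take j d) = sh (\<tau>' @ take j e)" if "j < length d" for j
      using snoc.prems(4)[of j] that d' l by simp
  qed (use * l in auto)
  then show ?case using * d' by simp
qed simp

section \<open>Peeling off the first column\<close>

definition is_minus :: "nat list \<Rightarrow> nat list \<Rightarrow> nat list \<Rightarrow> bool" where
  "is_minus \<rho> \<tau> d \<longleftrightarrow> \<rho> \<sim>\<^sub>C\<^sub>K \<tau> @ d \<and> length d = rows \<rho> \<and> sorted_wrt (>) d \<and> sh \<tau> = (\<lambda>i. sh \<rho> i - 1)"

lemma is_minus_unique:
  assumes "reduced \<rho>" "is_minus \<rho> \<tau> d" "is_minus \<rho> \<tau>' d'"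
  shows "\<tau> \<sim>\<^sub>C\<^sub>K \<tau>'"
proof -
  have r: "reduced (\<tau> @ d)" "reduced (\<tau>' @ d')" using assms reduced_ck by (auto simp: is_minus_def)
  have l: "rows (\<tau> @ d) \<le> length d" "rows (\<tau>' @ d') \<le> length d'" "length d = length d'"
    using assms(2,3) rows_ck[OF assms(1), of "\<tau> @ d"] rows_ck[OF assms(1), of "\<tau>' @ d'"]
    by (simp_all add: is_minus_def)
  have "sh (\<tau> @ take j d) = sh (\<tau>' @ take j d')" if "j < length d" for j
    using dec_sh[OF r(1) _ l(1), of j] dec_sh[OF r(2) _ l(2), of j] that l(3) assms(2,3)
    by (simp add: is_minus_def)
  moreover have "\<tau> @ d \<sim>\<^sub>C\<^sub>K \<tau>' @ d'" using assms ck_sym ck_trans unfolding is_minus_def by metis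
  ultimately show ?thesis using peel_unique[OF r(1)] l(3) by blast
qed

text \<open>One box is deleted from each row, beginning with the last row; each deletion turns the
  end of the preceding row into a removable corner. The invariant on
  \<open>new_row \<tau> (hd d)\<close> records the row of the latest deletion, so that
  \<open>new_row_less_iff\<close> makes the extracted letters decreasing.\<close>

lemma is_minus_exists:
  assumes "reduced \<rho>"
  shows "\<exists>\<tau> d. is_minus \<rho> \<tau> d"
proof -
  have "k \<le> rows \<rho> \<Longrightarrow> \<exists>\<tau> d. \<rho> \<sim>\<^sub>C\<^sub>K \<tau> @ d \<and> length d = k \<and> sorted_wrt (>) d \<and>
    sh \<tau> = (\<lambda>i. sh \<rho> i - (if rows \<rho> - k \<le> i then 1 else 0)) \<and>
    (d \<noteq> [] \<longrightarrow> new_row \<tau> (hd d) = rows \<rho> - k)" for k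
  proof (induction k)
    case 0
    have "sh \<rho> = (\<lambda>i. sh \<rho> i - (if rows \<rho> \<le> i then 1 else 0))"
    proof
      fix i
      have "rows \<rho> \<le> i \<Longrightarrow> sh \<rho> i = 0" using sh_pos_iff[OF assms, of i] by linarith
      then show "sh \<rho> i = sh \<rho> i - (if rows \<rho> \<le> i then 1 else 0)" by simp
    qed
    then show ?case by (intro exI[of _ \<rho>] exI[of _ "[]"]) simp
  next
    case (Suc k)
    then obtain \<tau> d where IH: "\<rho> \<sim>\<^sub>C\<^sub>K \<tau> @ d" "length d = k" "sorted_wrt (>) d"
      "sh \<tau> = (\<lambda>i. sh \<rho> i - (if rows \<rho> - k \<le> i then 1 else 0))"
      "d \<noteq> [] \<longrightarrow> new_row \<tau> (hd d) = rows \<rho> - k" by auto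
    define p where "p = rows \<rho> - Suc k"
    have p: "rows \<rho> - k = Suc p" "p < rows \<rho>" using Suc.prems by (auto simp: p_def)
    have red: "reduced (\<tau> @ d)" using IH(1) assms reduced_ck by blast
    have "sh \<rho> (Suc p) \<le> sh \<rho> p" "0 < sh \<rho> p" using sh_antimono[OF assms, of p "Suc p"] sh_pos_iff[OF assms] p by auto
    then have "sh \<tau> (Suc p) < sh \<tau> p" by (simp add: IH(4) p)
    then obtain \<sigma> x where \<sigma>: "\<tau> \<sim>\<^sub>C\<^sub>K \<sigma> @ [x]" "reduced (\<sigma> @ [x])" "new_row \<sigma> x = p"
      using delete_exists reduced_prefix[OF red] by blast
    have ck: "\<tau> @ d \<sim>\<^sub>C\<^sub>K (\<sigma> @ [x]) @ d" by (rule ck_equiv_append[OF \<sigma>(1) ck_refl])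
    have red': "reduced ((\<sigma> @ [x]) @ d)" using red ck reduced_ck by blast
    have dec: "sorted_wrt (>) (x # d)"
    proof (cases d)
      case (Cons y d'')
      have "reduced (\<sigma> @ [x, y])" using red' reduced_prefix[of "\<sigma> @ [x, y]" d''] by (simp add: Cons)
      moreover have "new_row (\<sigma> @ [x]) y = Suc p"
        using IH(5) Cons p new_row_ck[OF reduced_prefix[OF red] \<sigma>(1)] by simp
      ultimately have "y < x" using new_row_less_iff[of \<sigma> x y] \<sigma>(3) by simp
      then show ?thesis using IH(3) Cons by auto
    qed simp
    have sh\<tau>: "sh \<tau> = (sh \<sigma>)(p := Suc (sh \<sigma> p))"
      using sh_ck[OF reduced_prefix[OF red] \<sigma>(1)] sh_snoc[OF \<sigma>(2)] \<sigma>(3) by simp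
    have "sh \<sigma> i = sh \<rho> i - (if p \<le> i then 1 else 0)" for i
      using fun_cong[OF sh\<tau>, of i] fun_cong[OF IH(4), of i] p by (auto split: if_splits)
    then have "sh \<sigma> = (\<lambda>i. sh \<rho> i - (if rows \<rho> - Suc k \<le> i then 1 else 0))" by (auto simp: p_def)
    moreover have "\<rho> \<sim>\<^sub>C\<^sub>K \<sigma> @ (x # d)" using ck_trans[OF IH(1) ck] by simp
    ultimately show ?case using dec IH(2) \<sigma>(3) by (intro exI[of _ \<sigma>] exI[of _ "x # d"]) (simp add: p_def)
  qed
  from this[of "rows \<rho>"] show ?thesis by (auto simp: is_minus_def)
qed

text \<open>Only the class of the chosen word matters, by
  \<open>is_minus_minus_word\<close>.\<close>

definition minus_word :: "nat list \<Rightarrow> nat list" where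
  "minus_word \<rho> = (SOME \<tau>. \<exists>d. is_minus \<rho> \<tau> d)"

lemma minus_word:
  assumes "reduced \<rho>"
  obtains d where "is_minus \<rho> (minus_word \<rho>) d"
  using someI_ex[OF is_minus_exists[OF assms]] that unfolding minus_word_def by blast

lemma is_minus_minus_word:
  assumes "reduced \<rho>" "is_minus \<rho> \<tau> d"
  shows "\<tau> \<sim>\<^sub>C\<^sub>K minus_word \<rho>"
  using minus_word[OF assms(1)] is_minus_unique[OF assms] by metis

lemma reduced_minus_word: "reduced \<rho> \<Longrightarrow> reduced (minus_word \<rho>)"
  using minus_word[of \<rho>] reduced_ck reduced_prefix unfolding is_minus_def by metis

lemma rows_eq_0_iff: "rows \<rho> = 0 \<longleftrightarrow> \<rho> = []"
proof (cases \<rho> rule: rev_cases)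
  case (snoc \<sigma> x)
  then show ?thesis using new_row_less_rows[of \<sigma> x] by auto
qed simp

lemma length_minus_word: "reduced \<rho> \<Longrightarrow> \<rho> \<noteq> [] \<Longrightarrow> length (minus_word \<rho>) < length \<rho>"
proof -
  assume \<rho>: "reduced \<rho>" "\<rho> \<noteq> []"
  then obtain d where d: "is_minus \<rho> (minus_word \<rho>) d" using minus_word by blast
  then have "length \<rho> = length (minus_word \<rho> @ d)" unfolding is_minus_def using ck_equiv_length by blast
  then show ?thesis using d rows_eq_0_iff[of \<rho>] \<rho>(2) by (simp add: is_minus_def)
qed

lemma minus_word_ck:
  assumes "reduced \<rho>" "\<rho> \<sim>\<^sub>C\<^sub>K \<tau>"
  shows "minus_word \<rho> \<sim>\<^sub>C\<^sub>K minus_word \<tau>"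
proof -
  obtain d where d: "is_minus \<rho> (minus_word \<rho>) d" using minus_word assms(1) by blast
  then have "is_minus \<tau> (minus_word \<rho>) d"
    using sh_ck[OF assms] rows_ck[OF assms] ck_trans[OF ck_sym[OF assms(2)]] by (auto simp: is_minus_def)
  then show ?thesis using is_minus_minus_word reduced_ck[OF assms(2,1)] by blast
qed

lemma C1_minus_word: "reduced \<rho> \<Longrightarrow> C1 (minus_word \<rho>) \<subseteq> C1 \<rho>"
  by (metis C1_ck C1_mono is_minus_def minus_word reduced_ck)

text \<open>The guard restricts the recursion to words for which \<open>minus_word\<close> is
  strictly shorter. By \<open>C1_minus_word\<close> the successive first columns are nested, so
  their indicator functions add up to left-justified rows: column \<open>c\<close> of the diagram is
  the first column after \<open>c - 1\<close> peelings.\<close>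

function alpha :: "nat list \<Rightarrow> nat \<Rightarrow> nat" where
  "alpha \<rho> = (if reduced \<rho> \<and> \<rho> \<noteq> []
     then (\<lambda>r. (if r \<in> C1 \<rho> then 1 else 0) + alpha (minus_word \<rho>) r) else (\<lambda>_. 0))"
  by pat_completeness auto
termination
  by (relation "measure length") (auto simp: length_minus_word)

declare alpha.simps [simp del]

lemma alpha_Nil [simp]: "alpha [] = (\<lambda>_. 0)"
  by (simp add: alpha.simps)

lemma alpha_rec:
  assumes "reduced \<rho>"
  shows "alpha \<rho> r = (if r \<in> C1 \<rho> then 1 else 0) + alpha (minus_word \<rho>) r"
proof (cases "\<rho> = []")
  case True
  obtain d where "is_minus \<rho> (minus_word \<rho>) d" using minus_word assms by blast
  then have "minus_word \<rho> = []" using True unfolding is_minus_def by (auto dest: ck_equiv_length)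
  then show ?thesis using True by simp
qed (simp add: alpha.simps[of \<rho>] assms)

lemma alpha_ck: "reduced \<rho> \<Longrightarrow> \<rho> \<sim>\<^sub>C\<^sub>K \<tau> \<Longrightarrow> alpha \<rho> = alpha \<tau>"
proof (induction "length \<rho>" arbitrary: \<rho> \<tau> rule: less_induct)
  case less
  have r: "reduced \<tau>" using less.prems reduced_ck by blast
  show ?case
  proof (cases "\<rho> = []")
    case True
    then show ?thesis using ck_equiv_length[OF less.prems(2)] by simp
  next
    case False
    have "alpha (minus_word \<rho>) = alpha (minus_word \<tau>)"
      by (intro less.hyps length_minus_word reduced_minus_word minus_word_ck less.prems False)
    then show ?thesis using alpha_rec[OF less.prems(1)] alpha_rec[OF r] C1_ck[OF less.prems] by auto
  qed
qed

lemma alpha_pos_iff: "reduced \<rho> \<Longrightarrow> 0 < alpha \<rho> r \<longleftrightarrow> r \<in> C1 \<rho>"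
proof (induction "length \<rho>" arbitrary: \<rho> rule: less_induct)
  case less
  show ?case
  proof (cases "\<rho> = []")
    case False
    have "0 < alpha (minus_word \<rho>) r \<longleftrightarrow> r \<in> C1 (minus_word \<rho>)"
      by (intro less.hyps length_minus_word reduced_minus_word less.prems False)
    then show ?thesis using alpha_rec[OF less.prems, of r] C1_minus_word[OF less.prems] by auto
  qed simp
qed

section \<open>The growth rule for the weak composition\<close>

lemma dec_entries:
  assumes "reduced (\<tau> @ d)" "sorted_wrt (>) d" "j < length d"
  shows "(entry (d ! j) (EG (\<tau> @ take j d)) = None \<longrightarrow> C1 (\<tau> @ take j d) = C1 \<tau>) \<and>
    (\<forall>r. entry (d ! j) (EG (\<tau> @ take j d)) = Some r \<longrightarrow> (\<forall>i\<in>C1 (\<tau> @ take j d) - C1 \<tau>. r < i))"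
  using assms(3)
proof (induction j)
  case (Suc j)
  define e where "e = entry (d ! j) (EG (\<tau> @ take j d))"
  define e' where "e' = entry (d ! Suc j) (EG (\<tau> @ take (Suc j) d))"
  have j: "j < length d" using Suc by simp
  have red: "reduced (\<tau> @ take j d)" by (rule reduced_take[OF assms(1)])
  have C: "C1 (\<tau> @ take (Suc j) d) = C1 (\<tau> @ take j d) \<union> set_option e"
    unfolding e_def take_Suc_append[OF j] by (rule C1_snoc[OF red])
  have EG: "EG (\<tau> @ take (Suc j) d) = ins (d ! j) (EG (\<tau> @ take j d))"
    unfolding take_Suc_append[OF j] by (rule EG_snoc)
  have "d ! Suc j < d ! j" using assms(2) Suc.prems by (simp add: sorted_wrt_iff_nth_less)
  then have dec: "\<exists>r'. e' = Some r' \<and> r' < r" if "e = Some r" for r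
    using entry_decreasing[OF tab_EG[OF red]] that unfolding e_def e'_def EG by blast
  have IH: "e = None \<Longrightarrow> C1 (\<tau> @ take j d) = C1 \<tau>"
    "\<And>r i. e = Some r \<Longrightarrow> i \<in> C1 (\<tau> @ take j d) - C1 \<tau> \<Longrightarrow> r < i"
    using Suc.IH[OF j] by (auto simp: e_def)
  show ?case unfolding e'_def[symmetric]
  proof (cases e)
    case None
    then show "(e' = None \<longrightarrow> C1 (\<tau> @ take (Suc j) d) = C1 \<tau>) \<and>
      (\<forall>r. e' = Some r \<longrightarrow> (\<forall>i\<in>C1 (\<tau> @ take (Suc j) d) - C1 \<tau>. r < i))"
      using IH(1) C by simp
  next
    case (Some r)
    obtain r' where r': "e' = Some r'" "r' < r" using dec[OF Some] by blast
    have "r' < i" if "i \<in> C1 (\<tau> @ take (Suc j) d) - C1 \<tau>" for i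
    proof (cases "i = r")
      case False
      then have "i \<in> C1 (\<tau> @ take j d) - C1 \<tau>" using that C Some by auto
      then show ?thesis using IH(2)[OF Some] r'(2) less_trans by blast
    qed (simp add: r')
    then show "(e' = None \<longrightarrow> C1 (\<tau> @ take (Suc j) d) = C1 \<tau>) \<and>
      (\<forall>r. e' = Some r \<longrightarrow> (\<forall>i\<in>C1 (\<tau> @ take (Suc j) d) - C1 \<tau>. r < i))" using r'(1) by auto
  qed
qed simp

lemma sh_snoc_ge: "reduced (\<rho> @ [x]) \<Longrightarrow> sh \<rho> i \<le> sh (\<rho> @ [x]) i"
  by (simp add: sh_snoc)

text \<open>Each new box must lie in a later row than the box before it, as otherwise a row of
  length two would arise.\<close>

lemma column_dec: "reduced \<sigma> \<Longrightarrow> (\<And>i. sh \<sigma> i \<le> 1) \<Longrightarrow> sorted_wrt (>) \<sigma>"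
proof (induction \<sigma> rule: rev_induct)
  case (snoc x \<sigma>)
  have r: "reduced \<sigma>" using snoc.prems(1) reduced_prefix by blast
  have "\<And>i. sh \<sigma> i \<le> 1" using snoc.prems sh_snoc_ge order_trans by blast
  then have IH: "sorted_wrt (>) \<sigma>" using snoc.IH r by blast
  show ?case
  proof (cases \<sigma> rule: rev_cases)
    case (snoc \<sigma>' z)
    have rzx: "reduced (\<sigma>' @ [z, x])" using snoc.prems(1) snoc by simp
    have "new_row \<sigma>' z < new_row \<sigma> x"
    proof (rule ccontr)
      assume "\<not> new_row \<sigma>' z < new_row \<sigma> x"
      then have "sh \<sigma> (new_row \<sigma>' z) \<le> sh \<sigma> (new_row \<sigma> x)" using sh_antimono[OF r] by simp
      moreover have "0 < sh \<sigma> (new_row \<sigma>' z)" using sh_snoc[of \<sigma>' z] r snoc by simp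
      moreover have "sh (\<sigma> @ [x]) (new_row \<sigma> x) = Suc (sh \<sigma> (new_row \<sigma> x))"
        using sh_snoc[OF \<open>reduced (\<sigma> @ [x])\<close>] by simp
      ultimately show False using \<open>\<And>i. sh (\<sigma> @ [x]) i \<le> 1\<close>[of "new_row \<sigma> x"] by simp
    qed
    then have "x < z" using new_row_less_iff[OF rzx] snoc by simp
    then show ?thesis using IH snoc by (auto simp: sorted_wrt_append)
  qed simp
qed simp

text \<open>The insertion tableau of \<open>y # e\<close> is a hook whose first row has length two.
  Deleting the end of that row leaves a single column, and a word with such a shape is
  decreasing.\<close>

lemma hook_swap:
  assumes "reduced (y # e)" "sorted_wrt (>) e" "e \<noteq> []" "y < hd e"
  obtains e' x where "y # e \<sim>\<^sub>C\<^sub>K e' @ [x]" "sorted_wrt (>) e'" "length e' = length e"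
proof -
  obtain a e1 where e: "e = a # e1" using assms(3) by (cases e) auto
  have r: "reduced ([y] @ e)" using assms(1) by simp
  have "reduced ([] @ [y, a])" using reduced_prefix[of "[y, a]" e1] assms(1) e by simp
  \<comment> \<open>Since \<open>a\<close> exceeds \<open>y\<close>, it lands in the first row;
    hence the word has at most \<open>length e\<close> rows and \<open>dec_sh\<close>
    applies.\<close>
  then have n0: "new_row [y] a = 0"
    using new_row_mono[of "[]" y a] assms(4) e rows_snoc(1)[of "[]" y] by simp
  have "rows [y] = 1" using rows_snoc[of "[]" y] by simp
  then have "rows [y, a] = 1" using rows_snoc(2)[of "[y]" a] n0 by simp
  then have rows: "rows ([y] @ e) \<le> length e" using rows_append_le[of "[y, a]" e1] e by simp
  have "reduced ([] @ [y])" using reduced_prefix[of "[y]" e] assms(1) by simp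
  then have "sh [y] = (\<lambda>_. 0)(0 := 1)" using sh_snoc[of "[]" y] rows_snoc(1)[of "[]" y] by simp
  then have sh: "sh (y # e) = (\<lambda>i. (if i = 0 then 1 else 0) + (if i < length e then 1 else 0))"
    using dec_sh[OF r assms(2) rows, of "length e"] by auto
  then have "sh (y # e) (Suc 0) < sh (y # e) 0" using e by simp
  then obtain \<sigma> x where \<sigma>: "y # e \<sim>\<^sub>C\<^sub>K \<sigma> @ [x]" "reduced (\<sigma> @ [x])" "new_row \<sigma> x = 0"
    using delete_exists assms(1) by blast
  have sh2: "sh (y # e) = (sh \<sigma>)(0 := Suc (sh \<sigma> 0))"
    using sh_ck[OF assms(1) \<sigma>(1)] sh_snoc[OF \<sigma>(2)] \<sigma>(3) by simp
  have "sh \<sigma> i \<le> 1" for i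
    using fun_cong[OF sh2, of i] fun_cong[OF sh, of i] by (auto split: if_splits)
  then have "sorted_wrt (>) \<sigma>" using column_dec reduced_prefix[OF \<sigma>(2)] by blast
  then show ?thesis using that[OF \<sigma>(1)] ck_equiv_length[OF \<sigma>(1)] by simp
qed

text \<open>Both words have the same peeled word \<open>\<tau>\<close> up to equivalence, and
  \<open>x\<close> is the last letter of the peeled decreasing word. A row \<open>i\<close> of
  length 1 lies in the first column of \<open>\<sigma>\<close> but not in that of
  \<open>\<tau>\<close>; so it was added by an earlier letter of the decreasing word and exceeds
  \<open>r\<close> by \<open>dec_entries\<close>.\<close>

lemma alpha_snoc_first:
  assumes red: "reduced (\<sigma> @ [x])" and z: "sh \<sigma> (new_row \<sigma> x) = 0"
  shows "\<exists>r. alpha (\<sigma> @ [x]) = (alpha \<sigma>)(r := 1) \<and> alpha \<sigma> r = 0 \<and> (\<forall>i<r. alpha \<sigma> i \<noteq> 1)"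
proof -
  define h where "h = new_row \<sigma> x"
  have r\<sigma>: "reduced \<sigma>" by (rule reduced_prefix[OF red])
  have h: "h = rows \<sigma>" using z sh_pos_iff[OF r\<sigma>, of h] rows_snoc(1)[of \<sigma> x] by (simp add: h_def)
  have rows: "rows (\<sigma> @ [x]) = Suc h" using rows_snoc(2)[of \<sigma> x] h by (simp add: h_def)
  have sh: "sh (\<sigma> @ [x]) = (sh \<sigma>)(h := 1)" using sh_snoc[OF red] z by (simp add: h_def)
  obtain r where e: "entry x (EG \<sigma>) = Some r"
    using entry_None_iff[OF r\<sigma>, of x] h by (auto simp: h_def)
  have C: "C1 (\<sigma> @ [x]) = insert r (C1 \<sigma>)" using C1_snoc[OF r\<sigma>, of x] e by simp
  have rn: "r \<notin> C1 \<sigma>"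
    using card_C1[OF red] card_C1[OF r\<sigma>] rows h C by (auto simp: insert_absorb)
  define \<tau> where "\<tau> = minus_word (\<sigma> @ [x])"
  obtain d where d: "is_minus (\<sigma> @ [x]) \<tau> d" using minus_word[OF red] unfolding \<tau>_def .
  then have d': "\<sigma> @ [x] \<sim>\<^sub>C\<^sub>K \<tau> @ d" "length d = Suc h" "sorted_wrt (>) d" "sh \<tau> = (\<lambda>i. sh (\<sigma> @ [x]) i - 1)"
    by (auto simp: is_minus_def rows)
  have r\<tau>: "reduced (\<tau> @ d)" using reduced_ck[OF d'(1) red] .
  have le: "rows (\<tau> @ d) \<le> length d" using rows_ck[OF red d'(1)] rows d'(2) by simp
  have split: "d = take h d @ [d ! h]" using d'(2) by (metis lessI take_Suc_conv_app_nth take_all_iff order_refl)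
  have pos: "0 < sh \<sigma> i \<longleftrightarrow> i < h" for i using sh_pos_iff[OF r\<sigma>] h by simp
  \<comment> \<open>Removing the last letter of \<open>d\<close> restores the shape of
    \<open>\<sigma>\<close>, which identifies both the class and the letter.\<close>
  have "sh (\<tau> @ take h d) i = sh \<sigma> i" for i
    using fun_cong[OF dec_sh[OF r\<tau> d'(3) le, of h], of i] d'(2,4) sh pos[of i] by (auto split: if_splits)
  then have shd: "sh (\<tau> @ take h d) = sh \<sigma>" by auto
  have "\<sigma> @ [x] \<sim>\<^sub>C\<^sub>K (\<tau> @ take h d) @ [d ! h]" using d'(1) split by (metis append_assoc)
  from delete_unique[OF red this shd[symmetric]]
  have ck: "\<sigma> \<sim>\<^sub>C\<^sub>K \<tau> @ take h d" and x: "x = d ! h" .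
  have "sorted_wrt (>) (take h d)" using d'(3) by (rule sorted_wrt_take)
  moreover have "sh \<tau> = (\<lambda>i. sh \<sigma> i - 1)" using d'(4) sh pos[of h] by (auto simp: fun_eq_iff)
  ultimately have "is_minus \<sigma> \<tau> (take h d)" using ck h d'(2) by (simp add: is_minus_def)
  then have \<tau>\<sigma>: "\<tau> \<sim>\<^sub>C\<^sub>K minus_word \<sigma>" by (rule is_minus_minus_word[OF r\<sigma>])
  have r\<tau>': "reduced \<tau>" using reduced_prefix r\<tau> by blast
  have a: "alpha \<tau> = alpha (minus_word \<sigma>)" by (rule alpha_ck[OF r\<tau>' \<tau>\<sigma>])
  have eq: "alpha (\<sigma> @ [x]) i = (if i \<in> C1 (\<sigma> @ [x]) then 1 else 0) + alpha \<tau> i"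
    "alpha \<sigma> i = (if i \<in> C1 \<sigma> then 1 else 0) + alpha \<tau> i" for i
    using alpha_rec[OF red, of i] alpha_rec[OF r\<sigma>, of i] a by (auto simp: \<tau>_def)
  have a0: "alpha \<sigma> r = 0" using alpha_pos_iff[OF r\<sigma>, of r] rn by simp
  have "alpha (\<sigma> @ [x]) = (alpha \<sigma>)(r := 1)"
  proof
    fix i
    show "alpha (\<sigma> @ [x]) i = ((alpha \<sigma>)(r := 1)) i"
      using eq[of i] C rn a0 eq(2)[of r] by (auto split: if_splits)
  qed
  moreover have "alpha \<sigma> i \<noteq> 1" if "i < r" for i
  proof
    assume 1: "alpha \<sigma> i = 1"
    then have i: "i \<in> C1 \<sigma>" using alpha_pos_iff[OF r\<sigma>, of i] by simp
    then have "alpha \<tau> i = 0" using 1 eq(2)[of i] by simp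
    then have "i \<notin> C1 \<tau>" using alpha_pos_iff[OF r\<tau>', of i] by simp
    then have "i \<in> C1 (\<tau> @ take h d) - C1 \<tau>" using i C1_ck[OF r\<sigma> ck] by simp
    moreover have "entry (d ! h) (EG (\<tau> @ take h d)) = Some r" using e x EG_ck[OF ck r\<sigma>] by simp
    ultimately have "r < i" using dec_entries[OF r\<tau> d'(3), of h] d'(2) by simp
    then show False using that by simp
  qed
  ultimately show ?thesis using a0 by blast
qed

text \<open>Peeling commutes with appending, and the new box moves one column to the left. The box
  in row \<open>h\<close> of the peeled tableau is deleted, which places a letter \<open>y\<close>
  before the decreasing word \<open>e\<close>; \<open>hook_swap\<close> moves the surplus letter to
  the end, where its removal leaves a word for the class of \<open>\<sigma>\<close>.\<close>

lemma minus_word_snoc: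
  assumes red: "reduced (\<sigma> @ [x])" and pos: "0 < sh \<sigma> (new_row \<sigma> x)"
  obtains \<tau> y where "minus_word (\<sigma> @ [x]) \<sim>\<^sub>C\<^sub>K \<tau> @ [y]" "minus_word \<sigma> \<sim>\<^sub>C\<^sub>K \<tau>" "reduced (\<tau> @ [y])"
    "new_row \<tau> y = new_row \<sigma> x" "Suc (sh \<tau> (new_row \<tau> y)) = sh \<sigma> (new_row \<sigma> x)"
proof -
  define h where "h = new_row \<sigma> x"
  define m where "m = sh \<sigma> h"
  have m: "0 < m" using pos by (simp add: m_def h_def)
  have r\<sigma>: "reduced \<sigma>" by (rule reduced_prefix[OF red])
  have h: "h < rows \<sigma>" using pos sh_pos_iff[OF r\<sigma>, of h] by (simp add: h_def)
  define l where "l = rows \<sigma>"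
  have rows: "rows (\<sigma> @ [x]) = l" using rows_snoc(2)[of \<sigma> x] h by (simp add: h_def l_def)
  have sh: "sh (\<sigma> @ [x]) = (sh \<sigma>)(h := Suc m)" using sh_snoc[OF red] by (simp add: h_def m_def)
  have p: "0 < sh \<sigma> i \<longleftrightarrow> i < l" for i using sh_pos_iff[OF r\<sigma>] by (simp add: l_def)
  define \<tau> where "\<tau> = minus_word (\<sigma> @ [x])"
  obtain e where "is_minus (\<sigma> @ [x]) \<tau> e" using minus_word[OF red] unfolding \<tau>_def .
  then have e: "\<sigma> @ [x] \<sim>\<^sub>C\<^sub>K \<tau> @ e" "length e = l" "sorted_wrt (>) e" "sh \<tau> = (\<lambda>i. sh (\<sigma> @ [x]) i - 1)"
    by (auto simp: is_minus_def rows)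
  have r\<tau>e: "reduced (\<tau> @ e)" using reduced_ck[OF e(1) red] .
  have r\<tau>: "reduced \<tau>" using reduced_prefix[OF r\<tau>e] .
  have "sh \<sigma> (Suc h) \<le> m" using sh_antimono[OF r\<sigma>, of h "Suc h"] by (simp add: m_def)
  then have "sh \<tau> (Suc h) < sh \<tau> h" using e(4) sh m by auto
  then obtain \<tau>' y where \<tau>': "\<tau> \<sim>\<^sub>C\<^sub>K \<tau>' @ [y]" "reduced (\<tau>' @ [y])" "new_row \<tau>' y = h"
    using delete_exists[OF r\<tau>] by blast
  have sh\<tau>: "sh \<tau> = (sh \<tau>')(h := Suc (sh \<tau>' h))"
    using sh_ck[OF r\<tau> \<tau>'(1)] sh_snoc[OF \<tau>'(2)] \<tau>'(3) by simp
  have sh\<tau>': "sh \<tau>' i = sh \<sigma> i - 1" for i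
    using fun_cong[OF sh\<tau>, of i] e(4) sh m_def by (cases "i = h") auto
  have ck1: "\<tau> @ e \<sim>\<^sub>C\<^sub>K (\<tau>' @ [y]) @ e" by (rule ck_equiv_append[OF \<tau>'(1) ck_refl])
  have ck2: "\<sigma> @ [x] \<sim>\<^sub>C\<^sub>K \<tau>' @ (y # e)" using ck_trans[OF e(1) ck1] by simp
  have r2: "reduced (\<tau>' @ (y # e))" using reduced_ck[OF ck2 red] .
  have ne: "e \<noteq> []" using e(2) h by (auto simp: l_def)
  \<comment> \<open>Otherwise \<open>y # e\<close> would be a decreasing word longer than the number
    of rows.\<close>
  have "y < hd e"
  proof (rule ccontr)
    assume "\<not> y < hd e"
    moreover have "y \<noteq> hd e"
      using r2 not_reduced_square[of \<tau>' y "tl e"] ne by (cases e) auto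
    ultimately have "sorted_wrt (>) (y # e)" using e(3) ne by (cases e) auto
    then have "length (y # e) \<le> rows (\<tau>' @ (y # e))" by (rule dec_length_le_rows[OF r2])
    then show False using rows_ck[OF red ck2] rows e(2) by simp
  qed
  then obtain e' x' where e': "y # e \<sim>\<^sub>C\<^sub>K e' @ [x']" "sorted_wrt (>) e'" "length e' = length e"
    using hook_swap[OF reduced_suffix[OF r2] e(3) ne] by blast
  have "\<tau>' @ (y # e) \<sim>\<^sub>C\<^sub>K \<tau>' @ (e' @ [x'])" by (rule ck_equiv_append[OF ck_refl e'(1)])
  then have ck3: "\<sigma> @ [x] \<sim>\<^sub>C\<^sub>K (\<tau>' @ e') @ [x']" using ck_trans[OF ck2] by simp
  have r3: "reduced (\<tau>' @ e')" using reduced_prefix[OF reduced_ck[OF ck3 red]] .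
  have "rows (\<tau>' @ e') \<le> length e'"
    using rows_mono[of "\<tau>' @ e'" "[x']"] rows_ck[OF red ck3] rows e(2) e'(3) by simp
  from dec_sh[OF r3 e'(2) this, of "length e'"]
  have "sh (\<tau>' @ e') = (\<lambda>i. sh \<tau>' i + (if i < l then 1 else 0))" using e(2) e'(3) by simp
  then have "sh (\<tau>' @ e') i = sh \<sigma> i" for i using sh\<tau>'[of i] p[of i] by (auto split: if_splits)
  then have "sh (\<tau>' @ e') = sh \<sigma>" by auto
  from delete_unique(1)[OF red ck3 this[symmetric]] have "\<sigma> \<sim>\<^sub>C\<^sub>K \<tau>' @ e'" .
  then have "is_minus \<sigma> \<tau>' e'" using e'(2,3) e(2) sh\<tau>' by (auto simp: is_minus_def l_def)
  then have "\<tau>' \<sim>\<^sub>C\<^sub>K minus_word \<sigma>" by (rule is_minus_minus_word[OF r\<sigma>])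
  then have "minus_word \<sigma> \<sim>\<^sub>C\<^sub>K \<tau>'" by (rule ck_sym)
  then show ?thesis using that[of \<tau>' y] \<tau>' sh\<tau>'[of h] m by (simp add: \<tau>_def h_def m_def)
qed

text \<open>Induction on the column: peeling lowers it by one, and the row \<open>r\<close> found
  for the peeled words also lies in the first column, which adds one to its length. A lower row of
  length \<open>Suc (Suc n)\<close> would have length \<open>Suc n\<close> after peeling.\<close>

lemma alpha_snoc:
  "reduced (\<sigma> @ [x]) \<Longrightarrow> sh \<sigma> (new_row \<sigma> x) = n \<Longrightarrow>
   \<exists>r. alpha (\<sigma> @ [x]) = (alpha \<sigma>)(r := Suc n) \<and> alpha \<sigma> r = n \<and> (\<forall>i<r. alpha \<sigma> i \<noteq> Suc n)"
proof (induction n arbitrary: \<sigma> x)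
  case 0
  then show ?case using alpha_snoc_first[of \<sigma> x] by (simp only: One_nat_def)
next
  case (Suc n)
  note red = Suc.prems(1)
  have r\<sigma>: "reduced \<sigma>" by (rule reduced_prefix[OF red])
  have "0 < sh \<sigma> (new_row \<sigma> x)" using Suc.prems by simp
  then obtain \<tau> y where \<tau>: "minus_word (\<sigma> @ [x]) \<sim>\<^sub>C\<^sub>K \<tau> @ [y]" "minus_word \<sigma> \<sim>\<^sub>C\<^sub>K \<tau>" "reduced (\<tau> @ [y])"
    "Suc (sh \<tau> (new_row \<tau> y)) = sh \<sigma> (new_row \<sigma> x)"
    using minus_word_snoc[OF red] by metis
  have "sh \<tau> (new_row \<tau> y) = n" using \<tau>(4) Suc.prems by simp
  then obtain r where r: "alpha (\<tau> @ [y]) = (alpha \<tau>)(r := Suc n)" "alpha \<tau> r = n" "\<forall>i<r. alpha \<tau> i \<noteq> Suc n"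
    using Suc.IH[OF \<tau>(3)] by blast
  have a: "alpha (minus_word (\<sigma> @ [x])) = alpha (\<tau> @ [y])" "alpha (minus_word \<sigma>) = alpha \<tau>"
    using alpha_ck reduced_minus_word red r\<sigma> \<tau>(1,2) by auto
  have "new_row \<sigma> x \<noteq> rows \<sigma>" using Suc.prems sh_pos_iff[OF r\<sigma>, of "new_row \<sigma> x"] by simp
  then have C: "C1 (\<sigma> @ [x]) = C1 \<sigma>" using C1_snoc[OF r\<sigma>, of x] entry_None_iff[OF r\<sigma>, of x] by simp
  have eq: "alpha (\<sigma> @ [x]) i = (if i \<in> C1 \<sigma> then 1 else 0) + ((alpha \<tau>)(r := Suc n)) i"
    "alpha \<sigma> i = (if i \<in> C1 \<sigma> then 1 else 0) + alpha \<tau> i" for i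
    using alpha_rec[OF red, of i] alpha_rec[OF r\<sigma>, of i] a r(1) C by auto
  have "0 < alpha (minus_word (\<sigma> @ [x])) r" using a r(1) by simp
  then have rC: "r \<in> C1 \<sigma>"
    using alpha_pos_iff[OF reduced_minus_word[OF red], of r] C1_minus_word[OF red] C by auto
  have "alpha (\<sigma> @ [x]) = (alpha \<sigma>)(r := Suc (Suc n))" using eq rC by (auto simp: fun_eq_iff)
  moreover have "alpha \<sigma> r = Suc n" using eq(2)[of r] rC r(2) by simp
  moreover have "alpha \<sigma> i \<noteq> Suc (Suc n)" if "i < r" for i
  proof
    assume s: "alpha \<sigma> i = Suc (Suc n)"
    then have "i \<in> C1 \<sigma>" using alpha_pos_iff[OF r\<sigma>, of i] by simp
    then show False using s eq(2)[of i] r(3) that by simp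
  qed
  ultimately show ?case by blast
qed

subsection \<open>Recording tableaux are key tableaux\<close>

definition diag :: "(nat \<Rightarrow> nat) \<Rightarrow> (int \<times> nat) set" where
  "diag a = {(int r, c) | r c. 1 \<le> c \<and> c \<le> a r}"

lemma in_diag_iff: "(i, c) \<in> diag a \<longleftrightarrow> 0 \<le> i \<and> 1 \<le> c \<and> c \<le> a (nat i)"
  by (force simp: diag_def)

lemma diag_upd: "a r = n \<Longrightarrow> diag (a(r := Suc n)) = insert (int r, Suc n) (diag a)"
proof (rule set_eqI)
  fix b :: "int \<times> nat" assume n: "a r = n"
  obtain i c where b: "b = (i, c)" by force
  show "b \<in> diag (a(r := Suc n)) \<longleftrightarrow> b \<in> insert (int r, Suc n) (diag a)"
  proof (cases "i = int r")
    case True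
    then show ?thesis using n by (auto simp: b in_diag_iff)
  next
    case False
    then have "0 \<le> i \<Longrightarrow> nat i \<noteq> r" by auto
    then show ?thesis using False by (auto simp: b in_diag_iff)
  qed
qed

text \<open>The box added to the weak diagram. By \<open>box_column\<close> it shares its column
  with the new box of the insertion tableau; its row is found by comparing the two
  compositions.\<close>

definition box :: "nat list \<Rightarrow> nat \<Rightarrow> int \<times> nat" where
  "box \<sigma> x = (let r = (THE r. alpha (\<sigma> @ [x]) r \<noteq> alpha \<sigma> r) in (int r, alpha (\<sigma> @ [x]) r))"

lemma boxE:
  assumes "reduced (\<sigma> @ [x])"
  obtains r n where "n = sh \<sigma> (new_row \<sigma> x)" "box \<sigma> x = (int r, Suc n)"
    "alpha (\<sigma> @ [x]) = (alpha \<sigma>)(r := Suc n)" "alpha \<sigma> r = n" "\<And>i. i < r \<Longrightarrow> alpha \<sigma> i \<noteq> Suc n"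
proof -
  define n where "n = sh \<sigma> (new_row \<sigma> x)"
  obtain r where r: "alpha (\<sigma> @ [x]) = (alpha \<sigma>)(r := Suc n)" "alpha \<sigma> r = n" "\<forall>i<r. alpha \<sigma> i \<noteq> Suc n"
    using alpha_snoc[OF assms] n_def by blast
  have "(THE r. alpha (\<sigma> @ [x]) r \<noteq> alpha \<sigma> r) = r"
    by (rule the_equality) (use r in \<open>auto split: if_splits\<close>)
  then have "box \<sigma> x = (int r, Suc n)" using r by (simp add: box_def)
  then show ?thesis using that n_def r by blast
qed

lemma box_column: "reduced (\<sigma> @ [x]) \<Longrightarrow> snd (box \<sigma> x) = Suc (sh \<sigma> (new_row \<sigma> x))"
  by (metis boxE snd_conv)

lemma box_ck:
  assumes "reduced (\<sigma> @ [x])" "\<sigma> \<sim>\<^sub>C\<^sub>K \<tau>"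
  shows "box \<sigma> x = box \<tau> x"
proof -
  have "\<sigma> @ [x] \<sim>\<^sub>C\<^sub>K \<tau> @ [x]" by (rule ck_equiv_append[OF assms(2) ck_refl])
  then show ?thesis using alpha_ck[OF assms(1)] alpha_ck[OF reduced_prefix[OF assms(1)] assms(2)]
    by (simp add: box_def)
qed

text \<open>In a partition shape, of two successively added boxes the later one lies further right
  exactly when it does not lie in a later row; \<open>new_row_less_iff\<close> translates this into
  letters.\<close>

lemma box_column_less:
  assumes "reduced (\<sigma> @ [y, x])"
  shows "snd (box \<sigma> y) < snd (box (\<sigma> @ [y]) x) \<longleftrightarrow> y < x"
proof -
  have r: "reduced (\<sigma> @ [y])" "reduced ((\<sigma> @ [y]) @ [x])"
    using assms reduced_prefix[of "\<sigma> @ [y]" "[x]"] by auto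
  define k where "k = new_row \<sigma> y"
  define k' where "k' = new_row (\<sigma> @ [y]) x"
  have s: "sh (\<sigma> @ [y]) k = Suc (sh \<sigma> k)" using sh_snoc[OF r(1)] by (simp add: k_def)
  have s': "sh ((\<sigma> @ [y]) @ [x]) = (sh (\<sigma> @ [y]))(k' := Suc (sh (\<sigma> @ [y]) k'))"
    using sh_snoc[OF r(2)] by (simp add: k'_def)
  have b: "snd (box \<sigma> y) = sh (\<sigma> @ [y]) k" "snd (box (\<sigma> @ [y]) x) = Suc (sh (\<sigma> @ [y]) k')"
    using box_column[OF r(1)] box_column[OF r(2)] s by (simp_all add: k_def k'_def)
  show ?thesis
  proof (cases "k < k'")
    case True
    then have "sh ((\<sigma> @ [y]) @ [x]) k' \<le> sh ((\<sigma> @ [y]) @ [x]) k" by (intro sh_antimono[OF r(2)]) simp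
    then have "\<not> snd (box \<sigma> y) < snd (box (\<sigma> @ [y]) x)" using True s' b by simp
    then show ?thesis using new_row_less_iff[OF assms] True by (simp add: k_def k'_def)
  next
    case False
    then have "sh (\<sigma> @ [y]) k \<le> sh (\<sigma> @ [y]) k'" by (intro sh_antimono[OF r(1)]) simp
    moreover have "\<not> x < y" using new_row_less_iff[OF assms] False by (simp add: k_def k'_def)
    moreover have "x \<noteq> y" using assms not_reduced_square[of \<sigma> x "[]"] by auto
    ultimately show ?thesis using b by simp
  qed
qed

text \<open>An increasing factorization is encoded as a list of pairs (label, letter), the label being the
  index of the component containing the letter.\<close>

definition bw_rel :: "nat \<times> nat \<Rightarrow> nat \<times> nat \<Rightarrow> bool" where
  "bw_rel p q \<longleftrightarrow> fst q < fst p \<or> fst q = fst p \<and> snd p < snd q"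

lemma bw_rel_trans: "bw_rel p q \<Longrightarrow> bw_rel q s \<Longrightarrow> bw_rel p s"
  by (auto simp: bw_rel_def)

definition biword :: "(nat \<times> nat) list \<Rightarrow> bool" where
  "biword bw \<longleftrightarrow> reduced (map snd bw) \<and> sorted_wrt bw_rel bw \<and> (\<forall>p\<in>set bw. 1 \<le> fst p)"

text \<open>Recursion over the reversed biword, because a box is determined by the letters that
  precede it in the word.\<close>

fun rec_rev :: "(nat \<times> nat) list \<Rightarrow> tableau" where
  "rec_rev [] = Map.empty"
| "rec_rev (p # bw) = (rec_rev bw)(box (rev (map snd bw)) (snd p) \<mapsto> fst p)"

definition rec_tab :: "(nat \<times> nat) list \<Rightarrow> tableau" where
  "rec_tab bw = rec_rev (rev bw)"

lemma rec_tab_Nil [simp]: "rec_tab [] = Map.empty"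
  by (simp add: rec_tab_def)

lemma rec_tab_snoc: "rec_tab (bw @ [(i, x)]) = (rec_tab bw)(box (map snd bw) x \<mapsto> i)"
  by (simp add: rec_tab_def rev_map)

lemma biword_snocD: "biword (bw @ [p]) \<Longrightarrow> biword bw"
  using reduced_prefix by (auto simp: biword_def sorted_wrt_append)

lemma dom_rec_tab: "reduced (map snd bw) \<Longrightarrow> dom (rec_tab bw) = diag (alpha (map snd bw))"
proof (induction bw rule: rev_induct)
  case Nil
  then show ?case by (auto simp: diag_def)
next
  case (snoc p bw)
  obtain i x where p: "p = (i, x)" by force
  have r: "reduced (map snd bw @ [x])" using snoc.prems p by simp
  obtain r' n where a: "box (map snd bw) x = (int r', Suc n)"
    "alpha (map snd bw @ [x]) = (alpha (map snd bw))(r' := Suc n)" "alpha (map snd bw) r' = n"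
    using boxE[OF r] by metis
  have "dom (rec_tab (bw @ [p])) = insert (int r', Suc n) (dom (rec_tab bw))"
    unfolding p rec_tab_snoc a(1) by simp
  moreover have "map snd (bw @ [p]) = map snd bw @ [x]" by (simp add: p)
  ultimately show ?case using snoc.IH[OF reduced_prefix[OF r]] diag_upd[of "alpha (map snd bw)" r' n, OF a(3)] a(2) by (simp only:)
qed

lemma box_fresh:
  assumes "reduced (map snd bw @ [x])"
  shows "rec_tab bw (box (map snd bw) x) = None"
proof -
  obtain r n where "box (map snd bw) x = (int r, Suc n)" "alpha (map snd bw) r = n"
    using boxE[OF assms] by metis
  then have "box (map snd bw) x \<notin> diag (alpha (map snd bw))" by (simp add: in_diag_iff)
  then show ?thesis using dom_rec_tab[OF reduced_prefix[OF assms]] by blast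
qed

text \<open>Labels weakly decrease along a biword, and within a block of equal labels the letters
  increase, so the boxes move strictly to the right. Hence the last box is the rightmost one with
  the smallest entry.\<close>

lemma rec_tab_entries:
  "biword (bw @ [(i, x)]) \<Longrightarrow> rec_tab bw b = Some j \<Longrightarrow>
   i \<le> j \<and> (j = i \<longrightarrow> snd b < snd (box (map snd bw) x))"
proof (induction bw arbitrary: i x b j rule: rev_induct)
  case (snoc p bw)
  obtain k y where p: "p = (k, y)" by force
  have v: "biword (bw @ [(k, y)])" using snoc.prems(1) biword_snocD p by blast
  have rel: "i < k \<or> i = k \<and> y < x"
    using snoc.prems(1) p by (auto simp: biword_def sorted_wrt_append bw_rel_def)
  have red: "reduced (map snd bw @ [y, x])" using snoc.prems(1) p by (simp add: biword_def)
  have b: "(b = box (map snd bw) y \<and> j = k) \<or> rec_tab bw b = Some j"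
    using snoc.prems(2) by (auto simp: p rec_tab_snoc split: if_splits)
  then have kj: "k \<le> j" using snoc.IH[OF v, of b j] by auto
  show ?case
  proof (cases "i < k")
    case True
    then show ?thesis using kj by simp
  next
    case False
    then have ik: "i = k" "y < x" using rel by auto
    have lt: "snd (box (map snd bw) y) < snd (box (map snd bw @ [y]) x)"
      using box_column_less[OF red] ik by simp
    have "snd b < snd (box (map snd bw @ [y]) x)" if "j = i"
      using b snoc.IH[OF v, of b j] that ik lt by auto
    then show ?thesis using kj ik by (simp add: p)
  qed
qed simp

lemma alpha_0: "reduced \<rho> \<Longrightarrow> alpha \<rho> 0 = 0"
  using alpha_pos_iff[of \<rho> 0] C1_subset[of \<rho>] reduced_pos[of \<rho> 0] by auto

lemma finite_alpha: "reduced \<rho> \<Longrightarrow> finite {r. alpha \<rho> r \<noteq> 0}"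
  using alpha_pos_iff[of \<rho>] finite_C1[of \<rho>] by (simp add: neq0_conv)

lemma positive_rows_diag: "a 0 = 0 \<Longrightarrow> dom T = diag a \<Longrightarrow> positive_rows T"
proof -
  assume a: "a 0 = 0" "dom T = diag a"
  have "0 < r" if "(r, c) \<in> dom T" for r c
    using that a by (cases "r = 0") (auto simp only: in_diag_iff, auto)
  then show ?thesis by (auto simp: positive_rows_def)
qed

lemma shape_diag: "dom T = diag a \<Longrightarrow> shape T = a"
proof
  fix i assume "dom T = diag a"
  then have "{c. (int i, c) \<in> dom T} = {1..a i}" by (auto simp: in_diag_iff)
  then show "shape T i = a i" by (simp add: shape_def)
qed

lemma is_tableau_diag:
  "is_tableau T \<Longrightarrow> positive_rows T \<Longrightarrow> dom T = diag (shape T)"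
proof (intro set_eqI)
  fix b :: "int \<times> nat" assume t: "is_tableau T" "positive_rows T"
  obtain i c where b: "b = (i, c)" by force
  have sh: "(i, c) \<in> dom T \<longleftrightarrow> 1 \<le> c \<and> c \<le> shape T (nat i)" if "0 \<le> i"
  proof -
    define A where "A = {c. (i, c) \<in> dom T}"
    have "finite (snd ` dom T)" using t by (simp add: is_tableau_def)
    then have f: "finite A" by (rule rev_finite_subset) (force simp: A_def)
    have pos: "\<And>c. c \<in> A \<Longrightarrow> 1 \<le> c" using t by (auto simp: A_def is_tableau_def)
    have down: "c' \<in> A" if "c \<in> A" "1 \<le> c'" "c' \<le> c" for c c'
      using t(1) that unfolding A_def is_tableau_def by blast
    have A: "A = {1..card A}"
    proof (cases "A = {}")
      case False
      then have "Max A \<in> A" using f by simp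
      then have "{1..Max A} \<subseteq> A" using down by auto
      moreover have "A \<subseteq> {1..Max A}" using pos f by auto
      ultimately have e: "A = {1..Max A}" by blast
      have "card A = Max A" using arg_cong[OF e, of card] by simp
      then show ?thesis using e by (rule ssubst)
    qed simp
    have "shape T (nat i) = card A" using that by (simp add: shape_def A_def)
    moreover have "c \<in> A \<longleftrightarrow> c \<in> {1..card A}" by (rule arg_cong[OF A, of "\<lambda>X. c \<in> X"])
    moreover have "(i, c) \<in> dom T \<longleftrightarrow> c \<in> A" by (simp add: A_def)
    ultimately show ?thesis by (simp only: atLeastAtMost_iff)
  qed
  show "b \<in> dom T \<longleftrightarrow> b \<in> diag (shape T)"
  proof (cases "0 \<le> i")
    case True
    then show ?thesis using sh by (simp only: b in_diag_iff) simp
  next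
    case False
    then have "(i, c) \<notin> dom T" using bspec[OF t(2)[unfolded positive_rows_def], of "(i, c)"] by auto
    then show ?thesis using False by (simp only: b in_diag_iff) simp
  qed
qed

lemma finite_diag: "finite {r. a r \<noteq> 0} \<Longrightarrow> finite (diag a)"
proof -
  assume f: "finite {r. a r \<noteq> 0}"
  have "b \<in> (\<lambda>(r, c). (int r, c)) ` (SIGMA r:{r. a r \<noteq> 0}. {..a r})" if "b \<in> diag a" for b
  proof -
    obtain r c where "b = (int r, c)" "1 \<le> c" "c \<le> a r" using \<open>b \<in> diag a\<close> by (auto simp: diag_def)
    then show ?thesis by (intro image_eqI[of _ _ "(r, c)"]) auto
  qed
  then have "diag a \<subseteq> (\<lambda>(r, c). (int r, c)) ` (SIGMA r:{r. a r \<noteq> 0}. {..a r})" by blast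
  then show ?thesis by (rule finite_subset) (use f in simp)
qed

lemma is_tableau_diagI:
  assumes "dom T = diag a" "finite {r. a r \<noteq> 0}" "\<And>x. x \<in> ran T \<Longrightarrow> 1 \<le> x"
  shows "is_tableau T"
  using assms finite_diag[of a] unfolding is_tableau_def by (auto simp: in_diag_iff)

lemma biword_ran: "biword bw \<Longrightarrow> rec_tab bw b = Some j \<Longrightarrow> j \<in> fst ` set bw"
proof (induction bw rule: rev_induct)
  case (snoc p bw)
  then show ?case using biword_snocD[OF snoc.prems(1)]
    by (cases p) (auto simp: rec_tab_snoc split: if_splits)
qed simp

text \<open>The new box has the smallest label \<open>l\<close>, ends its row and is the only box
  with this label in its column. A lower row that reaches column \<open>Suc n\<close> does not end
  there, by the growth rule; its next entry exceeds \<open>l\<close>, because all other boxes with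
  entry \<open>l\<close> lie in columns before \<open>Suc n\<close>. This is condition (c).\<close>

lemma key_tableau_rec_tab: "biword bw \<Longrightarrow> key_tableau (rec_tab bw)"
proof (induction bw rule: rev_induct)
  case Nil
  then show ?case by (simp add: key_tableau_def is_tableau_def)
next
  case (snoc p bw)
  obtain l x where p: "p = (l, x)" by force
  define T where "T = rec_tab bw"
  define b where "b = box (map snd bw) x"
  have v: "biword (bw @ [(l, x)])" using snoc.prems p by simp
  have key: "key_tableau T" using snoc.IH biword_snocD[OF snoc.prems] by (simp add: T_def)
  have r: "reduced (map snd bw @ [x])" using v by (simp add: biword_def)
  obtain r' n where b: "b = (int r', Suc n)" "alpha (map snd bw) r' = n"
    "\<And>i. i < r' \<Longrightarrow> alpha (map snd bw) i \<noteq> Suc n"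
    using boxE[OF r] unfolding b_def by metis
  have dT: "dom T = diag (alpha (map snd bw))" using dom_rec_tab[OF reduced_prefix[OF r]] by (simp add: T_def)
  have fresh: "T b = None" using box_fresh[OF r] by (simp add: T_def b_def)
  have ent: "l \<le> j" "j = l \<Longrightarrow> c < Suc n" if "T (i, c) = Some j" for i c j
    using rec_tab_entries[OF v, of "(i, c)" j] that b(1) by (auto simp: T_def b_def)
  have e: "rec_tab (bw @ [p]) = T(b \<mapsto> l)" by (simp add: p rec_tab_snoc T_def b_def)
  have inT: "T (i, c) \<noteq> None \<longleftrightarrow> 0 \<le> i \<and> 1 \<le> c \<and> c \<le> alpha (map snd bw) (nat i)" for i c
    using dT by (metis domIff in_diag_iff)
  have tab: "is_tableau (T(b \<mapsto> l))"
  proof (rule is_tableau_diagI)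
    show "dom (T(b \<mapsto> l)) = diag (alpha (map snd (bw @ [p])))"
      using dom_rec_tab[of "bw @ [p]"] snoc.prems by (simp add: e biword_def del: map_append)
    show "finite {r. alpha (map snd (bw @ [p])) r \<noteq> 0}"
      using snoc.prems finite_alpha unfolding biword_def by blast
    fix y assume "y \<in> ran (T(b \<mapsto> l))"
    then obtain c where "rec_tab (bw @ [p]) c = Some y" unfolding e ran_def by blast
    then have "y \<in> fst ` set (bw @ [p])" using biword_ran[OF snoc.prems] by blast
    then show "1 \<le> y" using snoc.prems unfolding biword_def by auto
  qed
  have a: "y \<le> z" if "c < c'" "(T(b \<mapsto> l)) (i, c) = Some z" "(T(b \<mapsto> l)) (i, c') = Some y" for i c c' z y
  proof (cases "b = (i, c')")
    case True
    then show ?thesis using that ent(1)[of i c z] by (auto split: if_splits)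
  next
    case False
    then have T': "T (i, c') = Some y" using that by (simp split: if_splits)
    have "b \<noteq> (i, c)"
    proof
      assume "b = (i, c)"
      moreover have "c' \<le> alpha (map snd bw) (nat i)" using inT[of i c'] T' by simp
      ultimately show False using b that(1) by auto
    qed
    then have "T (i, c) = Some z" using that by (simp split: if_splits)
    then show ?thesis using key T' that(1) unfolding key_tableau_def by blast
  qed
  have d: "z \<noteq> y" if "i \<noteq> i'" "(T(b \<mapsto> l)) (i, c) = Some z" "(T(b \<mapsto> l)) (i', c) = Some y" for i i' c z y
  proof -
    note ne = that(1)
    consider "b = (i, c)" "b \<noteq> (i', c)" | "b = (i', c)" "b \<noteq> (i, c)" | "b \<noteq> (i, c)" "b \<noteq> (i', c)"
      using ne by (metis Pair_inject)
    then show ?thesis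
    proof cases
      case 1
      then show ?thesis using that ent(2)[of i' c y] b(1) by auto
    next
      case 2
      then show ?thesis using that ent(2)[of i c z] b(1) by auto
    next
      case 3
      then show ?thesis using that key unfolding key_tableau_def by (auto split: if_splits)
    qed
  qed
  have c: "\<exists>w. (T(b \<mapsto> l)) (i, j + 1) = Some w \<and> w > y"
    if h: "i < k" "(T(b \<mapsto> l)) (i, j) = Some z" "(T(b \<mapsto> l)) (k, j) = Some y" "z > y" for i k j z y
  proof (cases "b = (k, j)")
    case True
    have y: "y = l" using True h by simp
    have "b \<noteq> (i, j)" using True h(1) by auto
    then have "T (i, j) = Some z" using h by (simp split: if_splits)
    then have ij: "0 \<le> i" "1 \<le> j" "j \<le> alpha (map snd bw) (nat i)" using inT[of i j] by auto
    have "nat i < r'" "j = Suc n" using True b(1) h(1) ij(1) by auto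
    then have "alpha (map snd bw) (nat i) \<noteq> j" using b(3) by auto
    then have "T (i, j + 1) \<noteq> None" using inT[of i "j + 1"] ij by auto
    then obtain w where w: "T (i, j + 1) = Some w" by auto
    then have "l < w" using ent[OF w] \<open>j = Suc n\<close> by (metis add.commute le_neq_implies_less less_Suc_eq less_irrefl plus_1_eq_Suc)
    moreover have "b \<noteq> (i, j + 1)" using True by auto
    ultimately show ?thesis using w y by auto
  next
    case False
    then have Tk: "T (k, j) = Some y" using h by (simp split: if_splits)
    \<comment> \<open>The box with the smallest label cannot carry the larger of two
      entries.\<close>
    have "b \<noteq> (i, j)" using h ent(1)[OF Tk] by (auto split: if_splits)
    then have "T (i, j) = Some z" using h by (simp split: if_splits)
    then obtain w where w: "T (i, j + 1) = Some w" "w > y"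
      using key Tk h(1,4) unfolding key_tableau_def by blast
    then show ?thesis using fresh by auto
  qed
  show ?case unfolding e key_tableau_def using tab a d c by blast
qed

text \<open>The last box is recovered as the rightmost occurrence of the smallest entry. Its column
  determines the corner to be removed from the insertion tableau, and \<open>delete_unique\<close>
  then gives the last letter.\<close>

lemma biword_unique:
  "biword bw \<Longrightarrow> biword bw' \<Longrightarrow> map snd bw \<sim>\<^sub>C\<^sub>K map snd bw' \<Longrightarrow> rec_tab bw = rec_tab bw' \<Longrightarrow> bw = bw'"
proof (induction bw arbitrary: bw' rule: rev_induct)
  case Nil
  then show ?case using ck_equiv_length by fastforce
next
  case (snoc p bw)
  obtain p' bw0 where bw': "bw' = bw0 @ [p']"
    using ck_equiv_length[OF snoc.prems(3)] by (cases bw' rule: rev_cases) auto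
  obtain i x i' x' where p: "p = (i, x)" "p' = (i', x')" by force
  note v = snoc.prems(1)[unfolded p] and v' = snoc.prems(2)[unfolded bw' p]
  define w where "w = map snd bw"
  define w0 where "w0 = map snd bw0"
  define b where "b = box w x"
  define b' where "b' = box w0 x'"
  have r: "reduced (w @ [x])" "reduced (w0 @ [x'])" using v v' by (simp_all add: biword_def w_def w0_def)
  have ck: "w @ [x] \<sim>\<^sub>C\<^sub>K w0 @ [x']" using snoc.prems(3) by (simp add: bw' p w_def w0_def)
  have T: "(rec_tab bw)(b \<mapsto> i) = (rec_tab bw0)(b' \<mapsto> i')"
    using snoc.prems(4) unfolding bw' p rec_tab_snoc b_def b'_def w_def w0_def .
  have f: "rec_tab bw b = None" "rec_tab bw0 b' = None"
    using box_fresh r by (simp_all add: b_def b'_def w_def w0_def)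
  have bb: "b = b'"
  proof (rule ccontr)
    assume ne: "b \<noteq> b'"
    have 1: "rec_tab bw0 b = Some i" using fun_cong[OF T, of b] ne by simp
    have 2: "rec_tab bw b' = Some i'" using fun_cong[OF T, of b'] ne by (simp split: if_splits)
    have "i' \<le> i" "i = i' \<Longrightarrow> snd b < snd b'"
      using rec_tab_entries[OF v' 1] by (simp_all add: b'_def w0_def)
    moreover have "i \<le> i'" "i' = i \<Longrightarrow> snd b' < snd b"
      using rec_tab_entries[OF v 2] by (simp_all add: b_def w_def)
    ultimately show False by (metis le_antisym less_asym)
  qed
  have ii: "i = i'" using fun_cong[OF T, of b] bb by simp
  have T0: "rec_tab bw = rec_tab bw0"
  proof
    fix c show "rec_tab bw c = rec_tab bw0 c"
      using fun_cong[OF T, of c] bb f by (cases "c = b") auto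
  qed
  define k where "k = new_row w x"
  define k' where "k' = new_row w0 x'"
  have col: "Suc (sh w k) = Suc (sh w0 k')"
    using box_column[OF r(1)] box_column[OF r(2)] bb by (simp add: b_def b'_def k_def k'_def)
  have S: "(sh w)(k := Suc (sh w k)) = (sh w0)(k' := Suc (sh w0 k'))"
    using sh_ck[OF r(1) ck] sh_snoc[OF r(1)] sh_snoc[OF r(2)] by (simp add: k_def k'_def)
  \<comment> \<open>A partition shape has at most one removable corner in each column.\<close>
  have "k = k'"
  proof (rule ccontr)
    assume ne: "k \<noteq> k'"
    have 1: "sh w0 k = Suc (sh w k)" using fun_cong[OF S, of k] ne by simp
    have 2: "sh w k' = Suc (sh w0 k')" using fun_cong[OF S, of k'] ne by (simp split: if_splits)
    have rw: "reduced w" "reduced w0" using r reduced_prefix by auto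
    show False
    proof (cases "k < k'")
      case True
      then have "sh w k' \<le> sh w k" using sh_antimono[OF rw(1)] by simp
      then show False using 2 col by simp
    next
      case False
      then have "sh w0 k \<le> sh w0 k'" using sh_antimono[OF rw(2)] by simp
      then show False using 1 col by simp
    qed
  qed
  then have "sh w = sh w0" using S col by (metis fun_upd_triv fun_upd_upd nat.inject)
  then have "w \<sim>\<^sub>C\<^sub>K w0" "x = x'" using delete_unique[OF r(1) ck] by auto
  moreover have "bw = bw0"
    using snoc.IH[of bw0] biword_snocD v v' T0 \<open>w \<sim>\<^sub>C\<^sub>K w0\<close> unfolding w_def w0_def by blast
  ultimately show ?case by (simp add: bw' p ii)
qed

section \<open>From key tableaux back to biwords\<close>

lemma finite_sh: "reduced \<rho> \<Longrightarrow> 1 \<le> c \<Longrightarrow> finite {k. c \<le> sh \<rho> k}"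
  by (rule finite_subset[of _ "{..<rows \<rho>}"]) (use sh_pos_iff[of \<rho>] in force, simp)

text \<open>Each letter adds a box in the same column of both diagrams, so \<open>alpha\<close> is a
  rearrangement of the partition shape.\<close>

lemma card_alpha_sh:
  "reduced \<rho> \<Longrightarrow> 1 \<le> c \<Longrightarrow> card {r. c \<le> alpha \<rho> r} = card {k. c \<le> sh \<rho> k}"
proof (induction \<rho> rule: rev_induct)
  case (snoc x \<sigma>)
  have r\<sigma>: "reduced \<sigma>" using reduced_prefix[OF snoc.prems(1)] .
  obtain r n where a: "n = sh \<sigma> (new_row \<sigma> x)" "alpha (\<sigma> @ [x]) = (alpha \<sigma>)(r := Suc n)" "alpha \<sigma> r = n"
    using boxE[OF snoc.prems(1)] by metis
  have s: "sh (\<sigma> @ [x]) = (sh \<sigma>)(new_row \<sigma> x := Suc n)" using sh_snoc[OF snoc.prems(1)] a(1) by simp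
  have f: "finite {r. c \<le> alpha \<sigma> r}" "finite {k. c \<le> sh \<sigma> k}"
    using snoc.prems(2) by (auto intro!: finite_subset[OF _ finite_alpha[OF r\<sigma>]] finite_sh[OF r\<sigma>])
  show ?case
  proof (cases "c = Suc n")
    case True
    have "{r'. c \<le> alpha (\<sigma> @ [x]) r'} = insert r {r. c \<le> alpha \<sigma> r}"
      "{k. c \<le> sh (\<sigma> @ [x]) k} = insert (new_row \<sigma> x) {k. c \<le> sh \<sigma> k}" using a s True by auto
    then show ?thesis using snoc.IH[OF r\<sigma>] snoc.prems f a True by simp
  next
    case False
    then have "{r'. c \<le> alpha (\<sigma> @ [x]) r'} = {r. c \<le> alpha \<sigma> r}"
      "{k. c \<le> sh (\<sigma> @ [x]) k} = {k. c \<le> sh \<sigma> k}" using a s by (auto split: if_splits)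
    then show ?thesis using snoc.IH[OF r\<sigma>] snoc.prems by simp
  qed
qed simp

lemma corner_exists:
  assumes "reduced \<rho>" "alpha \<rho> r = c" "1 \<le> c"
  obtains k where "sh \<rho> k = c" "sh \<rho> (Suc k) < c"
proof -
  have f: "finite {r. c \<le> alpha \<rho> r}"
    using assms(3) by (auto intro!: finite_subset[OF _ finite_alpha[OF assms(1)]])
  have "card {r. Suc c \<le> alpha \<rho> r} < card {r. c \<le> alpha \<rho> r}"
  proof (rule psubset_card_mono[OF f])
    have "r \<in> {r. c \<le> alpha \<rho> r}" "r \<notin> {r. Suc c \<le> alpha \<rho> r}" using assms(2) by auto
    moreover have "{r. Suc c \<le> alpha \<rho> r} \<subseteq> {r. c \<le> alpha \<rho> r}" by auto
    ultimately show "{r. Suc c \<le> alpha \<rho> r} \<subset> {r. c \<le> alpha \<rho> r}" by blast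
  qed
  then have "card {k. Suc c \<le> sh \<rho> k} < card {k. c \<le> sh \<rho> k}"
    using card_alpha_sh[OF assms(1), of c] card_alpha_sh[OF assms(1), of "Suc c"] assms(3) by simp
  then have "{k. Suc c \<le> sh \<rho> k} \<noteq> {k. c \<le> sh \<rho> k}" by auto
  then have ne: "{k. sh \<rho> k = c} \<noteq> {}" by (auto simp: Suc_le_eq order.order_iff_strict)
  have fin: "finite {k. sh \<rho> k = c}" by (rule finite_subset[OF _ finite_sh[OF assms(1,3)]]) auto
  define k where "k = Max {k. sh \<rho> k = c}"
  have "k \<in> {k. sh \<rho> k = c}" unfolding k_def by (rule Max_in[OF fin ne])
  moreover have "sh \<rho> (Suc k) \<noteq> c" using Max_ge[OF fin, of "Suc k"] by (auto simp: k_def)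
  moreover have "sh \<rho> (Suc k) \<le> sh \<rho> k" using sh_antimono[OF assms(1), of k "Suc k"] by simp
  ultimately show ?thesis using that[of k] by simp
qed

lemma biword_snocI:
  assumes "biword bw" "reduced (map snd bw @ [x])" "1 \<le> i" "bw \<noteq> [] \<Longrightarrow> bw_rel (last bw) (i, x)"
  shows "biword (bw @ [(i, x)])"
proof -
  have "bw_rel p (i, x)" if "p \<in> set bw" for p
  proof -
    have ne: "bw \<noteq> []" using that by auto
    then have "bw = butlast bw @ [last bw]" by simp
    then have "p = last bw \<or> bw_rel p (last bw)"
      using that assms(1) unfolding biword_def by (metis Un_iff insert_iff empty_iff list.set set_append sorted_wrt_append)
    then show ?thesis using assms(4)[OF ne] bw_rel_trans by blast
  qed
  then show ?thesis using assms by (auto simp: biword_def sorted_wrt_append)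
qed

text \<open>The rightmost occurrence of the smallest entry must be the box of the last letter. The
  key conditions make it the end of its row and make this row the lowest one of its length, which is
  exactly where the growth rule puts a box of that column.\<close>

lemma biword_exists:
  "reduced \<rho> \<Longrightarrow> key_tableau T \<Longrightarrow> dom T = diag (alpha \<rho>) \<Longrightarrow>
   \<exists>bw. biword bw \<and> map snd bw \<sim>\<^sub>C\<^sub>K \<rho> \<and> rec_tab bw = T"
proof (induction "length \<rho>" arbitrary: \<rho> T)
  case 0
  then have "\<rho> = []" by simp
  then have "dom T = {}" using 0 by (auto simp: diag_def)
  then have "biword [] \<and> map snd [] \<sim>\<^sub>C\<^sub>K \<rho> \<and> rec_tab [] = T"
    using \<open>\<rho> = []\<close> by (simp add: biword_def)
  then show ?case by blast
next
  case (Suc m)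
  note red = Suc.prems(1) and key = Suc.prems(2) and dT = Suc.prems(3)
  have "\<rho> \<noteq> []" using Suc.hyps by auto
  have inT: "T (i, c) \<noteq> None \<longleftrightarrow> 0 \<le> i \<and> 1 \<le> c \<and> c \<le> alpha \<rho> (nat i)" for i c
    using dT by (metis domIff in_diag_iff)
  have tab: "finite (dom T)" "\<And>x. x \<in> ran T \<Longrightarrow> 1 \<le> x" using key by (auto simp: key_tableau_def is_tableau_def)
  have "Min (set \<rho>) \<in> C1 \<rho>" using Min_in_C1[OF red] \<open>\<rho> \<noteq> []\<close> by simp
  then have "T (int (Min (set \<rho>)), 1) \<noteq> None" using inT alpha_pos_iff[OF red] by (simp add: Suc_le_eq)
  then have ne: "ran T \<noteq> {}" by (auto simp: ran_def)
  define l where "l = Min (ran T)"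
  have fr: "finite (ran T)" using tab(1) by (rule finite_ran)
  have l: "l \<in> ran T" "\<And>x. x \<in> ran T \<Longrightarrow> l \<le> x" using fr ne by (auto simp: l_def)
  define B where "B = {b. T b = Some l}"
  have "B \<subseteq> dom T" "B \<noteq> {}" using l(1) by (auto simp: B_def ran_def)
  then have fB: "finite (snd ` B)" "snd ` B \<noteq> {}" using tab(1) finite_subset by auto
  define c where "c = Max (snd ` B)"
  have "c \<in> snd ` B" unfolding c_def by (rule Max_in[OF fB])
  then obtain i where b: "T (i, c) = Some l" by (auto simp: B_def)
  have cmax: "snd b' \<le> c" if "T b' = Some l" for b'
    using that fB(1) unfolding c_def by (intro Max_ge) (auto simp: B_def)
  have ge: "l \<le> j" if "T b' = Some j" for b' j using l(2)[OF ranI[of T b' j, OF that]] .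
  have ic: "0 \<le> i" "1 \<le> c" "c \<le> alpha \<rho> (nat i)" using inT[of i c] b by auto
  define r where "r = nat i"
  have i: "i = int r" using ic by (simp add: r_def)
  \<comment> \<open>A further entry of this row would also be minimal, but further right.\<close>
  have rc: "alpha \<rho> r = c"
  proof (rule ccontr)
    assume "alpha \<rho> r \<noteq> c"
    then obtain j where j: "T (i, Suc c) = Some j" using inT[of i "Suc c"] ic by (auto simp: r_def)
    have "j \<le> l" using key b j unfolding key_tableau_def by (meson lessI)
    then have "j = l" using ge[OF j] by simp
    then show False using cmax[of "(i, Suc c)"] j by simp
  qed
  \<comment> \<open>A lower row of length \<open>c\<close> would have an entry larger than
    \<open>l\<close> in column \<open>c\<close>, and (c) would force it to be longer.\<close>
  have low: "alpha \<rho> i' \<noteq> c" if "i' < r" for i'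
  proof
    assume a: "alpha \<rho> i' = c"
    then obtain j where j: "T (int i', c) = Some j" using inT[of "int i'" c] ic by auto
    have lt: "int i' < i" using that i by simp
    have "j \<noteq> l" using key b j lt unfolding key_tableau_def by (metis less_irrefl)
    then have "j > l" using ge[OF j] by simp
    then obtain z where "T (int i', c + 1) = Some z" using key b j lt unfolding key_tableau_def by blast
    then show False using inT[of "int i'" "c + 1"] a by simp
  qed
  obtain k where k: "sh \<rho> k = c" "sh \<rho> (Suc k) < c" using corner_exists[OF red rc ic(2)] .
  then obtain \<sigma> x where \<sigma>: "\<rho> \<sim>\<^sub>C\<^sub>K \<sigma> @ [x]" "reduced (\<sigma> @ [x])" "new_row \<sigma> x = k"
    using delete_exists[OF red, of k] by auto
  have r\<sigma>: "reduced \<sigma>" using reduced_prefix[OF \<sigma>(2)] .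
  have "sh \<rho> = (sh \<sigma>)(k := Suc (sh \<sigma> k))" using sh_ck[OF red \<sigma>(1)] sh_snoc[OF \<sigma>(2)] \<sigma>(3) by simp
  then have n: "Suc (sh \<sigma> k) = c" using k(1) by simp
  obtain r' where bx: "box \<sigma> x = (int r', c)" "alpha (\<sigma> @ [x]) = (alpha \<sigma>)(r' := c)"
    "Suc (alpha \<sigma> r') = c" "\<And>i. i < r' \<Longrightarrow> alpha \<sigma> i \<noteq> c"
    using boxE[OF \<sigma>(2)] n \<sigma>(3) by metis
  have a\<rho>: "alpha \<rho> = (alpha \<sigma>)(r' := c)" using alpha_ck[OF red \<sigma>(1)] bx(2) by simp
  \<comment> \<open>Both are the lowest row of length \<open>c\<close> in
    \<open>alpha \<rho>\<close>.\<close>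
  have rr: "r' = r"
  proof (rule linorder_cases[of r r'])
    assume "r < r'"
    then show ?thesis using bx(4)[of r] a\<rho> rc by simp
  next
    assume "r' < r"
    then show ?thesis using low[of r'] a\<rho> by simp
  qed simp
  define T0 where "T0 = T((i, c) := None)"
  have d0: "dom T0 = diag (alpha \<sigma>)"
  proof -
    have "diag (alpha \<rho>) = insert (i, c) (diag (alpha \<sigma>))"
      using diag_upd[of "alpha \<sigma>" r' "alpha \<sigma> r'"] bx(3) a\<rho> rr i by simp
    moreover have "(i, c) \<notin> diag (alpha \<sigma>)" using bx(3) rr i by (simp add: in_diag_iff)
    ultimately show ?thesis using dT by (simp add: T0_def)
  qed
  have T0: "T0 b' = Some j \<longleftrightarrow> b' \<noteq> (i, c) \<and> T b' = Some j" for b' j by (simp add: T0_def)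
  have key0: "key_tableau T0"
  proof -
    have "is_tableau T0"
      by (rule is_tableau_diagI[OF d0 finite_alpha[OF r\<sigma>]]) (use tab(2) T0 in \<open>auto simp: ran_def\<close>)
    moreover have "\<exists>z. T0 (i', j + 1) = Some z \<and> z > y"
      if h: "i' < k'" "T0 (i', j) = Some x'" "T0 (k', j) = Some y" "x' > y" for i' k' j x' y
    proof -
      have "T (i', j) = Some x'" "T (k', j) = Some y" using h(2,3) T0 by auto
      then obtain z where z: "T (i', j + 1) = Some z" "z > y"
        using h(1,4) key unfolding key_tableau_def by blast
      \<comment> \<open>The witness exceeds some entry of the tableau, so it is not the removed
        minimal box.\<close>
      moreover have "(i', j + 1) \<noteq> (i, c)" using z b ge[of "(k', j)" y] h(3) T0 by auto
      ultimately show ?thesis using T0 by blast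
    qed
    moreover have "y \<le> x'" if "c1 < c2" "T0 (i', c1) = Some x'" "T0 (i', c2) = Some y" for i' c1 c2 x' y
    proof -
      have "T (i', c1) = Some x'" "T (i', c2) = Some y" using that(2,3) T0 by auto
      then show ?thesis using key that(1) unfolding key_tableau_def by blast
    qed
    moreover have "x' \<noteq> y" if "i' \<noteq> k'" "T0 (i', c1) = Some x'" "T0 (k', c1) = Some y" for i' k' c1 x' y
    proof -
      have "T (i', c1) = Some x'" "T (k', c1) = Some y" using that(2,3) T0 by auto
      then show ?thesis using key that(1) unfolding key_tableau_def by blast
    qed
    ultimately show ?thesis unfolding key_tableau_def by blast
  qed
  have "m = length \<sigma>" using Suc.hyps(2) ck_equiv_length[OF \<sigma>(1)] by simp
  then obtain bw where bw: "biword bw" "map snd bw \<sim>\<^sub>C\<^sub>K \<sigma>" "rec_tab bw = T0"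
    using Suc.hyps(1)[OF _ r\<sigma> key0 d0] by blast
  have ck: "map snd bw @ [x] \<sim>\<^sub>C\<^sub>K \<sigma> @ [x]" by (rule ck_equiv_append[OF bw(2) ck_refl])
  have r2: "reduced (map snd bw @ [x])" using reduced_ck[OF ck_sym[OF ck] \<sigma>(2)] .
  have bxw: "box (map snd bw) x = (i, c)" using box_ck[OF r2 bw(2)] bx(1) rr i by simp
  have "rec_tab (bw @ [(l, x)]) = T" using bw(3) bxw b by (auto simp: rec_tab_snoc T0_def)
  moreover have "biword (bw @ [(l, x)])"
  proof (rule biword_snocI[OF bw(1) r2])
    show "1 \<le> l" using tab(2) l(1) by blast
    assume ne: "bw \<noteq> []"
    then obtain bw1 j y where bw1: "bw = bw1 @ [(j, y)]" by (metis append_butlast_last_id surj_pair)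
    define b' where "b' = box (map snd bw1) y"
    have "T0 b' = Some j" unfolding bw(3)[symmetric] bw1 rec_tab_snoc b'_def by simp
    then have Tb': "T b' = Some j" "b' \<noteq> (i, c)" using T0 by auto
    have "l \<le> j" using ge[OF Tb'(1)] .
    \<comment> \<open>An earlier box with label \<open>l\<close> lies in a column before
      \<open>c\<close>: no later column contains \<open>l\<close>, and column \<open>c\<close>
      contains it only once.\<close>
    moreover have "y < x" if "j = l"
    proof -
      obtain i1 c1 where b1: "b' = (i1, c1)" by force
      have "c1 \<noteq> c"
      proof
        assume "c1 = c"
        then have "i1 \<noteq> i" using Tb'(2) b1 by simp
        then show False using key b Tb'(1) b1 \<open>c1 = c\<close> that unfolding key_tableau_def by metis
      qed
      then have "snd b' < c" using cmax[of b'] Tb'(1) that b1 by simp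
      then have "snd (box (map snd bw1) y) < snd (box (map snd bw1 @ [y]) x)"
        using bxw by (simp add: bw1 b'_def)
      then show ?thesis using box_column_less[of "map snd bw1" y x] r2 bw1 by simp
    qed
    ultimately show "bw_rel (last bw) (l, x)" by (auto simp: bw1 bw_rel_def)
  qed
  moreover have "map snd (bw @ [(l, x)]) \<sim>\<^sub>C\<^sub>K \<rho>" using ck_trans[OF ck ck_sym[OF \<sigma>(1)]] by simp
  ultimately show ?case by blast
qed

lemma flagged_tableau_upd:
  assumes "T (i, c) = None"
  shows "flagged_tableau \<phi> (T((i, c) \<mapsto> l)) \<longleftrightarrow> flagged_tableau \<phi> T \<and> l \<le> \<phi> (nat i)"
proof
  assume a: "flagged_tableau \<phi> (T((i, c) \<mapsto> l))"
  have "x \<le> \<phi> (nat i')" if "T (i', c') = Some x" for i' c' x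
  proof -
    have "(i', c') \<noteq> (i, c)" using that assms by auto
    then have "(T((i, c) \<mapsto> l)) (i', c') = Some x" using that by (metis fun_upd_other)
    then show ?thesis using a unfolding flagged_tableau_def by blast
  qed
  moreover have "(T((i, c) \<mapsto> l)) (i, c) = Some l" by simp
  ultimately show "flagged_tableau \<phi> T \<and> l \<le> \<phi> (nat i)" using a unfolding flagged_tableau_def by blast
qed (auto simp: flagged_tableau_def)

text \<open>The row \<open>r\<close> of the new box is a letter of the word whose label is at least
  \<open>l\<close>; this bounds \<open>l\<close> by \<open>\<phi> r\<close>. Conversely, the
  smallest letter is itself a row; its first entry is at least \<open>l\<close> and at most
  \<open>\<phi>\<close> of this letter, hence at most \<open>\<phi> x\<close> by
  monotonicity.\<close>

lemma flagged_rec_tab_iff: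
  assumes "flag \<phi>"
  shows "biword bw \<Longrightarrow> (\<forall>p\<in>set bw. fst p \<le> \<phi> (snd p)) \<longleftrightarrow> flagged_tableau \<phi> (rec_tab bw)"
proof (induction bw rule: rev_induct)
  case Nil
  then show ?case by (simp add: flagged_tableau_def)
next
  case (snoc p bw)
  obtain l x where p: "p = (l, x)" by force
  define w where "w = map snd bw @ [x]"
  have v: "biword (bw @ [(l, x)])" using snoc.prems p by simp
  have red: "reduced w" using v by (simp add: biword_def w_def)
  have mono: "\<phi> a \<le> \<phi> b" if "1 \<le> a" "a \<le> b" for a b
    using assms that unfolding flag_def mono_on_def by (metis atLeast_iff order_trans)
  obtain r n where b: "box (map snd bw) x = (int r, Suc n)" "alpha w = (alpha (map snd bw))(r := Suc n)"
    using boxE[of "map snd bw" x] red unfolding w_def by metis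
  have T: "rec_tab (bw @ [p]) = (rec_tab bw)((int r, Suc n) \<mapsto> l)" by (simp add: p rec_tab_snoc b)
  have fresh: "rec_tab bw (int r, Suc n) = None" using box_fresh[of bw x] red b by (simp add: w_def)
  have split: "flagged_tableau \<phi> (rec_tab (bw @ [p])) \<longleftrightarrow> flagged_tableau \<phi> (rec_tab bw) \<and> l \<le> \<phi> r"
    unfolding T using flagged_tableau_upd[of "rec_tab bw" "int r" "Suc n", OF fresh] by simp
  have lmin: "l \<le> fst q" if "q \<in> set (bw @ [p])" for q
    using v that p by (auto simp: biword_def sorted_wrt_append bw_rel_def less_imp_le)
  have "r \<in> C1 w" using alpha_pos_iff[OF red, of r] b(2) by simp
  then have "r \<in> set w" using C1_subset[OF red] by blast
  then have "r \<in> snd ` set (bw @ [p])" by (simp add: w_def p)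
  then obtain q where q: "q \<in> set (bw @ [p])" "snd q = r" by blast
  have m1: "1 \<le> Min (set w)" "Min (set w) \<le> x" using reduced_pos[OF red] by (auto simp: w_def)
  have "Min (set w) \<in> C1 w" using Min_in_C1[OF red] by (simp add: w_def)
  then have "(int (Min (set w)), 1) \<in> dom (rec_tab (bw @ [p]))"
    using dom_rec_tab[of "bw @ [p]"] red alpha_pos_iff[OF red, of "Min (set w)"] p
    by (simp add: w_def in_diag_iff Suc_le_eq del: set_append)
  then obtain j where j: "rec_tab (bw @ [p]) (int (Min (set w)), 1) = Some j" by blast
  obtain q' where "q' \<in> set (bw @ [p])" "fst q' = j" using biword_ran[OF snoc.prems j] by blast
  then have lj: "l \<le> j" using lmin by blast
  note IH = snoc.IH[OF biword_snocD[OF snoc.prems]]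
  show ?case
  proof
    assume a: "\<forall>p\<in>set (bw @ [p]). fst p \<le> \<phi> (snd p)"
    have "l \<le> \<phi> r" using a q lmin[OF q(1)] by fastforce
    then show "flagged_tableau \<phi> (rec_tab (bw @ [p]))" using split IH a by simp
  next
    assume a: "flagged_tableau \<phi> (rec_tab (bw @ [p]))"
    then have "j \<le> \<phi> (Min (set w))" using j unfolding flagged_tableau_def by fastforce
    also have "\<dots> \<le> \<phi> x" using mono m1 by simp
    finally have "l \<le> \<phi> x" using lj by simp
    then show "\<forall>p\<in>set (bw @ [p]). fst p \<le> \<phi> (snd p)" using a split IH p by auto
  qed
qed

subsection \<open>Weak descent tableaux and Yamanouchi words\<close>

text \<open>\<open>x\<close> is the preceding letter and \<open>p\<close> its row; a new row begins
  when the next letter does not exceed \<open>x\<close>.\<close>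

fun labels_from :: "int \<Rightarrow> nat \<Rightarrow> nat list \<Rightarrow> int list" where
  "labels_from p x [] = []"
| "labels_from p x (y # ys) =
     (let q = (if x < y then p else min (int y) (p - 1)) in q # labels_from q y ys)"

text \<open>The row of each letter in the weak descent tableau.\<close>

fun labels :: "nat list \<Rightarrow> int list" where
  "labels [] = []"
| "labels (x # xs) = int x # labels_from (int x) x xs"

definition placed_labels :: "(int \<times> nat list) list \<Rightarrow> int list" where
  "placed_labels ps = concat (map (\<lambda>(r, s). replicate (length s) r) ps)"

lemma placed_labels_simps [simp]:
  "placed_labels [] = []" "placed_labels ((r, s) # ps) = replicate (length s) r @ placed_labels ps"
  by (simp_all add: placed_labels_def)

lemma runs_ConsE: obtains s rs where "runs (x # xs) = (x # s) # rs"
proof (cases "runs xs")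
  case Nil
  then show ?thesis using that[of "[]" "[]"] by simp
next
  case (Cons r rs)
  then show ?thesis using that[of r rs] that[of "[]" "r # rs"] by (cases "x < hd r") auto
qed

lemma concat_runs: "concat (runs \<tau>) = \<tau>"
  by (induction \<tau>) (auto split: list.splits)

lemma runs_nonempty: "s \<in> set (runs \<tau>) \<Longrightarrow> s \<noteq> []"
  by (induction \<tau> arbitrary: s) (auto split: list.splits if_splits)

lemma labels_place_below:
  "runs (x # xs) = (x # s) # rs \<Longrightarrow>
   placed_labels ((q, x # s) # place_below q rs) = q # labels_from q x xs"
proof (induction xs arbitrary: x s rs q)
  case (Cons y ys)
  obtain s' rs' where y: "runs (y # ys) = (y # s') # rs'" by (rule runs_ConsE)
  show ?case
  proof (cases "x < y")
    case True
    then have "s = y # s'" "rs = rs'" using Cons.prems y by auto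
    then show ?thesis using Cons.IH[OF y, of q] True by (simp add: Let_def)
  next
    case False
    then have e: "s = []" "rs = (y # s') # rs'" using Cons.prems y by auto
    define r where "r = min (int y) (q - 1)"
    have "place_below q rs = (r, y # s') # place_below r rs'" by (simp add: e r_def Let_def min_def)
    then show ?thesis using Cons.IH[OF y, of r] False e by (simp add: Let_def r_def)
  qed
qed simp

lemma labels_place_runs: "placed_labels (place_runs (runs \<tau>)) = labels \<tau>"
proof (cases \<tau>)
  case (Cons x xs)
  obtain s rs where "runs (x # xs) = (x # s) # rs" by (rule runs_ConsE)
  then show ?thesis using labels_place_below[of x xs s rs "int x"] Cons by (simp del: runs.simps)
qed simp

lemma place_below_rows: "sorted_wrt (>) (p # map fst (place_below p ss))"
proof (induction ss arbitrary: p)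
  case (Cons s ss)
  define r where "r = (if int (hd s) < p then int (hd s) else p - 1)"
  have "r < p" by (simp add: r_def)
  then show ?case using Cons[of r] by (auto simp: Let_def r_def[symmetric])
qed simp

lemma map_snd_place_below: "map snd (place_below p ss) = ss"
  by (induction ss arbitrary: p) (simp_all add: Let_def)

lemma place_runs_rows: "sorted_wrt (>) (map fst (place_runs ss))"
  by (cases ss) (use place_below_rows in auto)

lemma map_snd_place_runs: "map snd (place_runs ss) = ss"
  by (cases ss) (simp_all add: map_snd_place_below)

lemma distinct_decreasing: "sorted_wrt (>) xs \<Longrightarrow> distinct xs" for xs :: "int list"
  by (induction xs) auto

lemma distinct_place_runs: "distinct (map fst (place_runs ss))"
  by (rule distinct_decreasing[OF place_runs_rows])

lemma count_list_replicate: "count_list (replicate n x) y = (if x = y then n else 0)"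
  by (induction n) auto

lemma count_placed_labels:
  "distinct (map fst ps) \<Longrightarrow>
   count_list (placed_labels ps) r = (case map_of ps r of None \<Rightarrow> 0 | Some s \<Rightarrow> length s)"
proof (induction ps)
  case (Cons p ps)
  obtain r' s where p: "p = (r', s)" by force
  have "r \<notin> set (map fst ps) \<Longrightarrow> map_of ps r = None" by (simp add: map_of_eq_None_iff)
  then show ?case using Cons by (auto simp: p count_list_replicate split: option.splits)
qed simp

lemma count_labels:
  "count_list (labels \<tau>) r = (case map_of (place_runs (runs \<tau>)) r of None \<Rightarrow> 0 | Some s \<Rightarrow> length s)"
  using count_placed_labels[OF distinct_place_runs] labels_place_runs by metis

lemma dom_WeakDesTab: "(r, c) \<in> dom (WeakDesTab \<tau>) \<longleftrightarrow> 1 \<le> c \<and> c \<le> count_list (labels \<tau>) r"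
  by (auto simp: WeakDesTab_def count_labels split: option.splits if_splits)

lemma virtual_iff: "virtual \<tau> \<longleftrightarrow> (\<exists>l\<in>set (labels \<tau>). l \<le> 0)"
proof -
  have pos: "0 < count_list (labels \<tau>) r \<longleftrightarrow> r \<in> set (labels \<tau>)" for r
    by (metis count_list_0_iff neq0_conv)
  have "(\<exists>c. (r, c) \<in> dom (WeakDesTab \<tau>)) \<longleftrightarrow> r \<in> set (labels \<tau>)" for r
    unfolding dom_WeakDesTab pos[symmetric] by (metis Suc_leI One_nat_def le_trans nat_less_le zero_less_one le_refl less_le_trans)
  moreover have "virtual \<tau> \<longleftrightarrow> (\<exists>r c. (r, c) \<in> dom (WeakDesTab \<tau>) \<and> \<not> 0 < r)"
    unfolding virtual_def positive_rows_def by blast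
  ultimately show ?thesis by (metis not_less)
qed

lemma des_eq: "des \<tau> i = count_list (labels \<tau>) (int i)"
proof -
  have "{c. (int i, c) \<in> dom (WeakDesTab \<tau>)} = {1..count_list (labels \<tau>) (int i)}"
    using dom_WeakDesTab by auto
  then show ?thesis by (simp add: des_def shape_def)
qed

lemma dom_WeakDesTab_diag:
  assumes "\<not> virtual \<tau>"
  shows "dom (WeakDesTab \<tau>) = diag (des \<tau>)"
proof (rule set_eqI)
  fix b :: "int \<times> nat"
  obtain i c where b: "b = (i, c)" by force
  show "b \<in> dom (WeakDesTab \<tau>) \<longleftrightarrow> b \<in> diag (des \<tau>)"
  proof (cases "0 \<le> i")
    case True
    then show ?thesis unfolding b dom_WeakDesTab in_diag_iff des_eq by simp
  next
    case False
    then have "count_list (labels \<tau>) i = 0" using assms unfolding virtual_iff by (force simp: count_list_0_iff)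
    then show ?thesis using False unfolding b dom_WeakDesTab in_diag_iff by simp
  qed
qed

lemma sorted_map_unique:
  fixes ps ps' :: "(int \<times> 'a) list"
  assumes "sorted_wrt (>) (map fst ps)" "sorted_wrt (>) (map fst ps')" "map_of ps = map_of ps'"
  shows "ps = ps'"
proof -
  have dis: "distinct (map fst qs)" if "sorted_wrt (>) (map fst qs)" for qs :: "(int \<times> 'a) list"
    by (rule distinct_decreasing[OF that])
  have srt: "sorted (rev (map fst qs))" if "sorted_wrt (>) (map fst qs)" for qs :: "(int \<times> 'a) list"
    unfolding sorted_wrt_rev using that by (rule sorted_wrt_mono_rel[rotated]) simp
  have "rev (map fst ps) = rev (map fst ps')"
  proof (rule sorted_distinct_set_unique)
    show "set (rev (map fst ps)) = set (rev (map fst ps'))"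
      using assms(3) dom_map_of_conv_image_fst[of ps] dom_map_of_conv_image_fst[of ps'] by simp
  qed (use srt dis assms in auto)
  then have keys: "map fst ps = map fst ps'" by simp
  have rebuild: "map (\<lambda>k. (k, the (map_of qs k))) (map fst qs) = qs" if "distinct (map fst qs)" for qs :: "(int \<times> 'a) list"
    using that by (auto intro!: map_idI)
  show ?thesis using rebuild[OF dis[OF assms(1)]] rebuild[OF dis[OF assms(2)]] keys assms(3) by metis
qed

text \<open>The runs occupy strictly decreasing rows, so reading the rows in this order returns the
  runs in their original order.\<close>

lemma WeakDesTab_inj:
  assumes "WeakDesTab \<tau> = WeakDesTab \<tau>'"
  shows "\<tau> = \<tau>'"
proof -
  \<comment> \<open>This depends on the tableau only, so it serves both words.\<close>
  define row where "row r = map (\<lambda>c. the (WeakDesTab \<tau> (r, c))) [1..<Suc (card {c. (r, c) \<in> dom (WeakDesTab \<tau>)})]" for r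
  have "map_of (place_runs (runs \<upsilon>)) r = (if row r = [] then None else Some (row r))"
    if "WeakDesTab \<upsilon> = WeakDesTab \<tau>" for \<upsilon> r
  proof -
    have c: "card {c. (r, c) \<in> dom (WeakDesTab \<tau>)} = count_list (labels \<upsilon>) r"
    proof -
      have "{c. (r, c) \<in> dom (WeakDesTab \<tau>)} = {1..count_list (labels \<upsilon>) r}"
        unfolding that[symmetric] dom_WeakDesTab by auto
      then show ?thesis by simp
    qed
    show ?thesis
    proof (cases "map_of (place_runs (runs \<upsilon>)) r")
      case None
      then show ?thesis by (simp add: row_def c count_labels)
    next
      case (Some s)
      then have "s \<in> set (map snd (place_runs (runs \<upsilon>)))" by (force dest: map_of_SomeD)
      then have ne: "s \<noteq> []" using runs_nonempty by (simp add: map_snd_place_runs)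
      have n: "count_list (labels \<upsilon>) r = length s" by (simp add: count_labels Some)
      have "row r = s"
      proof (rule nth_equalityI)
        show "length (row r) = length s" by (simp add: row_def c n del: upt_Suc)
        fix j assume "j < length (row r)"
        then have j: "j < length s" by (simp add: row_def c n del: upt_Suc)
        have "row r ! j = the (WeakDesTab \<upsilon> (r, Suc j))"
          using j by (simp add: row_def c n that del: upt_Suc)
        then show "row r ! j = s ! j" using j by (simp add: WeakDesTab_def Some)
      qed
      then show ?thesis using Some ne by simp
    qed
  qed
  then have "map_of (place_runs (runs \<tau>)) = map_of (place_runs (runs \<tau>'))" using assms by auto
  then have "place_runs (runs \<tau>) = place_runs (runs \<tau>')" by (rule sorted_map_unique[OF place_runs_rows place_runs_rows])
  then show ?thesis using map_snd_place_runs concat_runs by metis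
qed

section \<open>Weak descent rows as the largest labelling\<close>

lemma labels_from_greedy:
  "sorted_wrt bw_rel ((i, x) # bw) \<Longrightarrow> int i \<le> p \<Longrightarrow> \<forall>q\<in>set bw. fst q \<le> snd q \<Longrightarrow>
   list_all2 (\<lambda>q l. int (fst q) \<le> l) bw (labels_from p x (map snd bw))"
proof (induction bw arbitrary: i x p)
  case (Cons q bw)
  obtain j y where q: "q = (j, y)" by force
  define r where "r = (if x < y then p else min (int y) (p - 1))"
  have "j < i \<or> j = i \<and> x < y" using Cons.prems(1) by (simp add: q bw_rel_def)
  then have "int j \<le> r" using Cons.prems(2,3) by (auto simp: r_def q)
  moreover from this have "list_all2 (\<lambda>q l. int (fst q) \<le> l) bw (labels_from r y (map snd bw))"
    using Cons.prems by (intro Cons.IH[of j y]) (auto simp: q)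
  ultimately show ?case by (simp add: q Let_def r_def[symmetric])
qed simp

text \<open>A label never exceeds its letter and drops by at least one at each descent. The weak
  descent rows take the minimum of the two bounds, so they are at least as large as any labelling
  flagged by the identity.\<close>

lemma labels_greedy:
  assumes "sorted_wrt bw_rel bw" "\<forall>q\<in>set bw. fst q \<le> snd q"
  shows "list_all2 (\<lambda>q l. int (fst q) \<le> l) bw (labels (map snd bw))"
proof (cases bw)
  case (Cons q bw')
  obtain i x where q: "q = (i, x)" by force
  show ?thesis using labels_from_greedy[of i x bw' "int x"] assms by (simp add: Cons q)
qed simp

lemma length_labels_from [simp]: "length (labels_from p x ys) = length ys"
  by (induction ys arbitrary: p x) (simp_all add: Let_def)

lemma length_labels [simp]: "length (labels \<tau>) = length \<tau>"
  by (cases \<tau>) auto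

text \<open>The word labelled by its weak descent rows, which are positive for a non-virtual word,
  so that \<open>nat\<close> loses nothing.\<close>

definition own :: "nat list \<Rightarrow> (nat \<times> nat) list" where
  "own \<tau> = zip (map nat (labels \<tau>)) \<tau>"

lemma own_from:
  "0 < p \<Longrightarrow> \<forall>l\<in>set (labels_from p x ys). 0 < l \<Longrightarrow> p \<le> int x \<Longrightarrow>
   sorted_wrt bw_rel ((nat p, x) # zip (map nat (labels_from p x ys)) ys) \<and>
   (\<forall>q\<in>set (zip (map nat (labels_from p x ys)) ys). fst q \<le> snd q)"
proof (induction ys arbitrary: p x)
  case (Cons y ys)
  define r where "r = (if x < y then p else min (int y) (p - 1))"
  have l: "labels_from p x (y # ys) = r # labels_from r y ys" by (simp add: Let_def r_def)
  have r: "0 < r" "\<forall>l\<in>set (labels_from r y ys). 0 < l" using Cons.prems(2) l by auto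
  have ry: "r \<le> int y" using Cons.prems(3) by (auto simp: r_def)
  have rel: "bw_rel (nat p, x) (nat r, y)" using Cons.prems(1) r(1) by (auto simp: bw_rel_def r_def min_def)
  note IH = Cons.IH[OF r ry]
  have tr: "transp bw_rel" by (auto simp: transp_def intro: bw_rel_trans)
  have "nat r \<le> y" using ry by simp
  then show ?case using IH rel by (simp add: l sorted_wrt2[OF tr] del: labels_from.simps sorted_wrt.simps)
qed simp

lemma own:
  assumes "reduced \<tau>" "\<not> virtual \<tau>"
  shows "biword (own \<tau>)" "map snd (own \<tau>) = \<tau>" "map fst (own \<tau>) = map nat (labels \<tau>)"
    "\<forall>q\<in>set (own \<tau>). fst q \<le> snd q"
proof -
  have pos: "\<forall>l\<in>set (labels \<tau>). 0 < l" using assms(2) by (auto simp: virtual_iff not_le)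
  show s: "map snd (own \<tau>) = \<tau>" "map fst (own \<tau>) = map nat (labels \<tau>)" by (simp_all add: own_def)
  have "sorted_wrt bw_rel (own \<tau>) \<and> (\<forall>q\<in>set (own \<tau>). fst q \<le> snd q)"
  proof (cases \<tau>)
    case (Cons x xs)
    then show ?thesis using own_from[of "int x" x xs] pos by (simp add: own_def)
  qed (simp add: own_def)
  moreover have "1 \<le> fst q" if "q \<in> set (own \<tau>)" for q
  proof -
    have "fst q \<in> set (map nat (labels \<tau>))" using that s(2) by (metis image_eqI set_map)
    then show ?thesis using pos by auto
  qed
  ultimately show "biword (own \<tau>)" "\<forall>q\<in>set (own \<tau>). fst q \<le> snd q"
    using assms(1) s(1) by (auto simp: biword_def)
qed

section \<open>Dominance bounds by counting small labels\<close>

lemma sum_count_list: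
  "\<forall>l\<in>set ls. 1 \<le> l \<Longrightarrow> (\<Sum>i=1..k. count_list ls i) = length (filter (\<lambda>l. l \<le> k) ls)" for k :: nat
proof (induction ls)
  case (Cons a ls)
  have "count_list (a # ls) i = count_list ls i + (if a = i then 1 else 0)" for i by simp
  then have "(\<Sum>i=1..k. count_list (a # ls) i) = (\<Sum>i=1..k. count_list ls i) + (\<Sum>i=1..k. if a = i then 1 else 0)"
    by (simp only: sum.distrib)
  also have "(\<Sum>i=1..k. if a = i then 1 else 0) = (if a \<le> k then 1 else 0)" using Cons.prems by simp
  finally show ?case using Cons by simp
qed simp

lemma count_list_map_nat:
  "\<forall>l\<in>set ls. 0 < l \<Longrightarrow> count_list (map nat ls) i = count_list ls (int i)"
  by (induction ls) auto

lemma des_own: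
  assumes "\<not> virtual \<tau>"
  shows "des \<tau> i = count_list (map nat (labels \<tau>)) i"
  using assms count_list_map_nat[of "labels \<tau>" i] by (auto simp: virtual_iff not_le des_eq)

lemma sum_des:
  assumes "\<not> virtual \<tau>"
  shows "(\<Sum>i=1..k. des \<tau> i) = length (filter (\<lambda>l. l \<le> int k) (labels \<tau>))"
proof -
  have pos: "\<forall>l\<in>set (labels \<tau>). 0 < l" using assms by (auto simp: virtual_iff not_le)
  have "(\<Sum>i=1..k. des \<tau> i) = length (filter (\<lambda>l. l \<le> k) (map nat (labels \<tau>)))"
    using sum_count_list[of "map nat (labels \<tau>)" k] pos by (simp add: des_own[OF assms] Suc_le_eq)
  also have "\<dots> = length (filter (\<lambda>l. l \<le> int k) (labels \<tau>))"
    using pos by (induction "labels \<tau>") (auto simp: filter_map comp_def nat_le_iff)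
  finally show ?thesis .
qed

lemma card_rec_tab_le:
  assumes "biword bw"
  shows "finite {b. \<exists>j\<le>k. rec_tab bw b = Some j} \<and>
    card {b. \<exists>j\<le>k. rec_tab bw b = Some j} = length (filter (\<lambda>p. fst p \<le> k) bw)"
  using assms
proof (induction bw rule: rev_induct)
  case (snoc p bw)
  obtain i x where p: "p = (i, x)" by force
  define b where "b = box (map snd bw) x"
  have fresh: "rec_tab bw b = None" using box_fresh[of bw x] snoc.prems by (simp add: b_def p biword_def)
  have T: "rec_tab (bw @ [p]) = (rec_tab bw)(b \<mapsto> i)" unfolding p rec_tab_snoc b_def ..
  have "{c. \<exists>j\<le>k. rec_tab (bw @ [p]) c = Some j} =
    (if i \<le> k then insert b {b. \<exists>j\<le>k. rec_tab bw b = Some j} else {b. \<exists>j\<le>k. rec_tab bw b = Some j})"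
    unfolding T using fresh by auto
  moreover have "b \<notin> {b. \<exists>j\<le>k. rec_tab bw b = Some j}" using fresh by simp
  ultimately show ?case using snoc.IH[OF biword_snocD[OF snoc.prems]] by (simp add: p)
qed simp

lemma sum_alpha_card:
  assumes "a 0 = 0"
  shows "(\<Sum>i=1..k. a i) = card {b \<in> diag a. fst b \<le> int k}"
proof -
  have "{b \<in> diag a. fst b \<le> int k} = (\<lambda>(r, c). (int r, c)) ` (SIGMA r:{1..k}. {1..a r})"
  proof (rule set_eqI)
    fix b :: "int \<times> nat"
    show "b \<in> {b \<in> diag a. fst b \<le> int k} \<longleftrightarrow> b \<in> (\<lambda>(r, c). (int r, c)) ` (SIGMA r:{1..k}. {1..a r})"
    proof
      assume "b \<in> {b \<in> diag a. fst b \<le> int k}"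
      then obtain r c where rc: "b = (int r, c)" "1 \<le> c" "c \<le> a r" "r \<le> k" by (auto simp: diag_def)
      then have "r \<noteq> 0" using assms by (metis le_zero_eq not_one_le_zero)
      then show "b \<in> (\<lambda>(r, c). (int r, c)) ` (SIGMA r:{1..k}. {1..a r})"
        using rc by (intro image_eqI[of _ _ "(r, c)"]) auto
    qed (auto simp: diag_def)
  qed
  moreover have "inj_on (\<lambda>(r, c). (int r, c)) (SIGMA r:{1..k}. {1..a r})" by (auto simp: inj_on_def)
  ultimately show ?thesis by (simp add: card_image)
qed

lemma flag_id: "flag id"
  by (simp add: flag_def mono_on_def)

text \<open>Under the identity flag an entry is at most its row index, so the rows up to
  \<open>k\<close> contain only entries up to \<open>k\<close>. Counting boxes turns this inclusion
  into the dominance bound.\<close>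

lemma id_flagged_rows:
  assumes "biword bw" "\<forall>q\<in>set bw. fst q \<le> snd q"
  shows "{b \<in> diag (alpha (map snd bw)). fst b \<le> int k} \<subseteq> {b. \<exists>j\<le>k. rec_tab bw b = Some j}"
proof
  have fl: "flagged_tableau id (rec_tab bw)" using flagged_rec_tab_iff[OF flag_id assms(1)] assms(2) by simp
  fix b assume bk: "b \<in> {b \<in> diag (alpha (map snd bw)). fst b \<le> int k}"
  obtain i c where ic: "b = (i, c)" by force
  have "b \<in> dom (rec_tab bw)" using dom_rec_tab[of bw] assms(1) bk by (simp add: biword_def)
  then obtain j where b: "b = (i, c)" "rec_tab bw (i, c) = Some j" "i \<le> int k" using bk ic by auto
  then have "j \<le> nat i" using fl unfolding flagged_tableau_def by (metis id_apply)
  then show "b \<in> {b. \<exists>j\<le>k. rec_tab bw b = Some j}" using b by auto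
qed

lemma sum_alpha_le:
  assumes "biword bw" "\<forall>q\<in>set bw. fst q \<le> snd q"
  shows "(\<Sum>i=1..k. alpha (map snd bw) i) \<le> length (filter (\<lambda>p. fst p \<le> k) bw)"
proof -
  have "reduced (map snd bw)" using assms(1) by (simp add: biword_def)
  then show ?thesis
    using sum_alpha_card[of "alpha (map snd bw)" k] alpha_0 card_rec_tab_le[OF assms(1), of k]
      card_mono[OF _ id_flagged_rows[OF assms, of k]] by simp
qed

text \<open>Equal counts turn the inclusions of \<open>id_flagged_rows\<close> into equalities. Used
  at \<open>k\<close> equal to an entry and at \<open>k\<close> equal to its row index, they force
  the two to agree.\<close>

lemma extremal_rec_tab:
  assumes "biword bw" "\<forall>q\<in>set bw. fst q \<le> snd q"
    and "\<And>k. length (filter (\<lambda>p. fst p \<le> k) bw) = (\<Sum>i=1..k. alpha (map snd bw) i)"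
  shows "rec_tab bw = (\<lambda>b. if b \<in> diag (alpha (map snd bw)) then Some (nat (fst b)) else None)"
proof
  fix b :: "int \<times> nat"
  have red: "reduced (map snd bw)" using assms(1) by (simp add: biword_def)
  have d: "dom (rec_tab bw) = diag (alpha (map snd bw))" by (rule dom_rec_tab[OF red])
  have eq: "{b \<in> diag (alpha (map snd bw)). fst b \<le> int k} = {b. \<exists>j\<le>k. rec_tab bw b = Some j}" for k
    using card_subset_eq[OF _ id_flagged_rows[OF assms(1,2), of k]] card_rec_tab_le[OF assms(1), of k]
      sum_alpha_card[of "alpha (map snd bw)" k] alpha_0[OF red] assms(3)[of k] by simp
  show "rec_tab bw b = (if b \<in> diag (alpha (map snd bw)) then Some (nat (fst b)) else None)"
  proof (cases "b \<in> diag (alpha (map snd bw))")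
    case True
    then obtain j where j: "rec_tab bw b = Some j" using d by blast
    have f: "0 \<le> fst b" using True by (auto simp: diag_def)
    have "b \<in> {b. \<exists>j'\<le>j. rec_tab bw b = Some j'}" using j by blast
    then have "fst b \<le> int j" unfolding eq[symmetric] by simp
    moreover have "b \<in> {x. \<exists>j\<le>nat (fst b). rec_tab bw x = Some j}"
      unfolding eq[symmetric] using True f by simp
    then have "j \<le> nat (fst b)" using j by auto
    ultimately show ?thesis using True j f by simp
  next
    case False
    then show ?thesis using d by auto
  qed
qed

lemma alpha_le_des:
  assumes "reduced \<tau>" "\<not> virtual \<tau>"
  shows "dominance_le (alpha \<tau>) (des \<tau>)"
  unfolding dominance_le_def
proof
  fix k
  note o = own[OF assms]
  have "(\<Sum>i=1..k. alpha \<tau> i) \<le> length (filter (\<lambda>p. fst p \<le> k) (own \<tau>))"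
    using sum_alpha_le[OF o(1,4), of k] o(2) by simp
  also have "\<dots> = length (filter (\<lambda>l. l \<le> k) (map fst (own \<tau>)))" by (simp add: filter_map comp_def)
  also have "\<dots> = (\<Sum>i=1..k. count_list (map fst (own \<tau>)) i)"
    using o(1) by (intro sum_count_list[symmetric]) (auto simp: biword_def)
  also have "\<dots> = (\<Sum>i=1..k. des \<tau> i)" by (simp add: des_own[OF assms(2)] o(3))
  finally show "(\<Sum>i=1..k. alpha \<tau> i) \<le> (\<Sum>i=1..k. des \<tau> i)" .
qed

lemma own_extremal:
  assumes "reduced \<tau>" "\<not> virtual \<tau>" "des \<tau> = alpha \<tau>"
  shows "rec_tab (own \<tau>) = (\<lambda>b. if b \<in> diag (alpha \<tau>) then Some (nat (fst b)) else None)"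
proof -
  note o = own[OF assms(1,2)]
  have "length (filter (\<lambda>p. fst p \<le> k) (own \<tau>)) = (\<Sum>i=1..k. alpha (map snd (own \<tau>)) i)" for k
  proof -
    have "length (filter (\<lambda>p. fst p \<le> k) (own \<tau>)) = length (filter (\<lambda>l. l \<le> k) (map fst (own \<tau>)))"
      by (simp add: filter_map comp_def)
    also have "\<dots> = (\<Sum>i=1..k. count_list (map fst (own \<tau>)) i)"
      using o(1) by (intro sum_count_list[symmetric]) (auto simp: biword_def)
    also have "\<dots> = (\<Sum>i=1..k. alpha \<tau> i)" by (simp add: des_own[OF assms(2), symmetric] o(3) assms(3))
    finally show ?thesis by (simp add: o(2))
  qed
  from extremal_rec_tab[OF o(1,4) this] show ?thesis by (simp add: o(2))
qed

lemma des_alpha_unique: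
  assumes "reduced \<tau>" "\<not> virtual \<tau>" "des \<tau> = alpha \<tau>" "reduced \<tau>'" "\<not> virtual \<tau>'" "des \<tau>' = alpha \<tau>'" "\<tau> \<sim>\<^sub>C\<^sub>K \<tau>'"
  shows "\<tau> = \<tau>'"
proof -
  note o = own[OF assms(1,2)] and o' = own[OF assms(4,5)]
  have "rec_tab (own \<tau>) = rec_tab (own \<tau>')"
    using own_extremal[OF assms(1-3)] own_extremal[OF assms(4-6)] alpha_ck[OF assms(1,7)] by simp
  moreover have "map snd (own \<tau>) \<sim>\<^sub>C\<^sub>K map snd (own \<tau>')" unfolding o(2) o'(2) by (rule assms(7))
  ultimately have "own \<tau> = own \<tau>'" using biword_unique[OF o(1) o'(1)] by blast
  then show ?thesis using o(2) o'(2) by metis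
qed

section \<open>Yamanouchi words attain the lower bound\<close>

lemma dominance_antisym:
  assumes "dominance_le a b" "dominance_le b a" "a 0 = b 0"
  shows "a = b"
proof
  fix k
  have eq: "(\<Sum>i=1..k. a i) = (\<Sum>i=1..k. b i)" for k
    using assms(1,2) by (simp add: dominance_le_def le_antisym)
  show "a k = b k"
  proof (cases k)
    case 0
    then show ?thesis using assms(3) by simp
  next
    case (Suc j)
    then show ?thesis using eq[of j] eq[of k] by simp
  qed
qed

lemma des_0: "\<not> virtual \<tau> \<Longrightarrow> des \<tau> 0 = 0"
  by (auto simp: des_eq virtual_iff count_list_0_iff)

text \<open>The tableau with entry \<open>r\<close> throughout row \<open>r\<close> is the extremal
  one; inverting the recording map on it produces the Yamanouchi word.\<close>

lemma superkey:
  assumes "a 0 = 0" "finite {r. a r \<noteq> 0}"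
  defines "T \<equiv> (\<lambda>b. if b \<in> diag a then Some (nat (fst b)) else None)"
  shows "key_tableau T" "dom T = diag a" "flagged_tableau id T"
proof -
  show d: "dom T = diag a" by (auto simp: T_def split: if_splits)
  have T: "T b = Some j \<longleftrightarrow> b \<in> diag a \<and> j = nat (fst b)" for b j by (auto simp: T_def)
  have pos: "0 < i" if "(i, c) \<in> diag a" for i c
    using that assms(1) by (cases "i = 0") (auto simp: in_diag_iff)
  have "is_tableau T"
  proof (rule is_tableau_diagI[OF d assms(2)])
    fix x assume "x \<in> ran T"
    then obtain i c where "T (i, c) = Some x" by (auto simp: ran_def)
    then show "1 \<le> x" using pos[of i c] by (auto simp: T)
  qed
  moreover have "x \<noteq> y" if "r \<noteq> r'" "T (r, c) = Some x" "T (r', c) = Some y" for r r' c x y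
    using that pos[of r c] pos[of r' c] by (auto simp: T)
  moreover have "\<not> x > y" if "i < k" "T (i, j) = Some x" "T (k, j) = Some y" for i k j x y
    using that pos[of i j] pos[of k j] by (auto simp: T)
  moreover have "y \<le> x" if "T (r, c) = Some x" "T (r, c') = Some y" for r c c' x y
    using that by (simp add: T)
  ultimately show "key_tableau T" unfolding key_tableau_def by blast
  show "flagged_tableau id T" unfolding flagged_tableau_def by (simp add: T)
qed

text \<open>The labels recorded by constant rows are positive and bounded by the weak descent rows
  of the resulting word. So the word is non-virtual and \<open>des \<tau>\<close> is dominated by
  \<open>alpha \<tau>\<close>; the opposite bound is \<open>alpha_le_des\<close>.\<close>

lemma Yamanouchi_exists:
  assumes "reduced \<rho>"
  obtains \<tau> where "\<tau> \<sim>\<^sub>C\<^sub>K \<rho>" "\<not> virtual \<tau>" "des \<tau> = alpha \<rho>"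
proof -
  define T :: tableau where "T = (\<lambda>b. if b \<in> diag (alpha \<rho>) then Some (nat (fst b)) else None)"
  note T = superkey[OF alpha_0[OF assms] finite_alpha[OF assms], folded T_def]
  obtain bw where bw: "biword bw" "map snd bw \<sim>\<^sub>C\<^sub>K \<rho>" "rec_tab bw = T"
    using biword_exists[OF assms T(1,2)] by blast
  have fl: "\<forall>q\<in>set bw. fst q \<le> snd q" using flagged_rec_tab_iff[OF flag_id bw(1)] T(3) bw(3) by simp
  define \<tau> where "\<tau> = map snd bw"
  have red: "reduced \<tau>" using bw(1) by (simp add: \<tau>_def biword_def)
  have srt: "sorted_wrt bw_rel bw" "\<And>q. q \<in> set bw \<Longrightarrow> 1 \<le> fst q" using bw(1) by (auto simp: biword_def)
  have l: "list_all2 (\<lambda>q l. int (fst q) \<le> l) bw (labels \<tau>)"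
    unfolding \<tau>_def by (rule labels_greedy[OF srt(1) fl])
  have nv: "\<not> virtual \<tau>"
  proof -
    have "0 < l" if mem: "l \<in> set (labels \<tau>)" for l
    proof -
      obtain n where n: "n < length (labels \<tau>)" "l = labels \<tau> ! n" using mem by (metis in_set_conv_nth)
      then have "int (fst (bw ! n)) \<le> l" "n < length bw" using l by (auto simp: list_all2_conv_all_nth)
      then show ?thesis using srt(2)[of "bw ! n"] by simp
    qed
    then show ?thesis by (force simp: virtual_iff)
  qed
  have a: "alpha \<tau> = alpha \<rho>" using alpha_ck[OF red] bw(2) by (simp add: \<tau>_def)
  have "dominance_le (des \<tau>) (alpha \<tau>)" unfolding dominance_le_def
  proof
    fix k
    have "length (filter (\<lambda>l. l \<le> int k) (labels \<tau>)) \<le> length (filter (\<lambda>p. fst p \<le> k) bw)"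
      using l by (induction rule: list_all2_induct) auto
    also have "\<dots> = card {b. \<exists>j\<le>k. T b = Some j}" using card_rec_tab_le[OF bw(1), of k] bw(3) by simp
    also have "{b. \<exists>j\<le>k. T b = Some j} = {b \<in> diag (alpha \<rho>). fst b \<le> int k}"
      by (auto simp: T_def nat_le_iff split: if_splits)
    also have "card \<dots> = (\<Sum>i=1..k. alpha \<tau> i)" using sum_alpha_card[of "alpha \<rho>" k] alpha_0[OF assms] a by simp
    finally show "(\<Sum>i=1..k. des \<tau> i) \<le> (\<Sum>i=1..k. alpha \<tau> i)" using sum_des[OF nv, of k] by simp
  qed
  then have "des \<tau> = alpha \<tau>"
    using dominance_antisym alpha_le_des[OF red nv] des_0[OF nv] alpha_0[OF red] by metis
  then show ?thesis using that[of \<tau>] bw(2) nv a by (simp add: \<tau>_def)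
qed

text \<open>On a class, \<open>alpha\<close> is a lower bound for \<open>des\<close> that is
  attained, so being minimal means attaining it.\<close>

lemma Yamanouchi_iff:
  assumes "reduced \<tau>" "\<not> virtual \<tau>"
  shows "Yamanouchi \<tau> \<longleftrightarrow> des \<tau> = alpha \<tau>"
proof
  assume Y: "Yamanouchi \<tau>"
  obtain \<sigma> where \<sigma>: "\<sigma> \<sim>\<^sub>C\<^sub>K \<tau>" "\<not> virtual \<sigma>" "des \<sigma> = alpha \<tau>" using Yamanouchi_exists[OF assms(1)] .
  have "reduced \<sigma>" using reduced_ck[OF ck_sym[OF \<sigma>(1)] assms(1)] .
  moreover have "word_le \<sigma> \<tau>" using \<sigma> alpha_le_des[OF assms] by (simp add: word_le_def)
  ultimately have "\<sigma> = \<tau>" using Y \<sigma>(2) unfolding Yamanouchi_def by blast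
  then show "des \<tau> = alpha \<tau>" using \<sigma>(3) by simp
next
  assume d: "des \<tau> = alpha \<tau>"
  show "Yamanouchi \<tau>" unfolding Yamanouchi_def
  proof (intro conjI assms allI impI)
    fix \<sigma> assume \<sigma>: "reduced \<sigma>" "\<not> virtual \<sigma>" "word_le \<sigma> \<tau>"
    then have ck: "\<sigma> \<sim>\<^sub>C\<^sub>K \<tau>" and le: "dominance_le (des \<sigma>) (alpha \<sigma>)"
      using d alpha_ck[OF \<sigma>(1), of \<tau>] by (auto simp: word_le_def)
    have "des \<sigma> = alpha \<sigma>"
      using dominance_antisym[OF le alpha_le_des[OF \<sigma>(1,2)]] des_0[OF \<sigma>(2)] alpha_0[OF \<sigma>(1)] by simp
    then show "\<sigma> = \<tau>" using des_alpha_unique[OF \<sigma>(1,2) _ assms d ck] by simp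
  qed
qed

lemma hat_word:
  assumes "reduced \<rho>"
  shows "Yamanouchi (hat_word \<rho>)" "hat_word \<rho> \<sim>\<^sub>C\<^sub>K \<rho>"
    "Yamanouchi \<sigma> \<Longrightarrow> \<sigma> \<sim>\<^sub>C\<^sub>K \<rho> \<Longrightarrow> hat_word \<rho> = \<sigma>"
proof -
  obtain \<tau> where \<tau>: "\<tau> \<sim>\<^sub>C\<^sub>K \<rho>" "\<not> virtual \<tau>" "des \<tau> = alpha \<rho>" using Yamanouchi_exists[OF assms] .
  have red: "reduced \<tau>" using reduced_ck[OF ck_sym[OF \<tau>(1)] assms] .
  have d: "des \<tau> = alpha \<tau>" using alpha_ck[OF red \<tau>(1)] \<tau>(3) by simp
  have Y: "Yamanouchi \<tau>" using Yamanouchi_iff[OF red \<tau>(2)] d by simp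
  have uniq: "\<sigma> = \<tau>" if "Yamanouchi \<sigma>" "\<sigma> \<sim>\<^sub>C\<^sub>K \<rho>" for \<sigma>
  proof -
    have r: "reduced \<sigma>" "\<not> virtual \<sigma>" using that(1) by (auto simp: Yamanouchi_def)
    show ?thesis
      using des_alpha_unique[OF r _ red \<tau>(2) d ck_trans[OF that(2) ck_sym[OF \<tau>(1)]]]
        Yamanouchi_iff[OF r] that(1) by simp
  qed
  have h: "hat_word \<rho> = \<tau>" unfolding hat_word_def by (rule the_equality) (use Y \<tau>(1) uniq in blast)+
  show "Yamanouchi (hat_word \<rho>)" "hat_word \<rho> \<sim>\<^sub>C\<^sub>K \<rho>" using Y \<tau>(1) h by auto
  show "Yamanouchi \<sigma> \<Longrightarrow> \<sigma> \<sim>\<^sub>C\<^sub>K \<rho> \<Longrightarrow> hat_word \<rho> = \<sigma>" using uniq h by simp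
qed

lemma des_hat_word:
  assumes "reduced \<rho>"
  shows "des (hat_word \<rho>) = alpha \<rho>" "\<not> virtual (hat_word \<rho>)" "reduced (hat_word \<rho>)"
proof -
  show r: "\<not> virtual (hat_word \<rho>)" "reduced (hat_word \<rho>)"
    using hat_word(1)[OF assms] by (auto simp: Yamanouchi_def)
  show "des (hat_word \<rho>) = alpha \<rho>"
    using Yamanouchi_iff[OF r(2,1)] hat_word(1)[OF assms] alpha_ck[OF r(2) hat_word(2)[OF assms]] by simp
qed

lemma dom_P_hat_word: "reduced \<rho> \<Longrightarrow> dom (P_hat_word \<rho>) = diag (alpha \<rho>)"
  using dom_WeakDesTab_diag des_hat_word by (simp add: P_hat_word_def)

subsection \<open>Increasing factorizations\<close>

fun fact_biword :: "nat list list \<Rightarrow> (nat \<times> nat) list" where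
  "fact_biword [] = []"
| "fact_biword (c # f) = map (Pair (Suc (length f))) c @ fact_biword f"

lemma map_snd_fact_biword: "map snd (fact_biword f) = concat f"
  by (induction f) (simp_all add: comp_def)

lemma fact_biword_labels: "p \<in> set (fact_biword f) \<Longrightarrow> 1 \<le> fst p \<and> fst p \<le> length f"
  by (induction f) auto

lemma set_fact_biword:
  "(i, x) \<in> set (fact_biword f) \<longleftrightarrow> i \<in> {1..length f} \<and> x \<in> set (component f i)"
proof (induction f)
  case (Cons c f)
  consider "i = Suc (length f)" | "i \<in> {1..length f}" | "i \<notin> {1..Suc (length f)}" by fastforce
  then show ?case
  proof cases
    case 1
    then have "(i, x) \<notin> set (fact_biword f)" using fact_biword_labels[of "(i, x)" f] by auto
    then show ?thesis using 1 by (auto simp: component_def)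
  next
    case 2
    then have "component (c # f) i = component f i" by (simp add: component_def Suc_diff_le)
    then show ?thesis using Cons 2 by auto
  next
    case 3
    then show ?thesis using fact_biword_labels[of "(i, x)" "c # f"] by auto
  qed
qed simp

lemma sorted_fact_biword:
  assumes "\<forall>s\<in>set f. sorted_wrt (<) s"
  shows "sorted_wrt bw_rel (fact_biword f)"
  using assms
proof (induction f)
  case (Cons c f)
  have "bw_rel p q" if "p \<in> set (map (Pair (Suc (length f))) c)" "q \<in> set (fact_biword f)" for p q
    using that fact_biword_labels[of q f] by (auto simp: bw_rel_def)
  moreover have "sorted_wrt bw_rel (map (Pair (Suc (length f))) c)"
    using Cons.prems by (simp add: sorted_wrt_map bw_rel_def)
  ultimately show ?case using Cons by (simp add: sorted_wrt_append)
qed simp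

text \<open>A biword forgets empty components, but these are restored from the missing labels once
  the number of components is known.\<close>

lemma fact_biword_eq_length:
  "length f = length g \<Longrightarrow> fact_biword f = fact_biword g \<Longrightarrow> f = g"
proof (induction f g rule: list_induct2)
  case (Cons c f d g)
  have sep: "filter (\<lambda>p. fst p = Suc (length h)) (fact_biword (e # h)) = map (Pair (Suc (length h))) e"
    "filter (\<lambda>p. fst p \<noteq> Suc (length h)) (fact_biword (e # h)) = fact_biword h" for e h
  proof -
    have "filter (\<lambda>p. fst p = Suc (length h)) (fact_biword h) = []"
      "filter (\<lambda>p. fst p \<noteq> Suc (length h)) (fact_biword h) = fact_biword h"
      using fact_biword_labels[of _ h] by (fastforce simp: filter_empty_conv filter_id_conv)+
    then show "filter (\<lambda>p. fst p = Suc (length h)) (fact_biword (e # h)) = map (Pair (Suc (length h))) e"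
      "filter (\<lambda>p. fst p \<noteq> Suc (length h)) (fact_biword (e # h)) = fact_biword h"
      by (simp_all add: filter_map comp_def)
  qed
  have "map (Pair (Suc (length f))) c = map (Pair (Suc (length f))) d"
    using sep(1)[of f c] sep(1)[of g d] Cons.prems Cons.hyps by metis
  then have "map snd (map (Pair (Suc (length f))) c) = map snd (map (Pair (Suc (length f))) d)" by metis
  then have "c = d" by (simp add: comp_def)
  moreover have "fact_biword f = fact_biword g" using sep(2)[of f c] sep(2)[of g d] Cons.prems Cons.hyps by metis
  ultimately show ?case using Cons.IH by simp
qed simp

text \<open>For the chosen representatives the leftmost component is nonempty, so its label, the
  first one, is the number of components.\<close>

lemma length_from_fact_biword:
  assumes "f \<noteq> [] \<longrightarrow> hd f \<noteq> []"
  shows "length f = (if fact_biword f = [] then 0 else fst (hd (fact_biword f)))"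
proof (cases f)
  case (Cons c f')
  then show ?thesis using assms by (cases c) auto
qed simp

lemma fact_biword_inj:
  assumes "f \<noteq> [] \<longrightarrow> hd f \<noteq> []" "g \<noteq> [] \<longrightarrow> hd g \<noteq> []" "fact_biword f = fact_biword g"
  shows "f = g"
  using fact_biword_eq_length[of f g] length_from_fact_biword[OF assms(1)] length_from_fact_biword[OF assms(2)]
    assms(3) by simp

lemma fact_biword_surj:
  "sorted_wrt bw_rel bw \<Longrightarrow> \<forall>p\<in>set bw. 1 \<le> fst p \<and> fst p \<le> n \<Longrightarrow>
   \<exists>f. length f = n \<and> fact_biword f = bw \<and> (\<forall>s\<in>set f. sorted_wrt (<) s)"
proof (induction n arbitrary: bw)
  case 0
  then have "bw = []" by (cases bw) auto
  then show ?case by (intro exI[of _ "[]"]) simp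
next
  case (Suc n)
  define a where "a = takeWhile (\<lambda>p. fst p = Suc n) bw"
  define b where "b = dropWhile (\<lambda>p. fst p = Suc n) bw"
  have bw: "bw = a @ b" by (simp add: a_def b_def)
  have sa: "sorted_wrt bw_rel a" "sorted_wrt bw_rel b" using Suc.prems(1) by (auto simp: bw sorted_wrt_append)
  have fa: "\<forall>p\<in>set a. fst p = Suc n" by (auto simp: a_def dest: set_takeWhileD)
  have "fst p \<le> n" if p: "p \<in> set b" for p
  proof -
    obtain q b' where q: "b = q # b'" using p by (cases b) auto
    have "fst q \<noteq> Suc n" using hd_dropWhile[of "\<lambda>p. fst p = Suc n" bw, folded b_def] q by simp
    then have "fst q \<le> n" using Suc.prems(2) q bw by force
    moreover have "p = q \<or> bw_rel q p" using sa(2) p q by auto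
    ultimately show ?thesis by (auto simp: bw_rel_def)
  qed
  then have "\<forall>p\<in>set b. 1 \<le> fst p \<and> fst p \<le> n" using Suc.prems(2) bw by auto
  then obtain f where f: "length f = n" "fact_biword f = b" "\<forall>s\<in>set f. sorted_wrt (<) s"
    using Suc.IH[OF sa(2)] by blast
  have a: "map (Pair (Suc n)) (map snd a) = a" using fa by (auto intro!: map_idI simp: prod_eq_iff)
  have "sorted_wrt (<) (map snd a)" using sa(1) unfolding sorted_wrt_map
    by (rule sorted_wrt_mono_rel[rotated]) (use fa in \<open>auto simp: bw_rel_def\<close>)
  then show ?case using f a bw by (intro exI[of _ "map snd a # f"]) simp
qed

text \<open>The first letter of a component is its smallest, so by monotonicity of
  \<open>\<phi>\<close> its bound carries over to all letters of the component.\<close>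

lemma flagged_factorization_iff:
  assumes "flag \<phi>" "\<forall>s\<in>set f. sorted_wrt (<) s" "\<forall>x\<in>set (concat f). 1 \<le> x"
  shows "flagged_factorization \<phi> f \<longleftrightarrow> (\<forall>p\<in>set (fact_biword f). fst p \<le> \<phi> (snd p))"
proof
  assume fl: "flagged_factorization \<phi> f"
  show "\<forall>p\<in>set (fact_biword f). fst p \<le> \<phi> (snd p)"
  proof
    fix p assume pf: "p \<in> set (fact_biword f)"
    obtain i x where p: "p = (i, x)" by force
    have p: "p = (i, x)" "i \<in> {1..length f}" "x \<in> set (component f i)"
      using p pf set_fact_biword[of i x f] by auto
    have mem: "component f i \<in> set f" using p(2) by (auto simp: component_def)
    obtain h t where c: "component f i = h # t" using p(3) by (cases "component f i") auto
    have "i \<le> \<phi> h" using bspec[OF fl[unfolded flagged_factorization_def] p(2)] c by simp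
    moreover have "1 \<le> h" using assms(3) mem c by auto
    moreover have "h \<le> x" using assms(2) mem c p(3) by fastforce
    ultimately show "fst p \<le> \<phi> (snd p)"
      using assms(1) p(1) unfolding flag_def mono_on_def by (metis atLeast_iff fst_conv order_trans snd_conv)
  qed
next
  assume a: "\<forall>p\<in>set (fact_biword f). fst p \<le> \<phi> (snd p)"
  show "flagged_factorization \<phi> f" unfolding flagged_factorization_def
  proof (intro ballI impI)
    fix i assume i: "i \<in> {1..length f}" "component f i \<noteq> []"
    then have "(i, hd (component f i)) \<in> set (fact_biword f)" by (simp add: set_fact_biword)
    then show "i \<le> \<phi> (hd (component f i))" using a by force
  qed
qed

section \<open>The recording tableau of a factorization\<close>

lemma upper_word_eq: "upper_word f i = map snd (filter (\<lambda>p. i \<le> fst p) (fact_biword f))"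
proof (induction f)
  case (Cons c f)
  have none: "filter (\<lambda>p. i \<le> fst p) (fact_biword f) = []" if "length f < i"
    using that fact_biword_labels[of _ f] by (fastforce simp: filter_empty_conv)
  show ?case
  proof (cases "i \<le> Suc (length f)")
    case True
    then have "Suc (length (c # f)) - i = Suc (Suc (length f) - i)" by simp
    then show ?thesis using Cons True by (simp add: upper_word_def filter_map comp_def)
  next
    case False
    then show ?thesis using none by (simp add: upper_word_def filter_map comp_def)
  qed
qed (simp add: upper_word_def)

text \<open>Labels weakly decrease, so the filter keeps a prefix of the biword, and the boxes of
  this prefix are those with entries at least \<open>i\<close>.\<close>

lemma rec_tab_filter:
  "biword bw \<Longrightarrow> (b \<in> dom (rec_tab (filter (\<lambda>p. i \<le> fst p) bw)) \<longleftrightarrow> (\<exists>j\<ge>i. rec_tab bw b = Some j)) \<and>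
   reduced (map snd (filter (\<lambda>p. i \<le> fst p) bw))"
proof (induction bw rule: rev_induct)
  case (snoc p bw)
  obtain l x where p: "p = (l, x)" by force
  note IH = snoc.IH[OF biword_snocD[OF snoc.prems]]
  show ?case
  proof (cases "i \<le> l")
    case True
    have "i \<le> fst q" if "q \<in> set (bw @ [p])" for q
      using snoc.prems that p True by (auto simp: biword_def sorted_wrt_append bw_rel_def)
    then have f: "filter (\<lambda>p. i \<le> fst p) (bw @ [p]) = bw @ [p]" by (simp add: filter_id_conv)
    have "i \<le> j" if "rec_tab (bw @ [p]) b = Some j" for j
      using biword_ran[OF snoc.prems that] \<open>\<And>q. q \<in> set (bw @ [p]) \<Longrightarrow> i \<le> fst q\<close> by blast
    then show ?thesis unfolding f using snoc.prems by (auto simp: biword_def)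
  next
    case False
    then have f: "filter (\<lambda>p. i \<le> fst p) (bw @ [p]) = filter (\<lambda>p. i \<le> fst p) bw" by (simp add: p)
    define b' where "b' = box (map snd bw) x"
    have T: "rec_tab (bw @ [p]) = (rec_tab bw)(b' \<mapsto> l)" unfolding p rec_tab_snoc b'_def ..
    have "rec_tab bw b' = None" using box_fresh[of bw x] snoc.prems by (simp add: p b'_def biword_def)
    then have "(\<exists>j\<ge>i. rec_tab (bw @ [p]) b = Some j) \<longleftrightarrow> (\<exists>j\<ge>i. rec_tab bw b = Some j)"
      unfolding T using False by (cases "b = b'") auto
    then show ?thesis using IH unfolding f by simp
  qed
qed (simp add: dom_def)

lemma biword_fact_biword:
  assumes "reduced (concat f)" "\<forall>s\<in>set f. sorted_wrt (<) s"
  shows "biword (fact_biword f)"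
  using assms sorted_fact_biword fact_biword_labels by (auto simp: biword_def map_snd_fact_biword)

text \<open>A box lies in the diagram of \<open>upper_word f i\<close> exactly when its entry is at
  least \<open>i\<close>, so the index at which it appears is its entry.\<close>

lemma Q_hat_eq:
  assumes "reduced (concat f)" "\<forall>s\<in>set f. sorted_wrt (<) s"
  shows "Q_hat f = rec_tab (fact_biword f)"
proof
  fix b
  define T where "T = rec_tab (fact_biword f)"
  have bi: "biword (fact_biword f)" by (rule biword_fact_biword[OF assms])
  have up: "b \<in> dom (P_hat_word (upper_word f i)) \<longleftrightarrow> (\<exists>j\<ge>i. T b = Some j)" for i
    using rec_tab_filter[OF bi, of b i] dom_P_hat_word[of "upper_word f i"]
      dom_rec_tab[of "filter (\<lambda>p. i \<le> fst p) (fact_biword f)"]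
    unfolding upper_word_eq T_def by blast
  have d: "dom (P_hat f) = dom T"
    using dom_P_hat_word[OF assms(1)] dom_rec_tab[of "fact_biword f"] assms(1)
    by (simp add: P_hat_def T_def map_snd_fact_biword)
  show "Q_hat f b = T b"
  proof (cases "T b")
    case None
    then have "b \<notin> dom (P_hat f)" using d by auto
    then show ?thesis using None by (simp add: Q_hat_def)
  next
    case (Some j)
    have "j \<in> fst ` set (fact_biword f)" using biword_ran[OF bi, of b j] Some by (simp add: T_def)
    then have j: "j \<in> {1..length f}" using fact_biword_labels by auto
    have "(THE i. i \<in> {1..length f} \<and> b \<in> dom (P_hat_word (upper_word f i)) \<and>
        b \<notin> dom (P_hat_word (upper_word f (i + 1)))) = j"
      unfolding up Some by (rule the_equality) (use j in auto)
    moreover have "b \<in> dom (P_hat f)" using d Some by auto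
    ultimately show ?thesis using Some unfolding Q_hat_def by simp
  qed
qed

section \<open>The insertion map\<close>

lemma RFC_D:
  assumes "f \<in> RFC w \<phi>"
  shows "reduced_word_for w (concat f)" "reduced (concat f)" "\<forall>s\<in>set f. sorted_wrt (<) s"
    "flagged_factorization \<phi> f" "f \<noteq> [] \<longrightarrow> hd f \<noteq> []"
  using assms by (auto simp: RFC_def increasing_factorization_def reduced_def)

lemma insertion_in_codomain:
  assumes "flag \<phi>" "f \<in> RFC w \<phi>"
  shows "(shape (P_hat f), P_hat f, Q_hat f) \<in>
    (SIGMA \<alpha>:{\<alpha>. weak_composition \<alpha> \<and> YR \<alpha> w \<noteq> {}}. YR_tab \<alpha> w \<times> SSKT \<alpha> \<phi>)"
proof -
  note f = RFC_D[OF assms(2)]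
  define \<rho> where "\<rho> = concat f"
  define bw where "bw = fact_biword f"
  have red: "reduced \<rho>" using f by (simp add: \<rho>_def)
  have bi: "biword bw" using biword_fact_biword f unfolding bw_def by blast
  have word: "map snd bw = \<rho>" by (simp add: bw_def \<rho>_def map_snd_fact_biword)
  have P: "P_hat f = WeakDesTab (hat_word \<rho>)" by (simp add: P_hat_def P_hat_word_def \<rho>_def)
  have sP: "shape (P_hat f) = alpha \<rho>"
    using shape_diag[OF dom_P_hat_word[OF red]] by (simp add: P_hat_def \<rho>_def)
  have Q: "Q_hat f = rec_tab bw" using Q_hat_eq f by (simp add: bw_def)
  have dQ: "dom (rec_tab bw) = diag (alpha \<rho>)" using dom_rec_tab[of bw] red word by simp
  have wc: "weak_composition (alpha \<rho>)"
    using alpha_0[OF red] finite_alpha[OF red] by (simp add: weak_composition_def)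
  have YR: "hat_word \<rho> \<in> YR (alpha \<rho>) w"
    using hat_word(1,2)[OF red] des_hat_word[OF red] reduced_word_for_ck[OF ck_sym[OF hat_word(2)[OF red]]] f(1)
    by (simp add: YR_def \<rho>_def)
  have "1 \<le> x" if "x \<in> set (concat f)" for x using reduced_pos[OF f(2) that] .
  then have "\<forall>p\<in>set bw. fst p \<le> \<phi> (snd p)"
    using flagged_factorization_iff[OF assms(1) f(3)] f(4) by (simp add: bw_def)
  then have "flagged_tableau \<phi> (rec_tab bw)" using flagged_rec_tab_iff[OF assms(1) bi] by simp
  then have "rec_tab bw \<in> SSKT (alpha \<rho>) \<phi>"
    using key_tableau_rec_tab[OF bi] positive_rows_diag[OF alpha_0[OF red] dQ] shape_diag[OF dQ]
    by (simp add: SSKT_def)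
  moreover have "P_hat f \<in> YR_tab (alpha \<rho>) w" using YR by (simp add: P YR_tab_def)
  ultimately show ?thesis using wc YR sP Q by auto
qed

lemma insertion_inj:
  assumes "f \<in> RFC w \<phi>" "g \<in> RFC w \<phi>" "P_hat f = P_hat g" "Q_hat f = Q_hat g"
  shows "f = g"
proof -
  note f = RFC_D[OF assms(1)] and g = RFC_D[OF assms(2)]
  have "hat_word (concat f) = hat_word (concat g)"
    using assms(3) by (intro WeakDesTab_inj) (simp add: P_hat_def P_hat_word_def)
  then have "concat f \<sim>\<^sub>C\<^sub>K concat g"
    using hat_word(2)[OF f(2)] hat_word(2)[OF g(2)] ck_sym ck_trans by metis
  moreover have "rec_tab (fact_biword f) = rec_tab (fact_biword g)"
    using assms(4) Q_hat_eq[OF f(2,3)] Q_hat_eq[OF g(2,3)] by simp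
  ultimately have "fact_biword f = fact_biword g"
    using biword_unique[OF biword_fact_biword[OF f(2,3)] biword_fact_biword[OF g(2,3)]]
    by (simp add: map_snd_fact_biword)
  then show ?thesis using fact_biword_inj f(5) g(5) by blast
qed

lemma insertion_surj:
  assumes "flag \<phi>" "\<sigma> \<in> YR \<alpha> w" "Q \<in> SSKT \<alpha> \<phi>"
  shows "\<exists>f\<in>RFC w \<phi>. P_hat f = WeakDesTab \<sigma> \<and> Q_hat f = Q \<and> shape (P_hat f) = \<alpha>"
proof -
  have \<sigma>: "reduced_word_for w \<sigma>" "Yamanouchi \<sigma>" "des \<sigma> = \<alpha>" using assms(2) by (auto simp: YR_def)
  have red: "reduced \<sigma>" "\<not> virtual \<sigma>" using \<sigma>(2) by (auto simp: Yamanouchi_def)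
  have a: "alpha \<sigma> = \<alpha>" using Yamanouchi_iff[OF red] \<sigma> by simp
  have Q: "key_tableau Q" "positive_rows Q" "shape Q = \<alpha>" "flagged_tableau \<phi> Q"
    using assms(3) by (auto simp: SSKT_def)
  have "dom Q = diag (alpha \<sigma>)"
    using is_tableau_diag[of Q] Q a by (simp add: key_tableau_def)
  then obtain bw where bw: "biword bw" "map snd bw \<sim>\<^sub>C\<^sub>K \<sigma>" "rec_tab bw = Q"
    using biword_exists[OF red(1) Q(1)] by blast
  \<comment> \<open>The first label is the largest, so this number of components suffices and makes
    the leftmost one nonempty.\<close>
  define n where "n = (if bw = [] then 0 else fst (hd bw))"
  have srt: "sorted_wrt bw_rel bw" using bw(1) by (simp add: biword_def)
  have "1 \<le> fst p \<and> fst p \<le> n" if "p \<in> set bw" for p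
  proof -
    obtain q b where q: "bw = q # b" using \<open>p \<in> set bw\<close> by (cases bw) auto
    have "p = q \<or> bw_rel q p" using srt \<open>p \<in> set bw\<close> q by auto
    then show ?thesis using bw(1) \<open>p \<in> set bw\<close> by (auto simp: biword_def n_def q bw_rel_def)
  qed
  then obtain f where f: "length f = n" "fact_biword f = bw" "\<forall>s\<in>set f. sorted_wrt (<) s"
    using fact_biword_surj[OF srt, of n] by blast
  have word: "concat f = map snd bw" using f(2) map_snd_fact_biword by metis
  have redf: "reduced (concat f)" using bw(1) by (simp add: word biword_def)
  have ck: "concat f \<sim>\<^sub>C\<^sub>K \<sigma>" using bw(2) word by simp
  have hd: "f \<noteq> [] \<longrightarrow> hd f \<noteq> []"
  proof
    assume ne: "f \<noteq> []"
    then obtain c f' where c: "f = c # f'" by (cases f) auto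
    show "hd f \<noteq> []"
    proof
      assume "hd f = []"
      then have "bw = fact_biword f'" using f(2) c by simp
      moreover have "bw \<noteq> []" using f(1) c by (auto simp: n_def)
      ultimately have "fst (hd bw) \<le> length f'" using fact_biword_labels[of "hd bw" f'] by simp
      then show False using f(1) c \<open>bw \<noteq> []\<close> by (simp add: n_def)
    qed
  qed
  have "\<forall>p\<in>set bw. fst p \<le> \<phi> (snd p)" using flagged_rec_tab_iff[OF assms(1) bw(1)] bw(3) Q(4) by simp
  moreover have "\<forall>x\<in>set (concat f). 1 \<le> x" using reduced_pos[OF redf] by blast
  ultimately have "flagged_factorization \<phi> f" using flagged_factorization_iff[OF assms(1) f(3)] f(2) by simp
  moreover have "reduced_word_for w (concat f)" using reduced_word_for_ck[OF ck_sym[OF ck] \<sigma>(1)] .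
  ultimately have "f \<in> RFC w \<phi>" using hd f(3) by (auto simp: RFC_def increasing_factorization_def)
  moreover have "P_hat f = WeakDesTab \<sigma>"
    using hat_word(3)[OF redf \<sigma>(2) ck_sym[OF ck]] by (simp add: P_hat_def P_hat_word_def)
  moreover have "Q_hat f = Q" using Q_hat_eq[OF redf f(3)] f(2) bw(3) by simp
  moreover have "shape (WeakDesTab \<sigma>) = \<alpha>" using \<sigma>(3) by (simp add: des_def)
  ultimately show ?thesis by auto
qed

theorem theorem3p29:
  fixes w \<phi> :: "nat \<Rightarrow> nat"
  assumes "w \<in> S_inf" and "flag \<phi>"
  shows "bij_betw (\<lambda>f. (shape (P_hat f), (P_hat f, Q_hat f)))
           (RFC w \<phi>)
           (SIGMA \<alpha>:{\<alpha>. weak_composition \<alpha> \<and> YR \<alpha> w \<noteq> {}}. YR_tab \<alpha> w \<times> SSKT \<alpha> \<phi>)"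
  unfolding bij_betw_def
proof
  show "inj_on (\<lambda>f. (shape (P_hat f), (P_hat f, Q_hat f))) (RFC w \<phi>)"
    by (rule inj_onI) (use insertion_inj in blast)
  show "(\<lambda>f. (shape (P_hat f), (P_hat f, Q_hat f))) ` RFC w \<phi> =
    (SIGMA \<alpha>:{\<alpha>. weak_composition \<alpha> \<and> YR \<alpha> w \<noteq> {}}. YR_tab \<alpha> w \<times> SSKT \<alpha> \<phi>)" (is "?F ` _ = ?C")
  proof
    show "?F ` RFC w \<phi> \<subseteq> ?C" using insertion_in_codomain[OF assms(2)] by blast
    show "?C \<subseteq> ?F ` RFC w \<phi>"
    proof
      fix t assume "t \<in> ?C"
      then obtain \<alpha> \<sigma> Q where t: "t = (\<alpha>, WeakDesTab \<sigma>, Q)" "\<sigma> \<in> YR \<alpha> w" "Q \<in> SSKT \<alpha> \<phi>"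
        by (auto simp: YR_tab_def)
      obtain f where "f \<in> RFC w \<phi>" "P_hat f = WeakDesTab \<sigma>" "Q_hat f = Q" "shape (P_hat f) = \<alpha>"
        using insertion_surj[OF assms(2) t(2,3)] by blast
      then show "t \<in> ?F ` RFC w \<phi>" using t(1) by (intro image_eqI[of _ _ f]) auto
    qed
  qed
qed

end
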